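(* Let $R>0$ and let $\alpha=\alpha_n>0$, $\beta=\beta_n>0$ depend on $n$ so that $\lim_{n\to\infty}n\beta_n=\infty$ and $\lim_{n\to\infty}\alpha_n/n=\lambda\ge1$, and, in the case $\lambda=1$, assume moreover $\alpha_n-n>\frac{2}{\beta_n}-1$ for all $n$ large enough. Then for $n$ large enough $Z_n<\infty$, so $P_n$ is well defined. Moreover, for any way of realizing random vectors $X_n\sim P_n$ ($n$ large) on a common probability space, almost surely \[ \lim_{n\to\infty}\mathrm{d}_{\mathrm{BL}}(\mu_{X_n},\mu_* )=0, \] where $\mu_*$ is the uniform probability distribution on the disc $D_{R/\sqrt{\lambda}}$.
   Context: $\ell_{\mathbb{C}}$ is Lebesgue measure on $\mathbb{C}$; $D_r=\{z\in\mathbb{C}:|z|\le r\}$. $\rho$ is the uniform probability measure on $D_R$ and $U_\rho(x)=-\int\log|x-y|\,\mathrm{d}\rho(y)$. For $n$ particles, with $\alpha=\alpha_n,\beta=\beta_n$, set $V=-\frac{\alpha_n}{n}U_\rho$, $E_n(x_1,\dots,x_n)=\sum_{i<j}-\log|x_i-x_j|+n\sum_{i=1}^nV(x_i)$, $Z_n=\int_{\mathbb{C}^n}e^{-\beta_n E_n}\,\mathrm{d}\ell_{\mathbb{C}}^{\otimes n}$, and when $Z_n<\infty$, $P_n=Z_n^{-1}e^{-\beta_n E_n}\,\mathrm{d}\ell_{\mathbb{C}}^{\otimes n}$. For $X_n=(X_{n,1},\dots,X_{n,n})\sim P_n$, the empirical measure is $\mu_{X_n}=\frac1n\sum_{k=1}^n\delta_{X_{n,k}}$.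 The bounded-Lipschitz distance between probability measures on $\mathbb{C}$ is $\mathrm{d}_{\mathrm{BL}}(\mu,\nu)=\sup\{\int f\,\mathrm{d}(\mu-\nu):\sup|f|\le1,\ |f(x)-f(y)|\le|x-y|\ \forall x,y\}$. *)

theory Defs
  imports "HOL-Probability.Probability"
begin

definition unif_disc :: "real \<Rightarrow> complex measure" where
  "unif_disc r = uniform_measure lborel (cball 0 r)"

definition log_pot :: "real \<Rightarrow> complex \<Rightarrow> real" where
  "log_pot R x = - (\<integral>y. ln (cmod (x - y)) \<partial>(unif_disc R))"

definition ext_pot :: "real \<Rightarrow> real \<Rightarrow> nat \<Rightarrow> complex \<Rightarrow> real" where
  "ext_pot R a n x = - (a / real n) * log_pot R x"

definition energy :: "real \<Rightarrow> real \<Rightarrow> nat \<Rightarrow> (nat \<Rightarrow> complex) \<Rightarrow> real" where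
  "energy R a n x =
     (\<Sum>(i,j)\<in>{(i,j). i < j \<and> j < n}. - ln (cmod (x i - x j)))
     + real n * (\<Sum>i<n. ext_pot R a n (x i))"

definition lebC :: "nat \<Rightarrow> (nat \<Rightarrow> complex) measure" where
  "lebC n = (\<Pi>\<^sub>M i\<in>{..<n}. (lborel :: complex measure))"

definition part_fun :: "real \<Rightarrow> real \<Rightarrow> real \<Rightarrow> nat \<Rightarrow> ennreal" where
  "part_fun R a b n = (\<integral>\<^sup>+ x. ennreal (exp (- b * energy R a n x)) \<partial>(lebC n))"

text \<open>Gibbs measure P_n (meaningful when Z_n is finite).\<close>
definition gibbs :: "real \<Rightarrow> real \<Rightarrow> real \<Rightarrow> nat \<Rightarrow> (nat \<Rightarrow> complex) measure" where
  "gibbs R a b n = density (lebC n)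
     (\<lambda>x. ennreal (exp (- b * energy R a n x) / enn2real (part_fun R a b n)))"

definition empirical :: "nat \<Rightarrow> (nat \<Rightarrow> complex) \<Rightarrow> complex measure" where
  "empirical n x = measure_pmf (pmf_of_multiset (image_mset x (mset_set {..<n})))"

definition dBL :: "complex measure \<Rightarrow> complex measure \<Rightarrow> real" where
  "dBL \<mu> \<nu> = (SUP f \<in> {f :: complex \<Rightarrow> real. (\<forall>x. \<bar>f x\<bar> \<le> 1) \<and> (\<forall>x y. \<bar>f x - f y\<bar> \<le> dist x y)}.
                 (\<integral>x. f x \<partial>\<mu>) - (\<integral>x. f x \<partial>\<nu>))"

end

(*
The energy splits as
  E = sum_{i<j} (-ln |x_i - x_j| + W x_i + W x_j) + (alpha - n + 1) sum_i W x_i,   W = -U_rho,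
and the Gaussian mixture -ln (|x - y|^2 + a) = int (exp (-t (|x - y|^2 + a)) - exp (-t)) dt / t
shows that the logarithmic energy of a neutral measure is positive, quantitatively so when
the measure is detected by a Lipschitz function. Together with the Euler-Lagrange conditions for the uniform
measure nu on the disc of radius R / sqrt lam (circle means of the logarithm), a configuration at
distance eps from nu has energy at least n^2 (J + c), where J is the energy of nu; particles far
from the origin are controlled by their repulsion on the sphere compactifying the plane.

In the critical case lam = 1 a single particle may escape to infinity and Z_n contains the factor
1 / eta with eta = beta (alpha - n + 1) - 2, which may be arbitrarily large. Both the upper bound of the weight
of the bad configurations and the lower bound of Z_n are therefore kept with this exact factor. In
the upper bound a small part of the repulsion, sum_{i<j} min (l x_i) (l x_j) with
l x = ln (1 + |x|^2) / 2, is set aside to make all the other particles integrable at infinity.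
The ratio is at most exp (-n) eventually, and the Borel-Cantelli lemma applies.
*)
theory Submission
  imports Defs "HOL-Complex_Analysis.Cauchy_Integral_Formula" "HOL-Real_Asymp.Real_Asymp"
begin

section \<open>Integration in the plane\<close>

text \<open>Outside the energy gap the losses are factors exp (C n) and exp (C beta n), while the
  gap gains exp (- c beta n^2); n beta -> infinity is what lets the gain win, even if beta tends to
  0. So c may depend neither on n, nor on beta, nor on the configuration, and explicit constants
  replace compactness. In particular the logarithm is truncated at a fixed scale a, so that the
  diagonal costs only order n. The quantity alpha - n + 1 is the confinement felt by one particle
  far away from the n - 1 others; its weight is integrable at infinity iff beta (alpha - n + 1) > 2.
  For lam > 1 it is of order n. For lam = 1 this inequality is its only lower bound, so none of it
  may be spent on the gap. Hence it is split into (1 - kappa) (lam - 1) n, which serves the gap and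
  vanishes for lam = 1, and a rest reserved for integrability. The margins of the rest and of the
  whole over 2 / beta agree up to the factor 2 / kappa, so the singular factors of the bad set and
  of Z_n cancel.\<close>

lemma cball_sets_borel [measurable]: "cball (c::complex) r \<in> sets borel"
  by simp

text \<open>Polar coordinates for radial functions: the half-lines \<open>{..a}\<close> generate the
  Borel sets, and on them the claim is the area of a disc.\<close>

lemma distr_cmod_lborel:
  "distr lborel borel cmod = density lborel (\<lambda>s. ennreal (2 * pi * s) * indicator {0..} s)"
proof (rule measure_eqI_generator_eq[where E = "range atMost" and \<Omega> = UNIV and A = "\<lambda>n. {..real n}"])
  show "Int_stable (range (atMost :: real \<Rightarrow> _))"
    by (auto simp: Int_stable_def)
  show "range atMost \<subseteq> Pow (UNIV :: real set)" by auto
  have ball: "emeasure (distr lborel borel cmod) {..a} = (if a < 0 then 0 else ennreal (pi * a\<^sup>2))" for a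
  proof -
    have "emeasure (distr lborel borel cmod) {..a} = emeasure lborel (cball (0::complex) a)"
      by (subst emeasure_distr) (auto intro!: arg_cong2[where f=emeasure] simp: mem_cball)
    also have "\<dots> = (if a < 0 then 0 else ennreal (pi * a\<^sup>2))"
      by (auto simp: emeasure_cball eval_unit_ball_vol)
    finally show ?thesis .
  qed
  show "emeasure (distr lborel borel cmod) X =
          emeasure (density lborel (\<lambda>s. ennreal (2 * pi * s) * indicator {0..} s)) X"
    if X: "X \<in> range atMost" for X
  proof -
    obtain a where a: "X = {..a}" using X by auto
    have "emeasure (density lborel (\<lambda>s. ennreal (2 * pi * s) * indicator {0..} s)) X
        = (\<integral>\<^sup>+ s. ennreal (2 * pi * s) * indicator {0..a} s \<partial>lborel)"
      unfolding a by (subst emeasure_density) (auto intro!: nn_integral_cong split: split_indicator)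
    also have "\<dots> = (if a < 0 then 0 else ennreal (pi * a\<^sup>2))"
    proof (cases "a < 0")
      case False
      have "(\<integral>\<^sup>+ s. ennreal (2 * pi * s) * indicator {0..a} s \<partial>lborel) = pi * a\<^sup>2 - pi * 0\<^sup>2"
        by (rule nn_integral_FTC_Icc) (use False in \<open>auto intro!: derivative_eq_intros\<close>)
      then show ?thesis using False by simp
    qed simp
    finally show ?thesis using ball a by simp
  qed
  show "emeasure (distr lborel borel cmod) {..real i} \<noteq> \<infinity>" for i by (simp add: ball)
  show "(\<Union>i. {..real i}) = UNIV"
    by (auto intro: real_arch_simple)
qed (auto simp: borel_eq_atMost)

lemma nn_integral_radial:
  fixes f :: "real \<Rightarrow> ennreal"
  assumes [measurable]: "f \<in> borel_measurable borel"
  shows "(\<integral>\<^sup>+ (x::complex). f (cmod x) \<partial>lborel) = (\<integral>\<^sup>+ s. ennreal (2 * pi * s) * f s * indicator {0..} s \<partial>lborel)"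
proof -
  have "(\<integral>\<^sup>+ (x::complex). f (cmod x) \<partial>lborel) = (\<integral>\<^sup>+ s. f s \<partial>distr lborel borel cmod)"
    by (subst nn_integral_distr) auto
  then show ?thesis
    unfolding distr_cmod_lborel by (subst (asm) nn_integral_density) (auto simp: ac_simps)
qed

lemma nn_integral_lborel_translate:
  fixes f :: "'a::euclidean_space \<Rightarrow> ennreal"
  assumes [measurable]: "f \<in> borel_measurable borel"
  shows "(\<integral>\<^sup>+ x. f (c + x) \<partial>lborel) = (\<integral>\<^sup>+ x. f x \<partial>lborel)"
  by (subst (2) lborel_distr_plus[of c, symmetric], subst nn_integral_distr) auto

lemma nn_integral_lborel_reflect:
  fixes f :: "'a::euclidean_space \<Rightarrow> ennreal"
  assumes [measurable]: "f \<in> borel_measurable borel"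
  shows "(\<integral>\<^sup>+ x. f (c - x) \<partial>lborel) = (\<integral>\<^sup>+ x. f x \<partial>lborel)"
proof -
  have "lborel = distr lborel borel (\<lambda>x. c - x)"
    using lborel_affine[of "-1" c] by (simp add: density_1)
  then show ?thesis
    using nn_integral_distr[of "\<lambda>x. c - x" lborel borel f] by simp
qed

text \<open>The rotated measure is translation invariant and agrees with Lebesgue measure on discs;
  evaluating a double integral in two ways (as in the uniqueness proof of Haar measure)
  shows that the two measures are equal.\<close>

lemma lborel_distr_rotation:
  fixes c :: complex
  assumes c: "cmod c = 1"
  shows "distr lborel borel ((*) c) = lborel"
proof -
  define M where "M = distr lborel borel ((*) c)"
  have [simp, measurable_cong]: "sets M = sets borel" by (simp add: M_def)
  have c0: "c \<noteq> 0" using c by auto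
  have trans: "(\<integral>\<^sup>+ x. f (a + x) \<partial>M) = (\<integral>\<^sup>+ x. f x \<partial>M)" if [measurable]: "f \<in> borel_measurable borel" for f a
  proof -
    have "(\<integral>\<^sup>+ x. f (a + x) \<partial>M) = (\<integral>\<^sup>+ x. f (a + c * x) \<partial>lborel)"
      unfolding M_def by (subst nn_integral_distr) auto
    also have "\<dots> = (\<integral>\<^sup>+ x. (\<lambda>x. f (c * x)) (a / c + x) \<partial>lborel)"
      using c0 by (simp add: algebra_simps)
    also have "\<dots> = (\<integral>\<^sup>+ x. f (c * x) \<partial>lborel)"
      by (rule nn_integral_lborel_translate) auto
    also have "\<dots> = (\<integral>\<^sup>+ x. f x \<partial>M)"
      unfolding M_def by (subst nn_integral_distr) auto
    finally show ?thesis .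
  qed
  have MB: "emeasure M (cball 0 r) = emeasure lborel (cball (0::complex) r)" for r
    unfolding M_def
    by (subst emeasure_distr) (use c in \<open>auto intro!: arg_cong2[where f=emeasure] simp: norm_mult\<close>)
  interpret M: sigma_finite_measure M
  proof (standard, intro exI[of _ "range (\<lambda>n. cball 0 (real n))"] conjI)
    show "\<Union> (range (\<lambda>n. cball 0 (real n))) = space M"
      by (auto simp: M_def intro: real_arch_simple)
    show "\<forall>a\<in>range (\<lambda>n. cball 0 (real n)). emeasure M a \<noteq> \<infinity>"
      using emeasure_bounded_finite[of "cball 0 _ :: complex set"] by (auto simp: MB less_top)
  qed (auto simp: M_def)
  interpret P: pair_sigma_finite M "lborel :: complex measure" ..
  show ?thesis unfolding M_def[symmetric]
  proof (rule measure_eqI)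
    fix E assume "E \<in> sets M"
    then have E[measurable]: "E \<in> sets borel" by simp
    define B where "B = cball (0::complex) 1"
    have [measurable]: "B \<in> sets borel" by (simp add: B_def)
    have "emeasure M E * emeasure lborel B = (\<integral>\<^sup>+ x. indicator E x * (\<integral>\<^sup>+ y. indicator B y \<partial>lborel) \<partial>M)"
      by (subst nn_integral_multc) auto
    also have "\<dots> = (\<integral>\<^sup>+ x. indicator E x * (\<integral>\<^sup>+ y. indicator B (- x + y) \<partial>lborel) \<partial>M)"
      by (subst nn_integral_lborel_translate) auto
    also have "\<dots> = (\<integral>\<^sup>+ x. (\<integral>\<^sup>+ y. indicator E x * indicator B (- x + y) \<partial>lborel) \<partial>M)"
      by (subst nn_integral_cmult) auto
    also have "\<dots> = (\<integral>\<^sup>+ y. (\<integral>\<^sup>+ x. indicator E x * indicator B (- x + y) \<partial>M) \<partial>lborel)"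
      by (rule P.Fubini'[symmetric]) measurable
    also have "\<dots> = (\<integral>\<^sup>+ y. (\<integral>\<^sup>+ x. indicator E (y + x) * indicator B (- (y + x) + y) \<partial>M) \<partial>lborel)"
      by (intro nn_integral_cong trans[where f="\<lambda>x. indicator E x * indicator B (- x + _)", symmetric]) measurable
    \<comment> \<open>The argument \<open>- (y + x) + y\<close> is \<open>- x\<close>, and a disc is
      symmetric. Being a disc, \<open>B\<close> is also a set on which both measures are known to
      agree.\<close>
    also have "\<dots> = (\<integral>\<^sup>+ y. (\<integral>\<^sup>+ x. indicator E (y + x) * indicator B x \<partial>M) \<partial>lborel)"
      by (simp add: B_def indicator_def)
    also have "\<dots> = (\<integral>\<^sup>+ x. (\<integral>\<^sup>+ y. indicator E (y + x) * indicator B x \<partial>lborel) \<partial>M)"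
      by (rule P.Fubini') measurable
    also have "\<dots> = (\<integral>\<^sup>+ x. (\<integral>\<^sup>+ y. indicator E (x + y) \<partial>lborel) * indicator B x \<partial>M)"
      by (subst nn_integral_multc) (auto simp: add.commute)
    also have "\<dots> = (\<integral>\<^sup>+ x. emeasure lborel E * indicator B x \<partial>M)"
      by (subst nn_integral_lborel_translate) auto
    also have "\<dots> = emeasure lborel E * emeasure lborel B"
      by (subst nn_integral_cmult) (auto simp: MB B_def)
    finally have "emeasure M E * emeasure lborel B = emeasure lborel E * emeasure lborel B" .
    moreover have "emeasure lborel B = ennreal pi"
      by (simp add: B_def emeasure_cball eval_unit_ball_vol)
    ultimately show "emeasure M E = emeasure lborel E"
      by (metis ennreal_mult_divide_eq ennreal_neq_top ennreal_eq_0_iff not_le pi_gt_zero)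
  qed (simp add: M_def)
qed


lemma integral_lborel_rotation:
  fixes f :: "complex \<Rightarrow> real"
  assumes "cmod c = 1" and [measurable]: "f \<in> borel_measurable borel"
  shows "(\<integral>x. f (c * x) \<partial>lborel) = (\<integral>x. f x \<partial>lborel)"
  by (subst (2) lborel_distr_rotation[OF assms(1), symmetric], subst integral_distr) auto

section \<open>Circle and disc means of the logarithm\<close>

text \<open>Mean value property: |z| < 1 keeps \<open>1 - z * w\<close> off the branch cut for |w|
  \<le> 1, so \<open>Ln (1 - z * w)\<close> is holomorphic in w on the closed disc, with value 0 at
  the centre. Cauchy's formula and real parts do the rest.\<close>

lemma circle_mean_Ln:
  fixes z :: complex
  assumes z: "cmod z < 1"
  shows "(\<integral>t. indicator {0..1} t * ln (cmod (1 - z * exp (2 * pi * \<i> * of_real t))) \<partial>lborel) = 0"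
proof -
  have ne: "1 - z * w \<notin> \<real>\<^sub>\<le>\<^sub>0" if "cmod w \<le> 1" for w
  proof
    assume "1 - z * w \<in> \<real>\<^sub>\<le>\<^sub>0"
    then have "Re (z * w) \<ge> 1" by (auto simp: complex_nonpos_Reals_iff)
    moreover have "Re (z * w) \<le> cmod z * cmod w"
      using complex_Re_le_cmod[of "z * w"] by (simp add: norm_mult)
    moreover have "cmod z * cmod w \<le> cmod z * 1" by (rule mult_left_mono) (use that in auto)
    ultimately show False using z by linarith
  qed
  define g where "g t = exp (2 * pi * \<i> * of_real t)" for t :: real
  have ng: "cmod (g t) = 1" for t
    by (simp add: g_def norm_exp_eq_Re)
  have hol: "(\<lambda>w. Ln (1 - z * w)) holomorphic_on cball 0 1"
    by (intro holomorphic_intros) (use ne in auto)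
  have "((\<lambda>u. Ln (1 - z * u) / (u - 0)) has_contour_integral
      (2 * of_real pi * \<i> * Ln (1 - z * 0))) (circlepath 0 1)"
    by (rule Cauchy_integral_circlepath_simple[OF hol]) auto
  moreover have "circlepath 0 1 t = g t" for t
    by (simp add: circlepath g_def)
  ultimately have "((\<lambda>t. Ln (1 - z * g t) / g t * (2 * pi * \<i> * g t)) has_integral 0) {0..1}"
    unfolding has_contour_integral vector_derivative_circlepath by (simp add: g_def)
  then have "((\<lambda>t. Ln (1 - z * g t) * (2 * pi * \<i>)) has_integral 0) {0..1}"
    by (rule has_integral_eq[rotated]) (simp add: g_def)
  from has_integral_mult_left[OF this, of "1 / (2 * pi * \<i>)"]
  have "((\<lambda>t. Ln (1 - z * g t)) has_integral 0) {0..1}"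
    by (simp add: mult.assoc)
  from has_integral_Re[OF this]
  have "((\<lambda>t. Re (Ln (1 - z * g t))) has_integral 0) {0..1}" by simp
  moreover have "Re (Ln (1 - z * g t)) = ln (cmod (1 - z * g t))" for t
    using ne[of "g t"] ng[of t] by (subst Re_Ln) auto
  ultimately have hi: "((\<lambda>t. ln (cmod (1 - z * g t))) has_integral 0) {0..1}" by simp
  have "continuous_on {0..1} (\<lambda>t. ln (cmod (1 - z * g t)))"
    using ne ng unfolding g_def by (intro continuous_intros) (metis nonpos_Reals_zero_I norm_eq_zero order_refl)
  then have "set_integrable lborel {0..1} (\<lambda>t. ln (cmod (1 - z * g t)))"
    by (rule borel_integrable_atLeastAtMost')
  from set_borel_integral_eq_integral(2)[OF this] integral_unique[OF hi]
  show ?thesis by (simp add: set_lebesgue_integral_def g_def)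
qed

text \<open>The larger modulus is factored out, which leaves \<open>1 - z * g t\<close> with |z| <
  1. Equal moduli would put the singularity on the circle; that case is a null set of y in the
  disc.\<close>

lemma circle_mean_ln:
  fixes x y :: complex
  assumes "cmod x \<noteq> cmod y"
  shows "(\<integral>t. indicator {0..1} t * ln (cmod (x * exp (2 * pi * \<i> * of_real t) - y)) \<partial>lborel)
     = ln (max (cmod x) (cmod y))"
proof -
  define g where "g t = exp (2 * pi * \<i> * of_real t)" for t :: real
  have ng: "cmod (g t) = 1" for t
    by (simp add: g_def norm_exp_eq_Re)
  obtain z m where zm: "cmod z < 1" "m = max (cmod x) (cmod y)" "m > 0"
    "\<And>t. cmod (x * g t - y) = m * cmod (1 - z * g t)"
  proof (cases "cmod x < cmod y")
    case True
    then have "y \<noteq> 0" by auto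
    have "cmod (x * g t - y) = cmod y * cmod (1 - x / y * g t)" for t
      using \<open>y \<noteq> 0\<close> by (simp add: norm_minus_commute right_diff_distrib flip: norm_mult)
    then show ?thesis using True \<open>y \<noteq> 0\<close> by (intro that[of "x / y" "cmod y"]) (auto simp: norm_divide)
  next
    case False
    then have "x \<noteq> 0" "cmod y < cmod x" using assms by auto
    \<comment> \<open>On the unit circle the zero y / x inside is reflected to the outside: |g - w|
      = |1 - cnj w * g| whenever |g| = 1.\<close>
    have "cmod (x * g t - y) = cmod x * cmod (1 - cnj (y / x) * g t)" for t
    proof -
      have "g t * cnj (g t) = 1"
        using ng[of t] by (simp add: complex_mult_cnj cmod_def flip: of_real_power of_real_add)
      then have "g t * cnj (1 - cnj (y / x) * g t) = g t - y / x"
        by (simp add: algebra_simps)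
      then have "x * (g t * cnj (1 - cnj (y / x) * g t)) = x * g t - y"
        using \<open>x \<noteq> 0\<close> by (simp add: algebra_simps)
      then show ?thesis by (metis complex_mod_cnj mult_1 ng norm_mult)
    qed
    then show ?thesis using \<open>x \<noteq> 0\<close> \<open>cmod y < cmod x\<close>
      by (intro that[of "cnj (y / x)" "cmod x"]) (auto simp: norm_divide)
  qed
  have pos: "cmod (1 - z * g t) > 0" for t
  proof -
    have "cmod (z * g t) < 1" using zm(1) ng[of t] by (simp add: norm_mult)
    then have "z * g t \<noteq> 1" by auto
    then show ?thesis by simp
  qed
  have "continuous_on {0..1} (\<lambda>t. ln (cmod (1 - z * g t)))"
    using pos unfolding g_def by (intro continuous_intros) (auto simp: less_imp_neq[symmetric])
  then have int: "set_integrable lborel {0..1} (\<lambda>t. ln (cmod (1 - z * g t)))"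
    by (rule borel_integrable_atLeastAtMost')
  have "(\<integral>t. indicator {0..1} t * ln (cmod (x * g t - y)) \<partial>lborel)
     = (\<integral>t. indicator {0..1} t * ln m + indicator {0..1} t * ln (cmod (1 - z * g t)) \<partial>lborel)"
    using pos zm by (simp add: ln_mult ring_distribs)
  also have "\<dots> = (\<integral>t. indicator {0..1} (t::real) * ln m \<partial>lborel) + (\<integral>t. indicator {0..1} t * ln (cmod (1 - z * g t)) \<partial>lborel)"
    using int by (subst Bochner_Integration.integral_add[symmetric]) (auto simp: set_integrable_def)
  also have "\<dots> = ln m"
    using circle_mean_Ln[OF zm(1)] by (simp add: g_def)
  finally show ?thesis using zm by (simp add: g_def)
qed

text \<open>Beyond distance 1 from x the integrand is at most 1, within it the polar weight cancels
  the singularity. The bound is uniform in x, and it controls both the logarithm and the error of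
  truncating it.\<close>

lemma nn_integral_inverse_cmod_disc:
  "(\<integral>\<^sup>+ y. indicator (cball 0 R) y * ennreal (1 / cmod (x - y)) \<partial>lborel) \<le> ennreal (pi * R\<^sup>2 + 2 * pi)"
proof (cases "R \<ge> 0")
  case True
  have "(\<integral>\<^sup>+ y. indicator (cball 0 R) y * ennreal (1 / cmod (x - y)) \<partial>lborel) \<le>
    (\<integral>\<^sup>+ y. indicator (cball 0 R) y + indicator {0..1} (cmod (x - y)) * ennreal (1 / cmod (x - y)) \<partial>lborel)"
    by (intro nn_integral_mono) (auto split: split_indicator simp: ennreal_leI divide_simps)
  also have "\<dots> = emeasure lborel (cball 0 R :: complex set) +
      (\<integral>\<^sup>+ y. indicator {0..1} (cmod (x - y)) * ennreal (1 / cmod (x - y)) \<partial>lborel)"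
    by (subst nn_integral_add) auto
  also have "(\<integral>\<^sup>+ y. indicator {0..1} (cmod (x - y)) * ennreal (1 / cmod (x - y)) \<partial>lborel)
    = (\<integral>\<^sup>+ y. indicator {0..1} (cmod y) * ennreal (1 / cmod y) \<partial>lborel)"
    by (rule nn_integral_lborel_reflect[where f="\<lambda>y. indicator {0..1} (cmod y) * ennreal (1 / cmod y)"]) auto
  also have "\<dots> = (\<integral>\<^sup>+ s. ennreal (2 * pi * s) * (indicator {0..1} s * ennreal (1 / s)) * indicator {0..} s \<partial>lborel)"
    by (rule nn_integral_radial) auto
  also have "\<dots> \<le> (\<integral>\<^sup>+ s. ennreal (2 * pi) * indicator {0..1} (s::real) \<partial>lborel)"
    by (rule nn_integral_mono) (auto split: split_indicator simp: ennreal_mult'[symmetric])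
  also have "\<dots> = ennreal (2 * pi)" by (subst nn_integral_cmult) auto
  finally show ?thesis using True
    by (simp add: emeasure_cball eval_unit_ball_vol) 
qed (auto simp: )

text \<open>The case s = 0 is included because both sides are then 0 by the conventions for
  \<open>ln 0\<close> and division by 0.\<close>

lemma abs_ln_le: "\<bar>ln s\<bar> \<le> s + 1 / s" if "s \<ge> 0" for s :: real
proof (cases "s = 0")
  case False
  then have "ln s \<le> s" "- ln s \<le> 1 / s"
    using that ln_bound[of s] ln_bound[of "1/s"] by (auto simp: ln_div)
  then show ?thesis using that by (auto simp: abs_le_iff intro: order_trans)
qed auto

lemma integrable_inverse_cmod_disc:
  "integrable lborel (\<lambda>y. indicator (cball 0 R) y * (1 / cmod (x - y)))"
proof (rule integrableI_nonneg)
  have "(\<integral>\<^sup>+ y. ennreal (indicator (cball 0 R) y * (1 / cmod (x - y))) \<partial>lborel)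
      \<le> ennreal (pi * R\<^sup>2 + 2 * pi)"
    using nn_integral_inverse_cmod_disc[of R x]
    by (simp add: ennreal_mult' ennreal_indicator del: ennreal_plus mult_1_right times_divide_eq_right)
  then show "(\<integral>\<^sup>+ y. ennreal (indicator (cball 0 R) y * (1 / cmod (x - y))) \<partial>lborel) < \<infinity>"
    by (auto intro: le_less_trans)
qed auto

lemma integrable_ln_cmod_disc:
  "integrable lborel (\<lambda>y. indicator (cball 0 R) y * ln (cmod (x - y)))"
proof (rule Bochner_Integration.integrable_bound)
  show "integrable lborel (\<lambda>y. indicator (cball 0 R) y * (cmod x + R) + indicator (cball 0 R) y * (1 / cmod (x - y)))"
    using emeasure_bounded_finite[of "cball 0 R :: complex set"]
    by (intro Bochner_Integration.integrable_add integrable_inverse_cmod_disc)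
      (auto intro!: integrable_mult_left integrable_real_indicator simp: less_top)
  have "\<bar>ln (cmod (x - y))\<bar> \<le> cmod x + R + 1 / cmod (x - y)" if "cmod y \<le> R" for y
    using abs_ln_le[of "cmod (x - y)"] norm_triangle_ineq4[of x y] norm_ge_zero[of "x - y"] that by linarith
  then have "\<bar>ln (cmod (x - y))\<bar> \<le> \<bar>cmod x + R + 1 / cmod (x - y)\<bar>" if "cmod y \<le> R" for y
    using that abs_ge_self order_trans by blast
  then show "AE y in lborel. norm (indicator (cball 0 R) y * ln (cmod (x - y))) \<le>
      norm (indicator (cball 0 R) y * (cmod x + R) + indicator (cball 0 R) y * (1 / cmod (x - y)))"
    by (intro AE_I2) (auto split: split_indicator)
qed auto

lemma AE_cmod_neq: "AE y in lborel. cmod y \<noteq> r"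
proof -
  have "sphere (0::complex) r \<in> null_sets lborel"
    using negligible_sphere[of "0::complex" r]
    by (simp add: negligible_iff_null_sets null_sets_completion_iff)
  then show ?thesis by (rule AE_I') auto
qed

text \<open>The disc is rotation invariant, so x may be replaced by \<open>x * g t\<close> and the
  result averaged over t. After Fubini the inner integral is the circle mean.\<close>

lemma disc_mean_ln:
  "(\<integral>y. indicator (cball 0 R) y * ln (cmod (x - y)) \<partial>lborel) =
   (\<integral>y. indicator (cball 0 R) y * ln (max (cmod x) (cmod y)) \<partial>lborel)"
proof -
  define g where "g t = exp (2 * pi * \<i> * of_real t)" for t :: real
  have ng: "cmod (g t) = 1" for t
    by (simp add: g_def norm_exp_eq_Re)
  have [measurable]: "g \<in> borel_measurable borel" unfolding g_def by measurable
  interpret pair_sigma_finite "lborel :: real measure" "lborel :: complex measure" ..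
  have rot: "cmod (x * g t - g t * y) = cmod (x - y)" for t y
    by (metis (no_types) mult.commute mult_1 ng norm_mult right_diff_distrib)
  have inv: "(\<integral>y. indicator (cball 0 R) y * F (cmod (x * g t - y)) \<partial>lborel) =
      (\<integral>y. indicator (cball 0 R) y * F (cmod (x - y)) \<partial>lborel)"
    if [measurable]: "F \<in> borel_measurable borel" for t and F :: "real \<Rightarrow> real"
  proof -
    have "(\<integral>y. indicator (cball 0 R) (g t * y) * F (cmod (x * g t - g t * y)) \<partial>lborel) =
       (\<integral>y. indicator (cball 0 R) y * F (cmod (x * g t - y)) \<partial>lborel)"
      by (rule integral_lborel_rotation[OF ng]) measurable
    moreover have "indicator (cball 0 R) (g t * y) = (indicator (cball 0 R) y :: real)" for y
      using ng by (auto simp: indicator_def norm_mult)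
    ultimately show ?thesis by (simp add: rot)
  qed
  let ?f = "\<lambda>t y. indicator {0..1} t * (indicator (cball 0 R) y * ln (cmod (x * g t - y)))"
  \<comment> \<open>By the same invariance the inner integral of the absolute value is constant in
    t, so integrability for a single x suffices.\<close>
  have int: "integrable (lborel \<Otimes>\<^sub>M lborel) (\<lambda>(t, y). ?f t y)"
  proof (rule lborel_pair.Fubini_integrable)
    have "(\<lambda>t. \<integral>y. norm (case (t, y) of (t, y) \<Rightarrow> ?f t y) \<partial>lborel) = 
      (\<lambda>t. indicator {0..1} t * (\<integral>y. indicator (cball 0 R) y * \<bar>ln (cmod (x - y))\<bar> \<partial>lborel))"
      by (intro ext) (simp add: abs_mult inv[where F="\<lambda>s. \<bar>ln s\<bar>"])
    then show "integrable lborel (\<lambda>t. \<integral>y. norm (case (t, y) of (t, y) \<Rightarrow> ?f t y) \<partial>lborel)" 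
      by (auto intro!: integrable_mult_left)
    show "AE t in lborel. integrable lborel (\<lambda>y. case (t, y) of (t, y) \<Rightarrow> ?f t y)"
      using integrable_ln_cmod_disc by (auto intro!: integrable_mult_right)
  qed measurable
  have "(\<integral>y. indicator (cball 0 R) y * ln (cmod (x - y)) \<partial>lborel) = 
    (\<integral>t. indicator {0..1} t * (\<integral>y. indicator (cball 0 R) y * ln (cmod (x - y)) \<partial>lborel) \<partial>(lborel::real measure))"
    by simp
  also have "\<dots> = (\<integral>t. (\<integral>y. ?f t y \<partial>lborel) \<partial>lborel)"
    by (simp add: inv)
  also have "\<dots> = (\<integral>y. (\<integral>t. ?f t y \<partial>lborel) \<partial>lborel)"
    by (rule lborel_pair.Fubini_integral[symmetric, OF int])
  also have "\<dots> = (\<integral>y. indicator (cball 0 R) y * (\<integral>t. indicator {0..1} t * ln (cmod (x * g t - y)) \<partial>lborel) \<partial>lborel)"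
    by (subst integral_mult_right_zero[symmetric]) (simp add: mult_ac)
  also have "\<dots> = (\<integral>y. indicator (cball 0 R) y * ln (max (cmod x) (cmod y)) \<partial>lborel)"
  proof (rule integral_cong_AE)
    show "AE y in lborel. indicator (cball 0 R) y * (\<integral>t. indicator {0..1} t * ln (cmod (x * g t - y)) \<partial>lborel)
       = indicator (cball 0 R) y * ln (max (cmod x) (cmod y))"
      using AE_cmod_neq[of "cmod x"] by eventually_elim (unfold g_def, subst circle_mean_ln, auto)
  qed auto
  finally show ?thesis .
qed

section \<open>The logarithmic potential of a disc\<close>

lemma sets_unif_disc [simp, measurable_cong]: "sets (unif_disc r) = sets borel"
  by (simp add: unif_disc_def)

lemma space_unif_disc [simp]: "space (unif_disc r) = UNIV"
  by (simp add: unif_disc_def)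

lemma prob_space_unif_disc: "r > 0 \<Longrightarrow> prob_space (unif_disc r)"
  unfolding unif_disc_def by (rule prob_space_uniform_measure) (auto simp: emeasure_cball eval_unit_ball_vol)

lemma unif_disc_density:
  assumes "r > 0"
  shows "unif_disc r = density lborel (\<lambda>y. ennreal (indicator (cball 0 r) y / (pi * r\<^sup>2)))"
  unfolding unif_disc_def uniform_measure_def using assms
  by (intro density_cong) (auto simp: emeasure_cball eval_unit_ball_vol divide_ennreal split: split_indicator
      simp flip: ennreal_1)

lemma integral_unif_disc:
  fixes f :: "complex \<Rightarrow> real"
  assumes "r > 0" and [measurable]: "f \<in> borel_measurable borel"
  shows "(\<integral>y. f y \<partial>unif_disc r) = (\<integral>y. indicator (cball 0 r) y * f y \<partial>lborel) / (pi * r\<^sup>2)"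
  unfolding unif_disc_density[OF assms(1)] by (subst integral_density) auto

lemma integrable_unif_disc:
  fixes f :: "complex \<Rightarrow> real"
  assumes "r > 0" and [measurable]: "f \<in> borel_measurable borel"
  shows "integrable (unif_disc r) f \<longleftrightarrow> integrable lborel (\<lambda>y. indicator (cball 0 r) y * f y)"
proof -
  have "integrable (unif_disc r) f \<longleftrightarrow> integrable lborel (\<lambda>y. (indicator (cball 0 r) y * f y) / (pi * r\<^sup>2))"
    unfolding unif_disc_density[OF assms(1)] by (subst integrable_density) auto
  also have "\<dots> \<longleftrightarrow> integrable lborel (\<lambda>y. indicator (cball 0 r) y * f y)"
    using assms(1) by (simp add: divide_inverse del: inverse_mult_distrib)
  finally show ?thesis .
qed

lemma AE_unif_disc: "r > 0 \<Longrightarrow> AE y in unif_disc r. cmod y \<le> r"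
  unfolding unif_disc_def by (rule AE_uniform_measureI) (auto simp: emeasure_cball eval_unit_ball_vol)

lemma borel_measurable_log_pot [measurable]: "r > 0 \<Longrightarrow> log_pot r \<in> borel_measurable borel"
proof -
  assume "r > 0"
  then interpret prob_space "unif_disc r" by (rule prob_space_unif_disc)
  show ?thesis unfolding log_pot_def[abs_def] by measurable
qed

lemma abs_ln_max_le: "\<bar>ln (max a b)\<bar> \<le> \<bar>ln a\<bar> + \<bar>ln b\<bar>" for a b :: real
  by (auto simp: max_def)

lemma integrable_ln_max_disc:
  "integrable lborel (\<lambda>y. indicator (cball 0 R) y * ln (max (cmod x) (cmod y)))"
proof (rule Bochner_Integration.integrable_bound)
  show "integrable lborel (\<lambda>y. indicator (cball 0 R) y * \<bar>ln (cmod x)\<bar> + \<bar>indicator (cball 0 R) y * ln (cmod (0 - y))\<bar>)"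
    using emeasure_bounded_finite[of "cball 0 R :: complex set"] integrable_ln_cmod_disc[of R 0]
    by (intro Bochner_Integration.integrable_add integrable_abs)
      (auto intro!: integrable_mult_left integrable_real_indicator simp: less_top)
  show "AE y in lborel. norm (indicator (cball 0 R) y * ln (max (cmod x) (cmod y))) \<le>
      norm (indicator (cball 0 R) y * \<bar>ln (cmod x)\<bar> + \<bar>indicator (cball 0 R) y * ln (cmod (0 - y))\<bar>)"
    using abs_ln_max_le by (intro AE_I2) (auto split: split_indicator)
qed auto

lemma log_pot_eq:
  assumes "R > 0"
  shows "log_pot R x = - (\<integral>y. indicator (cball 0 R) y * ln (max (cmod x) (cmod y)) \<partial>lborel) / (pi * R\<^sup>2)"
  unfolding log_pot_def using assms by (subst integral_unif_disc) (auto simp: disc_mean_ln)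

lemma log_pot_eq_unif:
  assumes "R > 0"
  shows "log_pot R x = - (\<integral>y. ln (max (cmod x) (cmod y)) \<partial>unif_disc R)"
  using assms by (subst integral_unif_disc) (auto simp: log_pot_eq)

lemma integrable_ln_cmod_unif: "R > 0 \<Longrightarrow> integrable (unif_disc R) (\<lambda>y. ln (cmod (x - y)))"
  by (subst integrable_unif_disc) (auto intro: integrable_ln_cmod_disc)

lemma integrable_ln_max_unif: "R > 0 \<Longrightarrow> integrable (unif_disc R) (\<lambda>y. ln (max (cmod x) (cmod y)))"
  by (subst integrable_unif_disc) (auto intro: integrable_ln_max_disc)

lemma log_pot_le_ln:
  assumes "R > 0" "x \<noteq> 0"
  shows "log_pot R x \<le> - ln (cmod x)"
proof -
  interpret prob_space "unif_disc R" using assms by (intro prob_space_unif_disc)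
  have "(\<integral>y. ln (cmod x) \<partial>unif_disc R) \<le> (\<integral>y. ln (max (cmod x) (cmod y)) \<partial>unif_disc R)"
    using assms by (intro integral_mono integrable_ln_max_unif) (auto intro!: ln_mono)
  then show ?thesis using prob_space by (simp add: log_pot_eq_unif assms)
qed

lemma log_pot_ge_ln:
  assumes "R > 0"
  shows "log_pot R x \<ge> - ln (max (cmod x) R)"
proof -
  interpret prob_space "unif_disc R" using assms by (intro prob_space_unif_disc)
  have "AE y in unif_disc R. ln (max (cmod x) (cmod y)) \<le> ln (max (cmod x) R)"
  proof -
    \<comment> \<open>At x = y = 0 the bound can fail for R < 1, since \<open>ln 0 = 0\<close>; this
      point is removed.\<close>
    have "AE y in unif_disc R. y \<noteq> 0"
      unfolding unif_disc_density[OF assms]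
      using AE_lborel_singleton[of "0::complex"] by (subst AE_density) auto
    with AE_unif_disc[OF assms] show ?thesis
      by eventually_elim (rule ln_mono, auto simp: less_max_iff_disj)
  qed
  then have "(\<integral>y. ln (max (cmod x) (cmod y)) \<partial>unif_disc R) \<le> (\<integral>y. ln (max (cmod x) R) \<partial>unif_disc R)"
    using assms by (intro integral_mono_AE integrable_ln_max_unif) auto
  then show ?thesis using prob_space by (simp add: log_pot_eq_unif assms)
qed

lemma log_pot_le_0:
  assumes "R > 0"
  shows "log_pot R x \<le> log_pot R 0"
proof -
  have "AE y in lborel. indicator (cball 0 R) y * ln (max (cmod 0) (cmod y)) \<le> indicator (cball 0 R) y * ln (max (cmod x) (cmod y))"
    using AE_lborel_singleton[of 0]
    by eventually_elim (auto intro!: mult_left_mono ln_mono split: split_indicator)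
  then have "(\<integral>y. indicator (cball 0 R) y * ln (max (cmod 0) (cmod y)) \<partial>lborel)
     \<le> (\<integral>y. indicator (cball 0 R) y * ln (max (cmod x) (cmod y)) \<partial>lborel)"
    by (intro integral_mono_AE integrable_ln_max_disc)
  then show ?thesis using assms by (simp add: log_pot_eq divide_right_mono del: max.absorb1 max.absorb2 max_absorb2)
qed

text \<open>\<open>exp (llog x)\<close> is sqrt (1 + |x|^2), the factor of stereographic projection:
  |x - y| divided by the factors of x and y is half the chordal distance. It grows like the
  potential at infinity, is nonnegative, and its exponentials have explicit radial
  integrals.\<close>

definition llog :: "complex \<Rightarrow> real" where
  "llog x = ln (1 + (cmod x)\<^sup>2) / 2"

lemma llog_nonneg: "llog x \<ge> 0"
  by (simp add: llog_def)

lemma borel_measurable_llog [measurable]: "llog \<in> borel_measurable borel"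
  unfolding llog_def[abs_def] by measurable

lemma log_pot_llog:
  assumes "R > 0"
  obtains C where "C \<ge> 0" "\<And>x. \<bar>- log_pot R x - llog x\<bar> \<le> C"
proof
  define C where "C = ln (1 + R\<^sup>2) / 2 + ln 2 + \<bar>log_pot R 0\<bar>"
  show "C \<ge> 0" by (simp add: C_def)
  show "\<bar>- log_pot R x - llog x\<bar> \<le> C" for x
  proof -
    have "ln (max (cmod x) R) * 2 = ln ((max (cmod x) R)\<^sup>2)"
      using assms by (subst ln_realpow) (auto simp: less_max_iff_disj)
    also have "\<dots> \<le> ln ((1 + (cmod x)\<^sup>2) * (1 + R\<^sup>2))"
    proof (rule ln_mono)
      show "(max (cmod x) R)\<^sup>2 \<le> (1 + (cmod x)\<^sup>2) * (1 + R\<^sup>2)"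
        by (auto simp: max_def algebra_simps intro: order_trans[of _ "R\<^sup>2 + 1"] add_increasing)
      show "0 < (max (cmod x) R)\<^sup>2" using assms by (auto simp: less_max_iff_disj zero_less_power)
    qed
    also have "\<dots> = ln (1 + (cmod x)\<^sup>2) + ln (1 + R\<^sup>2)"
      by (rule ln_mult_pos) (auto intro: add_pos_nonneg)
    finally have "- log_pot R x \<le> llog x + ln (1 + R\<^sup>2) / 2"
      using log_pot_ge_ln[OF assms, of x] by (simp add: llog_def)
    moreover have "llog x - ln 2 - \<bar>log_pot R 0\<bar> \<le> - log_pot R x"
    proof (cases "cmod x \<ge> 1")
      case True
      then have "1 + (cmod x)\<^sup>2 \<le> 4 * (cmod x)\<^sup>2" using one_le_power[of "cmod x" 2] by linarith
      then have "ln (1 + (cmod x)\<^sup>2) \<le> ln ((2 * cmod x)\<^sup>2)"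
        by (intro ln_mono) (auto intro: add_pos_nonneg simp: power_mult_distrib)
      also have "\<dots> = 2 * (ln 2 + ln (cmod x))"
        using True by (subst ln_realpow) (auto simp: ln_mult)
      finally have "llog x \<le> ln 2 + ln (cmod x)" by (simp add: llog_def)
      moreover have "x \<noteq> 0" using True by auto
      ultimately show ?thesis using log_pot_le_ln[OF assms, of x] by simp
    next
      case False
      then have "1 + (cmod x)\<^sup>2 \<le> 2" using power_mono[of "cmod x" 1 2] by simp
      then have "ln (1 + (cmod x)\<^sup>2) \<le> ln 2" by (intro ln_mono) (auto intro: add_pos_nonneg)
      then have "llog x \<le> ln 2" using ln_gt_zero[of "2::real"] unfolding llog_def by linarith
      then show ?thesis using log_pot_le_0[OF assms, of x] by linarith
    qed
    moreover have "ln (1 + R\<^sup>2) \<ge> 0" "ln (2::real) \<ge> 0" by auto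
    ultimately show ?thesis unfolding C_def by (intro abs_leI; linarith)
  qed
qed

text \<open>The left-hand side minus the right-hand side is, up to a positive factor, the integral of \<open>ln (max \<bar>x\<bar> \<bar>y\<bar>) - ln \<bar>y\<bar>\<close> over the annulus \<open>r < \<bar>y\<bar> \<le> R\<close>.\<close>

lemma euler_lagrange:
  assumes "0 < r" "r \<le> R"
  shows "log_pot r x - (R / r)\<^sup>2 * log_pot R x \<ge> log_pot r 0 - (R / r)\<^sup>2 * log_pot R 0"
    and "cmod x \<le> r \<Longrightarrow> log_pot r x - (R / r)\<^sup>2 * log_pot R x = log_pot r 0 - (R / r)\<^sup>2 * log_pot R 0"
proof -
  define N where "N x = (\<integral>y. (indicator (cball 0 R) y - indicator (cball 0 r) y) * ln (max (cmod x) (cmod y)) \<partial>lborel)" for x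
  have eq: "log_pot r x - (R / r)\<^sup>2 * log_pot R x = N x / (pi * r\<^sup>2)" for x
    using assms integrable_ln_max_disc
    by (simp add: log_pot_eq N_def left_diff_distrib field_simps)
  have int: "integrable lborel (\<lambda>y. (indicator (cball 0 R) y - indicator (cball 0 r) y) * ln (max (cmod x) (cmod y)))" for x
    using integrable_ln_max_disc unfolding left_diff_distrib by (intro Bochner_Integration.integrable_diff)
  have "N 0 \<le> N x" for x
    unfolding N_def
  proof (intro integral_mono_AE int)
    show "AE y in lborel. (indicator (cball 0 R) y - indicator (cball 0 r) y) * ln (max (cmod 0) (cmod y)) \<le>
       (indicator (cball 0 R) y - indicator (cball 0 r) y) * ln (max (cmod x) (cmod y))"
      using AE_lborel_singleton[of 0] by eventually_elim
        (use assms in \<open>auto intro!: mult_left_mono ln_mono split: split_indicator\<close>)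
  qed
  then show "log_pot r x - (R / r)\<^sup>2 * log_pot R x \<ge> log_pot r 0 - (R / r)\<^sup>2 * log_pot R 0"
    unfolding eq using assms by (intro divide_right_mono) auto
  have "N x = N 0" if "cmod x \<le> r"
    unfolding N_def using that assms by (intro Bochner_Integration.integral_cong) (auto split: split_indicator)
  then show "cmod x \<le> r \<Longrightarrow> log_pot r x - (R / r)\<^sup>2 * log_pot R x = log_pot r 0 - (R / r)\<^sup>2 * log_pot R 0"
    unfolding eq by simp
qed

section \<open>Gaussian and logarithmic energies of neutral measures\<close>

lemma nn_integral_gauss:
  assumes "a > 0"
  shows "(\<integral>\<^sup>+ z. ennreal (exp (- a * (cmod z)\<^sup>2)) \<partial>lborel) = ennreal (pi / a)"
proof -
  have "(\<integral>\<^sup>+ z. ennreal (exp (- a * (cmod z)\<^sup>2)) \<partial>lborel) =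
     (\<integral>\<^sup>+ s. ennreal (2 * pi * s) * ennreal (exp (- a * s\<^sup>2)) * indicator {0..} s \<partial>lborel)"
    by (rule nn_integral_radial) auto
  also have "\<dots> = (\<integral>\<^sup>+ s. ennreal (2 * pi * s * exp (- a * s\<^sup>2)) * indicator {0..} s \<partial>lborel)"
    by (intro nn_integral_cong) (auto simp: ennreal_mult' split: split_indicator)
  also have "\<dots> = 0 - (- pi / a * exp (- a * 0\<^sup>2))"
  proof (rule nn_integral_FTC_atLeast)
    show "((\<lambda>s. - pi / a * exp (- a * s\<^sup>2)) \<longlongrightarrow> 0) at_top"
      using assms by real_asymp
  qed (use assms in \<open>auto intro!: derivative_eq_intros\<close>)
  finally show ?thesis by simp
qed

lemma gauss_midpoint:
  "(cmod (x - z))\<^sup>2 + (cmod (y - z))\<^sup>2 = 2 * (cmod (z - (x + y) / 2))\<^sup>2 + (cmod (x - y))\<^sup>2 / 2"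
proof -
  have "(a - c)\<^sup>2 + (b - c)\<^sup>2 = 2 * (c - (a + b) / 2)\<^sup>2 + (a - b)\<^sup>2 / 2" for a b c :: real
    by (simp add: power2_eq_square field_simps)
  from this[of "Re x" "Re z" "Re y"] this[of "Im x" "Im z" "Im y"] show ?thesis
    by (simp add: cmod_power2 add_divide_distrib)
qed

text \<open>Gaussians of parameter 2 t are convolution square roots of the one of parameter t, up to
  a factor; completing the square at the midpoint of x and y shows it.\<close>

lemma nn_integral_gauss_prod:
  assumes "t > 0"
  shows "(\<integral>\<^sup>+ z. ennreal (exp (- 2 * t * (cmod (x - z))\<^sup>2)) * ennreal (exp (- 2 * t * (cmod (y - z))\<^sup>2)) \<partial>lborel)
    = ennreal (pi / (4 * t)) * ennreal (exp (- t * (cmod (x - y))\<^sup>2))"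
proof -
  have "exp (- 2 * t * (cmod (x - z))\<^sup>2) * exp (- 2 * t * (cmod (y - z))\<^sup>2) =
     exp (- (4 * t) * (cmod (- ((x + y) / 2) + z))\<^sup>2) * exp (- t * (cmod (x - y))\<^sup>2)" for z
  proof -
    have "- 2 * t * (cmod (x - z))\<^sup>2 + - 2 * t * (cmod (y - z))\<^sup>2 = - 2 * t * ((cmod (x - z))\<^sup>2 + (cmod (y - z))\<^sup>2)"
      by (simp add: algebra_simps)
    also have "\<dots> = - (4 * t) * (cmod (- ((x + y) / 2) + z))\<^sup>2 + - t * (cmod (x - y))\<^sup>2"
      unfolding gauss_midpoint by (simp add: algebra_simps)
    finally show ?thesis by (simp flip: exp_add)
  qed
  then have "(\<integral>\<^sup>+ z. ennreal (exp (- 2 * t * (cmod (x - z))\<^sup>2)) * ennreal (exp (- 2 * t * (cmod (y - z))\<^sup>2)) \<partial>lborel)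
    = (\<integral>\<^sup>+ z. ennreal (exp (- (4 * t) * (cmod (- ((x + y) / 2) + z))\<^sup>2)) \<partial>lborel) * ennreal (exp (- t * (cmod (x - y))\<^sup>2))"
    by (subst nn_integral_multc[symmetric]) (auto simp flip: ennreal_mult')
  also have "(\<integral>\<^sup>+ z. ennreal (exp (- (4 * t) * (cmod (- ((x + y) / 2) + z))\<^sup>2)) \<partial>lborel) = ennreal (pi / (4 * t))"
    using nn_integral_gauss[of "4 * t"] assms
    by (subst nn_integral_lborel_translate[where f="\<lambda>z. ennreal (exp (- (4 * t) * (cmod z)\<^sup>2))"]) auto
  finally show ?thesis .
qed

definition bform :: "(real \<Rightarrow> real) \<Rightarrow> complex measure \<Rightarrow> complex measure \<Rightarrow> real" where
  "bform k M N = (\<integral>p. k ((cmod (fst p - snd p))\<^sup>2) \<partial>(M \<Otimes>\<^sub>M N))"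

text \<open>The energy of the signed measure M - N, expanded so that only probability measures
  occur.\<close>

definition dform :: "(real \<Rightarrow> real) \<Rightarrow> complex measure \<Rightarrow> complex measure \<Rightarrow> real" where
  "dform k M N = bform k M M - bform k M N - bform k N M + bform k N N"

text \<open>Convolution of M with the square root, in the sense of convolution, of the kernel exp (-
  t |x - y|^2).\<close>

definition gsmooth :: "real \<Rightarrow> complex measure \<Rightarrow> complex \<Rightarrow> real" where
  "gsmooth t M z = (\<integral>x. exp (- 2 * t * (cmod (x - z))\<^sup>2) \<partial>M)"

locale bprob = prob_space M for M :: "complex measure" +
  assumes sets_b [simp, measurable_cong]: "sets M = sets borel"
begin

lemma space_b [simp]: "space M = UNIV"
  using sets_eq_imp_space_eq[OF sets_b] by simp

lemma gsmooth_nn: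
  assumes "t \<ge> 0"
  shows "ennreal (gsmooth t M z) = (\<integral>\<^sup>+ x. ennreal (exp (- 2 * t * (cmod (x - z))\<^sup>2)) \<partial>M)"
  unfolding gsmooth_def
  by (rule nn_integral_eq_integral[symmetric]) (use assms in \<open>auto intro!: integrable_const_bound[where B=1]\<close>)

lemma gsmooth_nonneg: "gsmooth t M z \<ge> 0"
  unfolding gsmooth_def by simp

lemma borel_measurable_gsmooth [measurable]: "gsmooth t M \<in> borel_measurable borel"
  unfolding gsmooth_def[abs_def] by measurable

end

lemma bprob_unif: "r > 0 \<Longrightarrow> bprob (unif_disc r)"
  by (simp add: bprob_def bprob_axioms_def prob_space_unif_disc)

locale bprob_pair = M: bprob M + N: bprob N for M N
begin

sublocale P: pair_prob_space M N ..

lemma integrable_exp_kernel: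
  assumes "t \<ge> 0"
  shows "integrable (M \<Otimes>\<^sub>M N) (\<lambda>p. exp (- t * (cmod (fst p - snd p))\<^sup>2))"
  by (rule P.integrable_const_bound[where B=1]) (use assms in auto)

lemma bform_exp_nn:
  assumes "t \<ge> 0"
  shows "ennreal (bform (\<lambda>q. exp (- t * q)) M N) = (\<integral>\<^sup>+ x. \<integral>\<^sup>+ y. ennreal (exp (- t * (cmod (x - y))\<^sup>2)) \<partial>N \<partial>M)"
  unfolding bform_def
  by (subst nn_integral_eq_integral[symmetric])
    (use integrable_exp_kernel[OF assms] in \<open>auto simp: N.nn_integral_fst[symmetric]\<close>)

lemma bform_exp_gsmooth:
  assumes t: "t > 0"
  shows "integrable lborel (\<lambda>z. gsmooth t M z * gsmooth t N z)"
    and "(\<integral>z. gsmooth t M z * gsmooth t N z \<partial>lborel) = pi / (4 * t) * bform (\<lambda>q. exp (- t * q)) M N"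
proof -
  let ?p = "\<lambda>x z. ennreal (exp (- 2 * t * (cmod (x - z))\<^sup>2))"
  interpret ML1: pair_sigma_finite M "lborel :: complex measure" ..
  interpret NL: pair_sigma_finite N "lborel :: complex measure" ..
  have "(\<integral>\<^sup>+ z. ennreal (gsmooth t M z * gsmooth t N z) \<partial>lborel) =
      (\<integral>\<^sup>+ z. (\<integral>\<^sup>+ x. ?p x z * (\<integral>\<^sup>+ y. ?p y z \<partial>N) \<partial>M) \<partial>lborel)"
    using t by (simp add: ennreal_mult M.gsmooth_nonneg N.gsmooth_nonneg M.gsmooth_nn N.gsmooth_nn nn_integral_multc)
  also have "\<dots> = (\<integral>\<^sup>+ x. (\<integral>\<^sup>+ z. ?p x z * (\<integral>\<^sup>+ y. ?p y z \<partial>N) \<partial>lborel) \<partial>M)"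
    by (rule ML1.Fubini') measurable
  also have "\<dots> = (\<integral>\<^sup>+ x. (\<integral>\<^sup>+ z. (\<integral>\<^sup>+ y. ?p x z * ?p y z \<partial>N) \<partial>lborel) \<partial>M)"
    by (simp add: nn_integral_cmult)
  also have "\<dots> = (\<integral>\<^sup>+ x. (\<integral>\<^sup>+ y. (\<integral>\<^sup>+ z. ?p x z * ?p y z \<partial>lborel) \<partial>N) \<partial>M)"
    by (intro nn_integral_cong NL.Fubini') measurable
  also have "\<dots> = (\<integral>\<^sup>+ x. (\<integral>\<^sup>+ y. ennreal (pi / (4 * t)) * ennreal (exp (- t * (cmod (x - y))\<^sup>2)) \<partial>N) \<partial>M)"
    using nn_integral_gauss_prod[OF t] by simp
  also have "\<dots> = ennreal (pi / (4 * t)) * ennreal (bform (\<lambda>q. exp (- t * q)) M N)"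
    using bform_exp_nn[of t] t by (simp add: nn_integral_cmult)
  also have "\<dots> = ennreal (pi / (4 * t) * bform (\<lambda>q. exp (- t * q)) M N)"
    using t by (subst ennreal_mult') auto
  finally have *: "(\<integral>\<^sup>+ z. ennreal (gsmooth t M z * gsmooth t N z) \<partial>lborel) = ennreal (pi / (4 * t) * bform (\<lambda>q. exp (- t * q)) M N)" .
  then show "integrable lborel (\<lambda>z. gsmooth t M z * gsmooth t N z)"
    by (intro integrableI_nonneg) (auto simp: M.gsmooth_nonneg N.gsmooth_nonneg)
  have "bform (\<lambda>q. exp (- t * q)) M N \<ge> 0" by (simp add: bform_def)
  then show "(\<integral>z. gsmooth t M z * gsmooth t N z \<partial>lborel) = pi / (4 * t) * bform (\<lambda>q. exp (- t * q)) M N"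
    using * t by (subst integral_eq_nn_integral) (auto simp: M.gsmooth_nonneg N.gsmooth_nonneg)
qed

end

text \<open>Positive definiteness of the Gaussian kernel in explicit form: the energy of M - N is a
  multiple of the squared L2 norm of its smoothing. The identity is needed for lower bounds, not
  only the sign.\<close>

lemma dform_exp:
  assumes "bprob M" "bprob N" "t > 0"
  shows "integrable lborel (\<lambda>z. (gsmooth t M z - gsmooth t N z)\<^sup>2)"
    and "dform (\<lambda>q. exp (- t * q)) M N = 4 * t / pi * (\<integral>z. (gsmooth t M z - gsmooth t N z)\<^sup>2 \<partial>lborel)"
proof -
  interpret M: bprob M by fact
  interpret N: bprob N by fact
  interpret MM: bprob_pair M M ..
  interpret MN: bprob_pair M N ..
  interpret NM: bprob_pair N M ..
  interpret NN: bprob_pair N N ..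
  note i = MM.bform_exp_gsmooth[OF assms(3)] MN.bform_exp_gsmooth[OF assms(3)]
    NM.bform_exp_gsmooth[OF assms(3)] NN.bform_exp_gsmooth[OF assms(3)]
  have eq: "(gsmooth t M z - gsmooth t N z)\<^sup>2 = gsmooth t M z * gsmooth t M z - gsmooth t M z * gsmooth t N z
     - gsmooth t N z * gsmooth t M z + gsmooth t N z * gsmooth t N z" for z
    by (simp add: power2_eq_square algebra_simps)
  show "integrable lborel (\<lambda>z. (gsmooth t M z - gsmooth t N z)\<^sup>2)"
    unfolding eq by (intro Bochner_Integration.integrable_add Bochner_Integration.integrable_diff i)
  have "(\<integral>z. (gsmooth t M z - gsmooth t N z)\<^sup>2 \<partial>lborel) = pi / (4 * t) * dform (\<lambda>q. exp (- t * q)) M N"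
    unfolding eq dform_def right_diff_distrib distrib_left i(2,4,6,8)[symmetric]
    by (simp only: Bochner_Integration.integral_add Bochner_Integration.integral_diff
        Bochner_Integration.integrable_add Bochner_Integration.integrable_diff i(1,3,5,7))
  then show "dform (\<lambda>q. exp (- t * q)) M N = 4 * t / pi * (\<integral>z. (gsmooth t M z - gsmooth t N z)\<^sup>2 \<partial>lborel)"
    using assms by simp
qed

lemma dform_exp_nonneg: "bprob M \<Longrightarrow> bprob N \<Longrightarrow> t > 0 \<Longrightarrow> dform (\<lambda>q. exp (- t * q)) M N \<ge> 0"
  by (subst dform_exp) auto

section \<open>The logarithmic kernel as a mixture of Gaussians\<close>

text \<open>The weight (exp (- t a) - exp (- t b)) / t is the integral of exp (- t u) over u in
  [a, b]. A finite b in place of the subtracted term exp (- t) keeps the kernel nonnegative and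
  bounded, so Tonelli's theorem applies.\<close>

lemma frullani:
  assumes "0 < a" "a \<le> b" "0 \<le> s"
  shows "(\<integral>\<^sup>+ t. ennreal ((exp (- (t * a)) - exp (- (t * b))) / t * exp (- t * s)) * indicator {0..} t \<partial>lborel)
    = ennreal (ln ((s + b) / (s + a)))"
proof -
  have 1: "(\<integral>\<^sup>+ u. ennreal (exp (- (t * (u + s)))) * indicator {a..b} u \<partial>lborel) =
      ennreal ((exp (- (t * a)) - exp (- (t * b))) / t * exp (- t * s))" if "t > 0" for t
  proof -
    have "(\<integral>\<^sup>+ u. ennreal (exp (- (t * (u + s)))) * indicator {a..b} u \<partial>lborel) =
       - exp (- (t * (b + s))) / t - (- exp (- (t * (a + s))) / t)"
      by (rule nn_integral_FTC_Icc) (use assms that in \<open>auto intro!: derivative_eq_intros simp: field_simps\<close>)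
    then show ?thesis using that
      by (simp add: exp_add[symmetric] algebra_simps diff_divide_distrib)
  qed
  have 2: "(\<integral>\<^sup>+ t. ennreal (exp (- (t * w))) * indicator {0..} t \<partial>lborel) = ennreal (1 / w)"
    if "w > 0" for w :: real
  proof -
    have "(\<integral>\<^sup>+ t. ennreal (exp (- (t * w))) * indicator {0..} t \<partial>lborel) = 0 - (- exp (- (0 * w)) / w)"
    proof (rule nn_integral_FTC_atLeast)
      show "((\<lambda>t. - exp (- (t * w)) / w) \<longlongrightarrow> 0) at_top"
        using that by real_asymp
    qed (use that in \<open>auto intro!: derivative_eq_intros\<close>)
    then show ?thesis by simp
  qed
  \<comment> \<open>The point t = 0, where the quotient is 0 by convention, is discarded as a null
    set.\<close>
  have "(\<integral>\<^sup>+ t. ennreal ((exp (- (t * a)) - exp (- (t * b))) / t * exp (- t * s)) * indicator {0..} t \<partial>lborel)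
    = (\<integral>\<^sup>+ t. (\<integral>\<^sup>+ u. ennreal (exp (- (t * (u + s)))) * indicator {a..b} u \<partial>lborel) * indicator {0..} t \<partial>lborel)"
    by (rule nn_integral_cong_AE, use AE_lborel_singleton[of "0::real"] in eventually_elim)
      (auto simp: 1 split: split_indicator)
  also have "\<dots> = (\<integral>\<^sup>+ t. (\<integral>\<^sup>+ u. ennreal (exp (- (t * (u + s)))) * indicator {a..b} u * indicator {0..} t \<partial>lborel) \<partial>lborel)"
    by (subst nn_integral_multc) auto
  also have "\<dots> = (\<integral>\<^sup>+ u. (\<integral>\<^sup>+ t. ennreal (exp (- (t * (u + s)))) * indicator {a..b} u * indicator {0..} t \<partial>lborel) \<partial>lborel)"
    by (rule lborel_pair.Fubini') measurable
  also have "\<dots> = (\<integral>\<^sup>+ u. (\<integral>\<^sup>+ t. ennreal (exp (- (t * (u + s)))) * indicator {0..} t \<partial>lborel) * indicator {a..b} u \<partial>lborel)"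
    by (subst nn_integral_multc[symmetric]) (auto simp: ac_simps)
  also have "\<dots> = (\<integral>\<^sup>+ u. ennreal (1 / (u + s)) * indicator {a..b} u \<partial>lborel)"
    using assms by (intro nn_integral_cong) (auto simp: 2 split: split_indicator)
  also have "\<dots> = ln (b + s) - ln (a + s)"
    by (rule nn_integral_FTC_Icc) (use assms in \<open>auto intro!: derivative_eq_intros simp: field_simps\<close>)
  also have "\<dots> = ennreal (ln ((s + b) / (s + a)))"
    using assms by (subst ln_div) (auto simp: add.commute)
  finally show ?thesis .
qed

context bprob_pair
begin

lemma integrable_log_ratio_kernel:
  assumes "0 < a" "a \<le> b"
  shows "integrable (M \<Otimes>\<^sub>M N) (\<lambda>p. ln (((cmod (fst p - snd p))\<^sup>2 + b) / ((cmod (fst p - snd p))\<^sup>2 + a)))"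
proof (rule P.integrable_const_bound[where B="ln (b / a)"])
  have "\<bar>ln ((q + b) / (q + a))\<bar> \<le> ln (b / a)" if "q \<ge> 0" for q :: real
  proof -
    have "1 \<le> (q + b) / (q + a)" "(q + b) / (q + a) \<le> b / a"
      using that assms mult_left_mono[of a b q] by (auto simp: field_simps)
    then have "0 \<le> ln ((q + b) / (q + a))" "ln ((q + b) / (q + a)) \<le> ln (b / a)"
      by (auto intro!: ln_mono)
    then show ?thesis by simp
  qed
  then show "AE p in M \<Otimes>\<^sub>M N. norm (ln (((cmod (fst p - snd p))\<^sup>2 + b) / ((cmod (fst p - snd p))\<^sup>2 + a))) \<le> ln (b / a)"
    by simp
qed measurable

lemma bform_log_ratio:
  assumes a: "0 < a" "a \<le> b"
  shows "integrable lborel (\<lambda>t. indicator {0..} t * ((exp (- (t * a)) - exp (- (t * b))) / t) * bform (\<lambda>q. exp (- t * q)) M N)" (is ?I)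
    and "bform (\<lambda>q. ln ((q + b) / (q + a))) M N =
      (\<integral>t. indicator {0..} t * ((exp (- (t * a)) - exp (- (t * b))) / t) * bform (\<lambda>q. exp (- t * q)) M N \<partial>lborel)" (is ?E)
proof -
  define \<phi> where "\<phi> t = (exp (- (t * a)) - exp (- (t * b))) / t" for t
  have \<phi>0: "\<phi> t \<ge> 0" if "t \<ge> 0" for t
    unfolding \<phi>_def using that a by (intro divide_nonneg_nonneg) (auto intro!: mult_left_mono)
  have [measurable]: "\<phi> \<in> borel_measurable borel" unfolding \<phi>_def by measurable
  have Bm[measurable]: "(\<lambda>t. bform (\<lambda>q. exp (- t * q)) M N) \<in> borel_measurable borel"
    unfolding bform_def by measurable
  interpret PL: pair_sigma_finite "M \<Otimes>\<^sub>M N" "lborel :: real measure" ..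
  let ?d = "\<lambda>p. (cmod (fst p - snd p))\<^sup>2"
  have "(\<integral>\<^sup>+ t. ennreal (indicator {0..} t * \<phi> t * bform (\<lambda>q. exp (- t * q)) M N) \<partial>lborel)
    = (\<integral>\<^sup>+ t. ennreal (\<phi> t) * indicator {0..} t * ennreal (bform (\<lambda>q. exp (- t * q)) M N) \<partial>lborel)"
    using \<phi>0 by (intro nn_integral_cong) (auto simp: ennreal_mult' split: split_indicator)
  also have "\<dots> = (\<integral>\<^sup>+ t. ennreal (\<phi> t) * indicator {0..} t * (\<integral>\<^sup>+ p. ennreal (exp (- t * ?d p)) \<partial>(M \<Otimes>\<^sub>M N)) \<partial>lborel)"
    unfolding bform_def
    by (intro nn_integral_cong)
      (auto split: split_indicator intro!: arg_cong2[where f="(*)"] nn_integral_eq_integral[symmetric] integrable_exp_kernel[simplified])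
  also have "\<dots> = (\<integral>\<^sup>+ t. (\<integral>\<^sup>+ p. ennreal (\<phi> t * exp (- t * ?d p)) * indicator {0..} t \<partial>(M \<Otimes>\<^sub>M N)) \<partial>lborel)"
    by (subst nn_integral_cmult[symmetric])
      (auto intro!: nn_integral_cong simp: ennreal_mult'' ac_simps)
  also have "\<dots> = (\<integral>\<^sup>+ p. (\<integral>\<^sup>+ t. ennreal (\<phi> t * exp (- t * ?d p)) * indicator {0..} t \<partial>lborel) \<partial>(M \<Otimes>\<^sub>M N))"
    by (rule PL.Fubini') measurable
  also have "\<dots> = (\<integral>\<^sup>+ p. ennreal (ln ((?d p + b) / (?d p + a))) \<partial>(M \<Otimes>\<^sub>M N))"
    unfolding \<phi>_def using a by (subst frullani) auto
  also have "\<dots> = ennreal (bform (\<lambda>q. ln ((q + b) / (q + a))) M N)"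
  proof -
    have "0 \<le> ln ((?d p + b) / (?d p + a))" for p
      using a by (intro ln_ge_zero) (auto simp: add_nonneg_pos)
    then show ?thesis unfolding bform_def using a
      by (intro nn_integral_eq_integral integrable_log_ratio_kernel AE_I2) (simp_all del: ln_ge_zero_iff)
  qed
  finally have *: "(\<integral>\<^sup>+ t. ennreal (indicator {0..} t * \<phi> t * bform (\<lambda>q. exp (- t * q)) M N) \<partial>lborel)
     = ennreal (bform (\<lambda>q. ln ((q + b) / (q + a))) M N)" .
  have nn: "indicator {0..} t * \<phi> t * bform (\<lambda>q. exp (- t * q)) M N \<ge> 0" for t
    using \<phi>0 by (auto simp: bform_def split: split_indicator)
  have nn2: "bform (\<lambda>q. ln ((q + b) / (q + a))) M N \<ge> 0"
    unfolding bform_def using a by (intro Bochner_Integration.integral_nonneg ln_ge_zero) (auto simp: add_nonneg_pos)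
  have m: "(\<lambda>t. indicator {0..} t * \<phi> t * bform (\<lambda>q. exp (- t * q)) M N) \<in> borel_measurable lborel"
    by measurable
  show ?I unfolding \<phi>_def[symmetric] using * nn m by (intro integrableI_nonneg) auto
  show ?E unfolding \<phi>_def[symmetric] using * nn nn2 m by (subst integral_eq_nn_integral) auto
qed

end

text \<open>Every Gaussian energy in the mixture is nonnegative, so it may be restricted to the
  window [s, 2 s], where a lower bound is available.\<close>

lemma dform_log_ratio_ge:
  assumes "bprob M" "bprob N" and a: "0 < a" "a \<le> b" and s: "s > 0" and c: "c \<ge> 0"
    and D: "\<And>t. s \<le> t \<Longrightarrow> t \<le> 2 * s \<Longrightarrow> dform (\<lambda>q. exp (- t * q)) M N \<ge> c"
  shows "dform (\<lambda>q. ln ((q + b) / (q + a))) M N \<ge> c * (exp (- (2 * s * a)) - exp (- (s * b))) / 2"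
proof -
  interpret M: bprob M by fact
  interpret N: bprob N by fact
  interpret MM: bprob_pair M M ..
  interpret MN: bprob_pair M N ..
  interpret NM: bprob_pair N M ..
  interpret NN: bprob_pair N N ..
  define \<phi> where "\<phi> t = (exp (- (t * a)) - exp (- (t * b))) / t" for t
  have \<phi>0: "\<phi> t \<ge> 0" if "t \<ge> 0" for t
    unfolding \<phi>_def using that a by (intro divide_nonneg_nonneg) (auto intro!: mult_left_mono)
  note i = MM.bform_log_ratio[OF a, folded \<phi>_def] MN.bform_log_ratio[OF a, folded \<phi>_def]
    NM.bform_log_ratio[OF a, folded \<phi>_def] NN.bform_log_ratio[OF a, folded \<phi>_def]
  have int: "integrable lborel (\<lambda>t. indicator {0..} t * \<phi> t * dform (\<lambda>q. exp (- t * q)) M N)"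
    unfolding dform_def distrib_left right_diff_distrib
    by (intro Bochner_Integration.integrable_add Bochner_Integration.integrable_diff i)
  have eq: "dform (\<lambda>q. ln ((q + b) / (q + a))) M N = (\<integral>t. indicator {0..} t * \<phi> t * dform (\<lambda>q. exp (- t * q)) M N \<partial>lborel)"
    unfolding dform_def distrib_left right_diff_distrib using i by simp
  \<comment> \<open>\<open>m\<close> bounds the weight from below on the window: each exponential is
    taken at its worse end and the denominator at 2 s. The length s of the window turns 1 / (2 s)
    into the final 1/2.\<close>
  define m where "m = (exp (- (2 * s * a)) - exp (- (s * b))) / (2 * s)"
  have m: "indicator {0..} t * \<phi> t * dform (\<lambda>q. exp (- t * q)) M N \<ge> indicator {s .. 2 * s} t * (m * c)" for t
  proof (cases "t \<in> {s .. 2 * s}")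
    case True
    then have t: "s \<le> t" "t \<le> 2 * s" "t > 0" using s by auto
    have "dform (\<lambda>q. exp (- t * q)) M N \<ge> c" using D t by auto
    moreover have "m \<le> \<phi> t"
    proof -
      have "exp (- (2 * s * a)) \<le> exp (- (t * a))" "exp (- (t * b)) \<le> exp (- (s * b))"
        using t a by (auto intro!: mult_right_mono)
      then have "exp (- (2 * s * a)) - exp (- (s * b)) \<le> exp (- (t * a)) - exp (- (t * b))" by linarith
      then have "m * (2 * s) \<le> \<phi> t * t" using t s by (simp add: m_def \<phi>_def)
      also have "\<dots> \<le> \<phi> t * (2 * s)" using t \<phi>0[of t] by (intro mult_left_mono) auto
      finally show ?thesis using s by simp
    qed
    ultimately have "m * c \<le> \<phi> t * dform (\<lambda>q. exp (- t * q)) M N"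
      using c \<phi>0[of t] t by (intro mult_mono) auto
    then show ?thesis using True t by simp
  next
    case False
    have "indicator {0..} t * \<phi> t * dform (\<lambda>q. exp (- t * q)) M N \<ge> 0"
    proof (cases "t > 0")
      case True
      then show ?thesis using dform_exp_nonneg[OF assms(1,2)] \<phi>0[of t] by simp
    qed (auto simp: \<phi>_def indicator_def)
    then show ?thesis using False by simp
  qed
  have "c * (exp (- (2 * s * a)) - exp (- (s * b))) / 2 = (\<integral>t. indicator {s .. 2 * s} t * (m * c) \<partial>lborel)"
    using s by (simp add: m_def)
  also have "\<dots> \<le> (\<integral>t. indicator {0..} t * \<phi> t * dform (\<lambda>q. exp (- t * q)) M N \<partial>lborel)"
    using s by (intro integral_mono int m) (auto intro!: integrable_real_indicator integrable_mult_left)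
  finally show ?thesis unfolding eq .
qed

text \<open>The kernel \<open>- ln (q + a) / 2\<close> at squared distance \<open>q\<close> is a smoothing of \<open>- ln \<bar>x - y\<bar>\<close> from below.
  On neutral measures with bounded support \<open>- ln (q + a)\<close> is the limit of \<open>ln ((q + b) / (q + a))\<close>
  as \<open>b\<close> tends to infinity.\<close>

definition smlog :: "real \<Rightarrow> real \<Rightarrow> real" where
  "smlog a q = - ln (q + a) / 2"

lemma borel_measurable_smlog [measurable]: "smlog a \<in> borel_measurable borel"
  unfolding smlog_def[abs_def] by measurable

text \<open>Exactly, \<open>smlog a q\<close> is half of \<open>ln ((q + b) / (q + a))\<close> minus
  \<open>ln b / 2\<close> minus \<open>ln (1 + q / b) / 2\<close>. The last term is at most q / (2
  b), and q \<le> (2 L)^2 on the supports.\<close>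

lemma (in bprob_pair) bounded_kernel:
  assumes LM: "AE x in M. cmod x \<le> L" and LN: "AE x in N. cmod x \<le> L" and ab: "0 < a" "a \<le> b"
  shows "integrable (M \<Otimes>\<^sub>M N) (\<lambda>p. smlog a ((cmod (fst p - snd p))\<^sup>2))"
    and "\<bar>bform (smlog a) M N - (bform (\<lambda>q. ln ((q + b) / (q + a))) M N / 2 - ln b / 2)\<bar> \<le> 2 * L\<^sup>2 / b"
proof -
  let ?d = "\<lambda>p. (cmod (fst p - snd p))\<^sup>2"
  have AE: "AE p in M \<Otimes>\<^sub>M N. ?d p \<le> 4 * L\<^sup>2"
  proof (rule P.AE_pair_measure)
    show "AE x in M. AE y in N. ?d (x, y) \<le> 4 * L\<^sup>2"
      using LM
    proof eventually_elim
      fix x assume x: "cmod x \<le> L"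
      show "AE y in N. ?d (x, y) \<le> 4 * L\<^sup>2"
        using LN
      proof eventually_elim
        fix y assume y: "cmod y \<le> L"
        have "cmod (x - y) \<le> 2 * L" using x y norm_triangle_ineq4[of x y] by linarith
        then have "(cmod (x - y))\<^sup>2 \<le> (2 * L)\<^sup>2" by (intro power_mono) auto
        then show "?d (x, y) \<le> 4 * L\<^sup>2" by (simp add: power_mult_distrib)
      qed
    qed
  qed measurable
  have b: "b > 0" using ab by simp
  have lb: "0 \<le> ln (1 + q / b) \<and> ln (1 + q / b) \<le> q / b" if "q \<ge> 0" for q
    using that b ln_add_one_self_le_self[of "q / b"] by auto
  have i1: "integrable (M \<Otimes>\<^sub>M N) (\<lambda>p. ln (1 + ?d p / b))"
  proof (rule P.integrable_const_bound[where B="4 * L\<^sup>2 / b"])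
    show "AE p in M \<Otimes>\<^sub>M N. norm (ln (1 + ?d p / b)) \<le> 4 * L\<^sup>2 / b"
      using AE
    proof eventually_elim
      fix p assume "?d p \<le> 4 * L\<^sup>2"
      then have "?d p / b \<le> 4 * L\<^sup>2 / b" using b by (intro divide_right_mono) auto
      then show "norm (ln (1 + ?d p / b)) \<le> 4 * L\<^sup>2 / b" using lb[of "?d p"] by auto
    qed
  qed measurable
  note i2 = integrable_log_ratio_kernel[OF ab]
  have eq: "smlog a q = ln ((q + b) / (q + a)) / 2 - ln b / 2 - ln (1 + q / b) / 2" if "q \<ge> 0" for q
  proof -
    have "ln (q + b) = ln b + ln (1 + q / b)"
      using b that by (subst ln_mult_pos[symmetric]) (auto simp: distrib_left add.commute intro: add_pos_nonneg)
    then show ?thesis using that ab b by (simp add: smlog_def ln_div field_simps)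
  qed
  have eq': "smlog a (?d p) = ln ((?d p + b) / (?d p + a)) / 2 - ln b / 2 - ln (1 + ?d p / b) / 2" for p
    by (rule eq) simp
  show "integrable (M \<Otimes>\<^sub>M N) (\<lambda>p. smlog a (?d p))"
    unfolding eq' using i1 i2 by (intro Bochner_Integration.integrable_diff) auto
  have "bform (smlog a) M N = bform (\<lambda>q. ln ((q + b) / (q + a))) M N / 2 - ln b / 2 - (\<integral>p. ln (1 + ?d p / b) \<partial>(M \<Otimes>\<^sub>M N)) / 2"
    unfolding bform_def eq' using i1 i2 P.prob_space by simp
  moreover have "0 \<le> (\<integral>p. ln (1 + ?d p / b) \<partial>(M \<Otimes>\<^sub>M N))"
    using lb by (intro Bochner_Integration.integral_nonneg) auto
  moreover have "(\<integral>p. ln (1 + ?d p / b) \<partial>(M \<Otimes>\<^sub>M N)) \<le> (\<integral>p. 4 * L\<^sup>2 / b \<partial>(M \<Otimes>\<^sub>M N))"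
  proof (rule integral_mono_AE[OF i1])
    show "AE p in M \<Otimes>\<^sub>M N. ln (1 + ?d p / b) \<le> 4 * L\<^sup>2 / b"
      using AE
    proof eventually_elim
      fix p assume "?d p \<le> 4 * L\<^sup>2"
      then have "?d p / b \<le> 4 * L\<^sup>2 / b" using b by (intro divide_right_mono) auto
      then show "ln (1 + ?d p / b) \<le> 4 * L\<^sup>2 / b" using lb[of "?d p"] by auto
    qed
  qed auto
  ultimately show "\<bar>bform (smlog a) M N - (bform (\<lambda>q. ln ((q + b) / (q + a))) M N / 2 - ln b / 2)\<bar> \<le> 2 * L\<^sup>2 / b"
    using P.prob_space by (simp add: abs_le_iff)
qed

lemma dform_smlog_ge:
  assumes "bprob M" "bprob N" and L: "AE x in M. cmod x \<le> L" "AE x in N. cmod x \<le> L"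
    and a: "0 < a" and s: "s > 0" and c: "c \<ge> 0"
    and D: "\<And>t. s \<le> t \<Longrightarrow> t \<le> 2 * s \<Longrightarrow> dform (\<lambda>q. exp (- t * q)) M N \<ge> c"
  shows "dform (smlog a) M N \<ge> c * exp (- (2 * s * a)) / 4"
proof -
  interpret M: bprob M by fact
  interpret N: bprob N by fact
  interpret MM: bprob_pair M M ..
  interpret MN: bprob_pair M N ..
  interpret NM: bprob_pair N M ..
  interpret NN: bprob_pair N N ..
  \<comment> \<open>The constants \<open>ln b / 2\<close> cancel between the four forms by
    neutrality, while the four errors add up to \<open>8 * L\<^sup>2 / b\<close>.\<close>
  have "dform (smlog a) M N \<ge> c * (exp (- (2 * s * a)) - exp (- (s * b))) / 4 - 8 * L\<^sup>2 / b" if "b \<ge> a" for b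
  proof -
    note k = MM.bounded_kernel(2)[OF L(1,1) a that] MN.bounded_kernel(2)[OF L a that]
      NM.bounded_kernel(2)[OF L(2,1) a that] NN.bounded_kernel(2)[OF L(2,2) a that]
    from dform_log_ratio_ge[OF assms(1,2) a that s c D] k show ?thesis
      unfolding dform_def abs_le_iff by linarith
  qed
  then have ev: "\<forall>\<^sub>F b in at_top. c * (exp (- (2 * s * a)) - exp (- (s * b))) / 4 - 8 * L\<^sup>2 / b \<le> dform (smlog a) M N"
    using eventually_ge_at_top[of a] by (rule eventually_mono[rotated])
  have "((\<lambda>b. c * (exp (- (2 * s * a)) - exp (- (s * b))) / 4 - 8 * L\<^sup>2 / b) \<longlongrightarrow> c * (exp (- (2 * s * a)) - 0) / 4 - 0) at_top"
  proof -
    have "((\<lambda>b. exp (- (s * b))) \<longlongrightarrow> 0) at_top" using s by real_asymp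
    moreover have "((\<lambda>b. 8 * L\<^sup>2 / b) \<longlongrightarrow> 0) at_top" by real_asymp
    ultimately show ?thesis by (intro tendsto_intros) simp_all
  qed
  from tendsto_upperbound[OF this ev] show ?thesis by simp
qed

text \<open>If \<open>M\<close> and \<open>N\<close> are separated by a Lipschitz function of compact support, then they are separated by
  a Gaussian regularization of that function, and this bounds the Gaussian energy of \<open>M - N\<close> from below.\<close>

lemma dform_exp_separated:
  assumes "bprob M" "bprob N" and \<epsilon>: "\<epsilon> > 0" and \<rho>: "\<rho> > 0" and t: "t \<ge> (24 / \<epsilon>)\<^sup>2"
    and g [measurable]: "g \<in> borel_measurable borel" and g2: "\<And>x. \<bar>g x\<bar> \<le> 2"
    and lip: "\<And>x y. \<bar>g x - g y\<bar> \<le> 3 * dist x y" and supp: "\<And>x. cmod x > \<rho> \<Longrightarrow> g x = 0"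
    and sep: "(\<integral>x. g x \<partial>M) - (\<integral>x. g x \<partial>N) \<ge> \<epsilon>"
  shows "dform (\<lambda>q. exp (- t * q)) M N \<ge> \<epsilon>\<^sup>2 / (16 * t * \<rho>\<^sup>2)"
proof -
  interpret M: bprob M by fact
  interpret N: bprob N by fact
  have t0: "t > 0" using t \<epsilon> by (smt (verit) divide_pos_pos zero_less_power)
  \<comment> \<open>The number 24 turns the smoothing error \<open>6 * Z / sqrt t\<close>, found
    below, into at most \<open>Z * \<epsilon> / 4\<close>.\<close>
  have sq: "24 / \<epsilon> \<le> sqrt t" using t \<epsilon> by (intro real_le_rsqrt) auto
  define Z where "Z = pi / (2 * t)"
  have Z: "Z > 0" using t0 by (simp add: Z_def)
  define p where "p y = exp (- 2 * t * (cmod y)\<^sup>2)" for y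
  have [measurable]: "p \<in> borel_measurable borel" unfolding p_def[abs_def] by measurable
  have p0: "p y \<ge> 0" for y by (simp add: p_def)
  have pint: "integrable lborel (\<lambda>z. p (x - z))" "(\<integral>z. p (x - z) \<partial>lborel) = Z" for x
  proof -
    have "(\<integral>\<^sup>+ z. ennreal (p (x - z)) \<partial>lborel) = ennreal Z"
      using nn_integral_gauss[of "2 * t"] t0
      by (subst nn_integral_lborel_reflect[where f="\<lambda>z. ennreal (p z)"]) (auto simp: p_def Z_def)
    then show "integrable lborel (\<lambda>z. p (x - z))" "(\<integral>z. p (x - z) \<partial>lborel) = Z"
      using p0 Z by (auto intro!: integrableI_nonneg simp: integral_eq_nn_integral)
  qed
  have gp: "integrable lborel (\<lambda>z. g z * p (x - z))" for x
    by (rule Bochner_Integration.integrable_bound[OF integrable_mult_right[OF pint(1)[of x], of 2]])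
      (use g2 p0 in \<open>auto simp: abs_mult intro!: mult_right_mono\<close>)
  have qint: "integrable lborel (\<lambda>z. exp (- t * (cmod (x - z))\<^sup>2))" "(\<integral>z. exp (- t * (cmod (x - z))\<^sup>2) \<partial>lborel) = 2 * Z" for x
  proof -
    have "(\<integral>\<^sup>+ z. ennreal (exp (- t * (cmod (x - z))\<^sup>2)) \<partial>lborel) = ennreal (2 * Z)"
      using nn_integral_gauss[of t] t0
      by (subst nn_integral_lborel_reflect[where f="\<lambda>z. ennreal (exp (- t * (cmod z)\<^sup>2))"]) (auto simp: p_def Z_def)
    then show "integrable lborel (\<lambda>z. exp (- t * (cmod (x - z))\<^sup>2))" "(\<integral>z. exp (- t * (cmod (x - z))\<^sup>2) \<partial>lborel) = 2 * Z"
      using Z by (auto intro!: integrableI_nonneg simp: integral_eq_nn_integral)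
  qed
  have conv: "\<bar>(\<integral>z. g z * p (x - z) \<partial>lborel) - Z * g x\<bar> \<le> Z * \<epsilon> / 4" for x
  proof -
    \<comment> \<open>Half of the exponent is sacrificed to absorb the linear factor produced by the
      Lipschitz bound.\<close>
    have le: "cmod (x - z) * p (x - z) \<le> exp (- t * (cmod (x - z))\<^sup>2) / sqrt t" for z
    proof -
      define u where "u = cmod (x - z)"
      have "sqrt t * u \<le> exp (t * u\<^sup>2)"
      proof -
        have "sqrt t * u \<le> 1 + (sqrt t * u)\<^sup>2"
          using zero_le_power2[of "sqrt t * u - 1/2"] by (simp add: power2_eq_square algebra_simps)
        also have "\<dots> \<le> exp ((sqrt t * u)\<^sup>2)" by simp
        also have "(sqrt t * u)\<^sup>2 = t * u\<^sup>2" using t0 by (simp add: power_mult_distrib)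
        finally show ?thesis .
      qed
      then have "sqrt t * u * exp (- 2 * t * u\<^sup>2) \<le> exp (t * u\<^sup>2) * exp (- 2 * t * u\<^sup>2)"
        by (rule mult_right_mono) simp
      also have "\<dots> = exp (- t * u\<^sup>2)" by (simp flip: exp_add)
      finally show ?thesis using t0 unfolding p_def u_def by (simp add: field_simps)
    qed
    have "(\<integral>z. g z * p (x - z) \<partial>lborel) - Z * g x = (\<integral>z. (g z - g x) * p (x - z) \<partial>lborel)"
      using gp pint by (simp add: left_diff_distrib)
    also have "\<bar>\<dots>\<bar> \<le> (\<integral>z. \<bar>(g z - g x) * p (x - z)\<bar> \<partial>lborel)"
      by (rule integral_abs_bound)
    also have "\<dots> \<le> (\<integral>z. 3 / sqrt t * exp (- t * (cmod (x - z))\<^sup>2) \<partial>lborel)"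
    proof (rule integral_mono)
      show "integrable lborel (\<lambda>z. \<bar>(g z - g x) * p (x - z)\<bar>)"
        using gp pint by (intro integrable_abs) (simp add: left_diff_distrib)
      show "integrable lborel (\<lambda>z. 3 / sqrt t * exp (- t * (cmod (x - z))\<^sup>2))"
        using qint by (intro integrable_mult_right)
      fix z
      have "\<bar>(g z - g x) * p (x - z)\<bar> \<le> 3 * cmod (x - z) * p (x - z)"
        using lip[of z x] p0 by (auto simp: abs_mult dist_norm norm_minus_commute intro!: mult_right_mono)
      also have "\<dots> \<le> 3 / sqrt t * exp (- t * (cmod (x - z))\<^sup>2)" using le[of z] by simp
      finally show "\<bar>(g z - g x) * p (x - z)\<bar> \<le> 3 / sqrt t * exp (- t * (cmod (x - z))\<^sup>2)" .
    qed
    also have "\<dots> = 6 * Z / sqrt t" using qint by simp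
    also have "\<dots> \<le> Z * \<epsilon> / 4"
      using sq \<epsilon> Z t0 by (simp add: field_simps)
    finally show ?thesis .
  qed
  have sw: "integrable lborel (\<lambda>z. g z * gsmooth t K z)"
     "(\<integral>z. g z * gsmooth t K z \<partial>lborel) = (\<integral>x. (\<integral>z. g z * p (x - z) \<partial>lborel) \<partial>K)"
    if "bprob K" for K
  proof -
    interpret K: bprob K by fact
    interpret KL: pair_sigma_finite K "lborel :: complex measure" ..
    have int: "integrable (K \<Otimes>\<^sub>M lborel) (\<lambda>(x, z). g z * p (x - z))"
    proof (rule KL.Fubini_integrable)
      have "\<bar>\<integral>z. \<bar>g z\<bar> * p (x - z) \<partial>lborel\<bar> \<le> 2 * Z" for x
      proof -
        have i: "integrable lborel (\<lambda>z. \<bar>g z\<bar> * p (x - z))" using integrable_abs[OF gp[of x]] p0 by (simp add: abs_mult)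
        have "(\<integral>z. \<bar>g z\<bar> * p (x - z) \<partial>lborel) \<le> (\<integral>z. 2 * p (x - z) \<partial>lborel)"
          using g2 p0 by (intro integral_mono i integrable_mult_right pint mult_right_mono) auto
        then show ?thesis using pint p0 by (subst abs_of_nonneg) auto
      qed
      then show "integrable K (\<lambda>x. \<integral>z. norm (case (x, z) of (x, z) \<Rightarrow> g z * p (x - z)) \<partial>lborel)"
        using p0 by (intro K.integrable_const_bound[where B="2 * Z"]) (auto simp: abs_mult)
      show "AE x in K. integrable lborel (\<lambda>z. case (x, z) of (x, z) \<Rightarrow> g z * p (x - z))"
        using gp by simp
    qed measurable
    have eq: "g z * gsmooth t K z = (\<integral>x. g z * p (x - z) \<partial>K)" for z
      by (simp add: gsmooth_def p_def)
    show "(\<integral>z. g z * gsmooth t K z \<partial>lborel) = (\<integral>x. (\<integral>z. g z * p (x - z) \<partial>lborel) \<partial>K)"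
      unfolding eq by (rule KL.Fubini_integral[OF int])
    show "integrable lborel (\<lambda>z. g z * gsmooth t K z)"
      unfolding eq by (rule KL.integrable_snd[OF int])
  qed
  have ex: "\<bar>(\<integral>x. (\<integral>z. g z * p (x - z) \<partial>lborel) \<partial>K) - Z * (\<integral>x. g x \<partial>K)\<bar> \<le> Z * \<epsilon> / 4" if "bprob K" for K
  proof -
    interpret K: bprob K by fact
    have ig: "integrable K g" using g2 by (intro K.integrable_const_bound[where B=2]) auto
    have ic: "integrable K (\<lambda>x. (\<integral>z. g z * p (x - z) \<partial>lborel) - Z * g x)"
      using conv by (intro K.integrable_const_bound[where B="Z * \<epsilon> / 4"]) auto
    have ic': "integrable K (\<lambda>x. (\<integral>z. g z * p (x - z) \<partial>lborel))"
      using Bochner_Integration.integrable_add[OF ic integrable_mult_right[OF ig, of Z]] by simp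
    have "(\<integral>x. (\<integral>z. g z * p (x - z) \<partial>lborel) \<partial>K) - Z * (\<integral>x. g x \<partial>K) = (\<integral>x. (\<integral>z. g z * p (x - z) \<partial>lborel) - Z * g x \<partial>K)"
      using ic' ig by simp
    also have "\<bar>\<dots>\<bar> \<le> (\<integral>x. \<bar>(\<integral>z. g z * p (x - z) \<partial>lborel) - Z * g x\<bar> \<partial>K)" by (rule integral_abs_bound)
    also have "\<dots> \<le> (\<integral>x. Z * \<epsilon> / 4 \<partial>K)" using ic conv by (intro integral_mono integrable_abs) auto
    also have "\<dots> = Z * \<epsilon> / 4" using K.prob_space by simp
    finally show ?thesis .
  qed
  let ?P = "\<lambda>z. gsmooth t M z - gsmooth t N z"
  \<comment> \<open>Smoothing loses \<open>Z * \<epsilon> / 4\<close> for each of the two measures,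
    so half of the separation survives.\<close>
  have "Z * \<epsilon> / 2 \<le> Z * (\<integral>x. g x \<partial>M) - Z * (\<integral>x. g x \<partial>N) - Z * \<epsilon> / 2"
    using mult_left_mono[OF sep, of Z] Z by (simp add: right_diff_distrib)
  also have "\<dots> \<le> (\<integral>z. g z * gsmooth t M z \<partial>lborel) - (\<integral>z. g z * gsmooth t N z \<partial>lborel)"
    using ex[OF assms(1)] ex[OF assms(2)] unfolding sw(2)[OF assms(1)] sw(2)[OF assms(2)] by linarith
  also have "\<dots> = (\<integral>z. g z * ?P z \<partial>lborel)"
    using sw[OF assms(1)] sw[OF assms(2)] by (simp add: right_diff_distrib)
  finally have low: "Z * \<epsilon> / 2 \<le> (\<integral>z. g z * ?P z \<partial>lborel)" .
  \<comment> \<open>Young's inequality is used pointwise in place of Cauchy-Schwarz;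
    \<open>\<tau>\<close> is chosen so that its term on the disc integrates to
    \<open>Z * \<epsilon> / 4\<close>, half of the bound \<open>low\<close>.\<close>
  define \<tau> where "\<tau> = Z * \<epsilon> / (8 * pi * \<rho>\<^sup>2)"
  have \<tau>: "\<tau> > 0" using Z \<epsilon> \<rho> by (simp add: \<tau>_def)
  have "(\<integral>z. g z * ?P z \<partial>lborel) \<le> (\<integral>z. 2 * \<tau> * indicator (cball 0 \<rho>) z + (?P z)\<^sup>2 / (2 * \<tau>) \<partial>lborel)"
  proof (rule integral_mono)
    show "integrable lborel (\<lambda>z. g z * ?P z)"
      using sw[OF assms(1)] sw[OF assms(2)] by (simp add: right_diff_distrib)
    show "integrable lborel (\<lambda>z. 2 * \<tau> * indicator (cball 0 \<rho>) z + (?P z)\<^sup>2 / (2 * \<tau>))"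
      using dform_exp(1)[OF assms(1,2) t0] emeasure_bounded_finite[of "cball 0 \<rho> :: complex set"]
      by (intro Bochner_Integration.integrable_add integrable_divide integrable_mult_right integrable_real_indicator) auto
    fix z
    show "g z * ?P z \<le> 2 * \<tau> * indicator (cball 0 \<rho>) z + (?P z)\<^sup>2 / (2 * \<tau>)"
    proof (cases "cmod z \<le> \<rho>")
      case True
      have "0 \<le> (\<tau> * g z - ?P z)\<^sup>2 / (2 * \<tau>)" using \<tau> by simp
      also have "\<dots> = \<tau> * (g z)\<^sup>2 / 2 - g z * ?P z + (?P z)\<^sup>2 / (2 * \<tau>)"
        using \<tau> by (simp add: power2_eq_square field_simps)
      finally have "g z * ?P z \<le> \<tau> * (g z)\<^sup>2 / 2 + (?P z)\<^sup>2 / (2 * \<tau>)" by linarith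
      moreover have "(g z)\<^sup>2 \<le> 2\<^sup>2" using g2[of z] by (intro abs_le_square_iff[THEN iffD1]) auto
      then have "\<tau> * (g z)\<^sup>2 / 2 \<le> 2 * \<tau>" using \<tau> by simp
      ultimately show ?thesis using True by simp
    next
      case False
      then show ?thesis using supp[of z] \<tau> by simp
    qed
  qed
  also have "\<dots> = 2 * \<tau> * (pi * \<rho>\<^sup>2) + (\<integral>z. (?P z)\<^sup>2 \<partial>lborel) / (2 * \<tau>)"
    using dform_exp(1)[OF assms(1,2) t0] emeasure_bounded_finite[of "cball 0 \<rho> :: complex set"] \<rho>
    by (subst Bochner_Integration.integral_add)
      (auto intro!: integrable_divide integrable_mult_right integrable_real_indicator simp: content_cball eval_unit_ball_vol)
  also have "2 * \<tau> * (pi * \<rho>\<^sup>2) = Z * \<epsilon> / 4" using \<rho> by (simp add: \<tau>_def field_simps)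
  finally have "Z * \<epsilon> / 4 \<le> (\<integral>z. (?P z)\<^sup>2 \<partial>lborel) / (2 * \<tau>)" using low by linarith
  then have "Z * \<epsilon> / 4 * (2 * \<tau>) \<le> (\<integral>z. (?P z)\<^sup>2 \<partial>lborel)" using \<tau> by (simp add: pos_le_divide_eq)
  then have "4 * t / pi * (Z * \<epsilon> / 4 * (2 * \<tau>)) \<le> 4 * t / pi * (\<integral>z. (?P z)\<^sup>2 \<partial>lborel)"
    using t0 by (intro mult_left_mono) auto
  moreover have "4 * t / pi * (Z * \<epsilon> / 4 * (2 * \<tau>)) = \<epsilon>\<^sup>2 / (16 * t * \<rho>\<^sup>2)"
    using t0 \<rho> by (simp add: \<tau>_def Z_def power2_eq_square field_simps)
  ultimately show ?thesis unfolding dform_exp(2)[OF assms(1,2) t0] by simp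
qed

text \<open>The point is uniformity: c depends on \<epsilon> and \<rho> only. The truncation scale a
  and the radius L of the supports can therefore be chosen after c, and as functions of it.\<close>

lemma dform_smlog_separated:
  assumes "\<epsilon> > 0" "\<rho> > 0"
  obtains c where "c > 0"
    "\<And>M N L a g. \<lbrakk>bprob M; bprob N; AE x in M. cmod x \<le> L; AE x in N. cmod x \<le> L; 0 < a; a \<le> 1;
       g \<in> borel_measurable borel; \<And>x. \<bar>g x\<bar> \<le> 2; \<And>x y. \<bar>g x - g y\<bar> \<le> 3 * dist x y;
       \<And>x. cmod x > \<rho> \<Longrightarrow> g x = 0; (\<integral>x. g x \<partial>M) - (\<integral>x. g x \<partial>N) \<ge> \<epsilon>\<rbrakk> \<Longrightarrow> dform (smlog a) M N \<ge> c"
proof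
  define s where "s = (24 / \<epsilon>)\<^sup>2"
  have s: "s > 0" using assms by (simp add: s_def)
  define c where "c = \<epsilon>\<^sup>2 / (16 * (2 * s) * \<rho>\<^sup>2)"
  have c: "c > 0" using assms s by (simp add: c_def)
  show "c * exp (- (2 * s)) / 4 > 0" using c by simp
  fix M N :: "complex measure" and L a :: real and g :: "complex \<Rightarrow> real"
  assume *: "bprob M" "bprob N" and L: "AE x in M. cmod x \<le> L" "AE x in N. cmod x \<le> L" and a: "0 < a" "a \<le> 1"
    and g: "g \<in> borel_measurable borel" "\<And>x. \<bar>g x\<bar> \<le> 2" "\<And>x y. \<bar>g x - g y\<bar> \<le> 3 * dist x y"
       "\<And>x. cmod x > \<rho> \<Longrightarrow> g x = 0" "(\<integral>x. g x \<partial>M) - (\<integral>x. g x \<partial>N) \<ge> \<epsilon>"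
  have "dform (\<lambda>q. exp (- t * q)) M N \<ge> c" if "s \<le> t" "t \<le> 2 * s" for t
  proof -
    have "c \<le> \<epsilon>\<^sup>2 / (16 * t * \<rho>\<^sup>2)"
      unfolding c_def using that s assms by (intro divide_left_mono mult_right_mono) auto
    also have "\<dots> \<le> dform (\<lambda>q. exp (- t * q)) M N"
      using dform_exp_separated[OF *(1,2) assms _ g] that s_def by auto
    finally show ?thesis .
  qed
  then have "c * exp (- (2 * s * a)) / 4 \<le> dform (smlog a) M N"
    using c by (intro dform_smlog_ge[OF *(1,2) L a(1) s]) auto
  moreover have "c * exp (- (2 * s)) / 4 \<le> c * exp (- (2 * s * a)) / 4"
    using c s a by (auto intro!: mult_left_mono)
  ultimately show "c * exp (- (2 * s)) / 4 \<le> dform (smlog a) M N" by linarith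
qed

section \<open>The equilibrium measure\<close>

locale jellium =
  fixes R lam :: real
  assumes R_pos: "R > 0" and lam_ge: "lam \<ge> 1"
begin

definition r :: real where "r = R / sqrt lam"

definition \<nu> :: "complex measure" where "\<nu> = unif_disc r"

definition W :: "complex \<Rightarrow> real" where "W x = - log_pot R x"

definition I\<nu> :: real where "I\<nu> = (\<integral>x. log_pot r x \<partial>\<nu>)"

definition J :: real where "J = I\<nu> / 2 + lam * (\<integral>x. W x \<partial>\<nu>)"

lemma r_pos: "r > 0" and r_le: "r \<le> R" and R_r: "(R / r)\<^sup>2 = lam"
proof -
  have s: "sqrt lam \<ge> 1" using lam_ge by simp
  show "r > 0" using R_pos lam_ge by (simp add: r_def)
  show "r \<le> R" unfolding r_def using s R_pos by (simp add: divide_le_eq)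
  show "(R / r)\<^sup>2 = lam" using R_pos lam_ge by (simp add: r_def)
qed

sublocale \<nu>: bprob \<nu>
  unfolding \<nu>_def by (rule bprob_unif[OF r_pos])

lemma AE_\<nu>: "AE x in \<nu>. cmod x \<le> r"
  unfolding \<nu>_def by (rule AE_unif_disc[OF r_pos])

lemma borel_measurable_W [measurable]: "W \<in> borel_measurable borel"
  unfolding W_def[abs_def] using R_pos by measurable

lemma borel_measurable_pot [measurable]: "log_pot r \<in> borel_measurable borel"
  using r_pos by measurable

lemma W_llog: obtains C where "C \<ge> 0" "\<And>x. \<bar>W x - llog x\<bar> \<le> C"
  using log_pot_llog[OF R_pos] unfolding W_def by blast

lemma llog_le: "cmod x \<le> L \<Longrightarrow> llog x \<le> ln (1 + L\<^sup>2) / 2"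
  unfolding llog_def by (intro divide_right_mono ln_mono) (auto intro!: power_mono add_pos_nonneg)

lemma bounded_pot_integrable:
  assumes "bprob M" and L: "AE x in M. cmod x \<le> L" and R': "R' > 0"
  shows "integrable M (log_pot R')"
proof -
  interpret M: bprob M by fact
  obtain C where C: "C \<ge> 0" "\<And>x. \<bar>- log_pot R' x - llog x\<bar> \<le> C" using log_pot_llog[OF R'] by blast
  show ?thesis
  proof (rule M.integrable_const_bound[where B="C + ln (1 + L\<^sup>2) / 2"])
    show "AE x in M. norm (log_pot R' x) \<le> C + ln (1 + L\<^sup>2) / 2"
      using L
    proof eventually_elim
      fix x assume "cmod x \<le> L"
      then show "norm (log_pot R' x) \<le> C + ln (1 + L\<^sup>2) / 2"
        using llog_le[of x L] C(2)[of x] llog_nonneg[of x] by (auto simp: abs_le_iff)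
    qed
    show "log_pot R' \<in> borel_measurable M" using R' by measurable
  qed
qed

text \<open>The constant in \<open>euler_lagrange\<close> is identified by integrating the equality
  on the support against \<nu>.\<close>

lemma EL: "log_pot r x + lam * W x \<ge> I\<nu> + lam * (\<integral>x. W x \<partial>\<nu>)"
proof -
  define c where "c = log_pot r 0 - lam * log_pot R 0"
  note e = euler_lagrange[OF r_pos r_le, unfolded R_r]
  have "(\<integral>x. log_pot r x - lam * log_pot R x \<partial>\<nu>) = (\<integral>x. c \<partial>\<nu>)"
  proof (rule integral_cong_AE)
    show "AE x in \<nu>. log_pot r x - lam * log_pot R x = c"
      using AE_\<nu> by eventually_elim (simp add: e(2) c_def)
  qed (use R_pos in measurable)
  then have "I\<nu> + lam * (\<integral>x. W x \<partial>\<nu>) = c"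
    using bounded_pot_integrable[OF \<nu>.bprob_axioms AE_\<nu> r_pos] bounded_pot_integrable[OF \<nu>.bprob_axioms AE_\<nu> R_pos]
      \<nu>.prob_space by (simp add: I\<nu>_def W_def)
  then show ?thesis using e(1)[of x] by (simp add: W_def c_def)
qed

lemma integrable_inverse_cmod: "integrable \<nu> (\<lambda>y. 1 / cmod (x - y))"
  unfolding \<nu>_def using r_pos integrable_inverse_cmod_disc by (subst integrable_unif_disc) auto

lemma integral_inverse_cmod_le: "(\<integral>y. 1 / cmod (x - y) \<partial>\<nu>) \<le> 1 + 2 / r\<^sup>2"
proof -
  have "ennreal (\<integral>y. indicator (cball 0 r) y * (1 / cmod (x - y)) \<partial>lborel) =
      (\<integral>\<^sup>+ y. indicator (cball 0 r) y * ennreal (1 / cmod (x - y)) \<partial>lborel)"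
    by (subst nn_integral_eq_integral[symmetric, OF integrable_inverse_cmod_disc])
      (auto intro!: nn_integral_cong split: split_indicator)
  also have "\<dots> \<le> ennreal (pi * r\<^sup>2 + 2 * pi)" by (rule nn_integral_inverse_cmod_disc)
  finally have "(\<integral>y. indicator (cball 0 r) y * (1 / cmod (x - y)) \<partial>lborel) \<le> pi * r\<^sup>2 + 2 * pi"
    by (subst (asm) ennreal_le_iff) auto
  then have "(\<integral>y. indicator (cball 0 r) y * (1 / cmod (x - y)) \<partial>lborel) / (pi * r\<^sup>2) \<le> (pi * r\<^sup>2 + 2 * pi) / (pi * r\<^sup>2)"
    by (intro divide_right_mono) auto
  also have "\<dots> = 1 + 2 / r\<^sup>2" using r_pos by (simp add: field_simps)
  finally show ?thesis
    unfolding \<nu>_def using r_pos by (subst integral_unif_disc) auto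
qed

text \<open>With u = sqrt a / |x - y|, truncation lowers the kernel by ln (1 + u^2) / 2, which lies
  between 0 and u. The integral of 1 / |x - y| against \<nu> is bounded uniformly in x, so the cost
  is of order sqrt a.\<close>

lemma smlog_pot:
  assumes "a > 0"
  shows "(\<integral>y. smlog a ((cmod (x - y))\<^sup>2) \<partial>\<nu>) \<ge> log_pot r x - sqrt a * (1 + 2 / r\<^sup>2)"
    and "(\<integral>y. smlog a ((cmod (x - y))\<^sup>2) \<partial>\<nu>) \<le> log_pot r x"
proof -
  have i1: "integrable \<nu> (\<lambda>y. ln (cmod (x - y)))"
    unfolding \<nu>_def by (rule integrable_ln_cmod_unif[OF r_pos])
  note i2 = integrable_inverse_cmod[of x] and i2' = integral_inverse_cmod_le[of x]
  have neq: "AE y in \<nu>. y \<noteq> x"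
    unfolding \<nu>_def unif_disc_density[OF r_pos]
    using AE_lborel_singleton[of x] by (subst AE_density) auto
  have bd: "smlog a ((cmod (x - y))\<^sup>2) \<le> - ln (cmod (x - y)) \<and>
     smlog a ((cmod (x - y))\<^sup>2) \<ge> - ln (cmod (x - y)) - sqrt a * (1 / cmod (x - y))" if "y \<noteq> x" for y
  proof -
    define s where "s = cmod (x - y)"
    have s: "s > 0" using that by (simp add: s_def)
    have 1: "ln (s\<^sup>2 + a) = 2 * ln s + ln (1 + (sqrt a / s)\<^sup>2)"
    proof -
      have "s\<^sup>2 + a = s\<^sup>2 * (1 + (sqrt a / s)\<^sup>2)"
        using s assms by (simp add: field_simps power_divide)
      then have "ln (s\<^sup>2 + a) = ln (s\<^sup>2) + ln (1 + (sqrt a / s)\<^sup>2)"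
        using s by (simp add: ln_mult_pos add_pos_nonneg)
      then show ?thesis using s by (simp add: ln_realpow)
    qed
    have 2: "0 \<le> ln (1 + u\<^sup>2) \<and> ln (1 + u\<^sup>2) \<le> 2 * u" if "u \<ge> 0" for u :: real
    proof -
      have "ln (1 + u\<^sup>2) \<le> ln ((1 + u)\<^sup>2)"
        using that by (intro ln_mono) (auto intro: add_pos_nonneg simp: power2_eq_square algebra_simps)
      also have "\<dots> = 2 * ln (1 + u)" using that by (simp add: ln_realpow)
      also have "\<dots> \<le> 2 * u" using ln_add_one_self_le_self[OF that] by simp
      finally show ?thesis by simp
    qed
    show ?thesis using 1 2[of "sqrt a / s"] s assms unfolding smlog_def s_def[symmetric] by (auto simp: mult.commute[of 2])
  qed
  have i3: "integrable \<nu> (\<lambda>y. smlog a ((cmod (x - y))\<^sup>2))"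
  proof (rule Bochner_Integration.integrable_bound)
    show "integrable \<nu> (\<lambda>y. \<bar>ln (cmod (x - y))\<bar> + sqrt a * (1 / cmod (x - y)))"
      using i1 i2 by (intro Bochner_Integration.integrable_add integrable_abs integrable_mult_right)
    show "AE y in \<nu>. norm (smlog a ((cmod (x - y))\<^sup>2)) \<le> norm (\<bar>ln (cmod (x - y))\<bar> + sqrt a * (1 / cmod (x - y)))"
      using neq
    proof eventually_elim
      fix y assume "y \<noteq> x"
      have "0 \<le> sqrt a * (1 / cmod (x - y))" using assms by simp
      then show "norm (smlog a ((cmod (x - y))\<^sup>2)) \<le> norm (\<bar>ln (cmod (x - y))\<bar> + sqrt a * (1 / cmod (x - y)))"
        using bd[OF \<open>y \<noteq> x\<close>] unfolding real_norm_def by linarith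
    qed
  qed measurable
  have lp: "log_pot r x = (\<integral>y. - ln (cmod (x - y)) \<partial>\<nu>)"
    by (simp add: log_pot_def \<nu>_def)
  show "(\<integral>y. smlog a ((cmod (x - y))\<^sup>2) \<partial>\<nu>) \<le> log_pot r x"
    unfolding lp using i1 i3 neq bd by (intro integral_mono_AE) auto
  have "(\<integral>y. - ln (cmod (x - y)) - sqrt a * (1 / cmod (x - y)) \<partial>\<nu>) \<le> (\<integral>y. smlog a ((cmod (x - y))\<^sup>2) \<partial>\<nu>)"
    using i1 i2 i3 neq bd by (intro integral_mono_AE Bochner_Integration.integrable_diff integrable_mult_right) auto
  moreover have "(\<integral>y. - ln (cmod (x - y)) - sqrt a * (1 / cmod (x - y)) \<partial>\<nu>) = log_pot r x - sqrt a * (\<integral>y. 1 / cmod (x - y) \<partial>\<nu>)"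
  proof -
    have "integrable \<nu> (\<lambda>y. - ln (cmod (x - y)))" using i1 by simp
    from Bochner_Integration.integral_diff[OF this integrable_mult_right[OF i2, of "sqrt a"]]
    show ?thesis unfolding lp by (simp only: integral_mult_right_zero)
  qed
  moreover have "sqrt a * (\<integral>y. 1 / cmod (x - y) \<partial>\<nu>) \<le> sqrt a * (1 + 2 / r\<^sup>2)"
    using i2' assms by (intro mult_left_mono) auto
  ultimately show "(\<integral>y. smlog a ((cmod (x - y))\<^sup>2) \<partial>\<nu>) \<ge> log_pot r x - sqrt a * (1 + 2 / r\<^sup>2)"
    by (simp add: field_simps)
qed

text \<open>Half the self-energy of M is half of \<open>dform\<close> plus the mixed form minus half
  the self-energy of \<nu>. The mixed form is the potential of \<nu> up to the truncation cost, and
  the Euler-Lagrange inequality integrated against M produces J. Truncation is there for M, which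
  will be atomic; in the self-energy of \<nu> it only helps.\<close>

lemma smoothed_energy_ge:
  assumes "bprob M" and LM: "AE x in M. cmod x \<le> L" and L: "r \<le> L" and a: "a > 0"
  shows "bform (smlog a) M M / 2 + lam * (\<integral>x. W x \<partial>M) \<ge>
     dform (smlog a) M \<nu> / 2 + J - sqrt a * (1 + 2 / r\<^sup>2)"
proof -
  interpret M: bprob M by fact
  interpret MM: bprob_pair M M ..
  interpret MN: bprob_pair M \<nu> ..
  interpret NM: bprob_pair \<nu> M ..
  interpret NN: bprob_pair \<nu> \<nu> ..
  have LN: "AE x in \<nu>. cmod x \<le> L" using AE_\<nu> by eventually_elim (use L in auto)
  note iU = bounded_pot_integrable[OF assms(1) LM r_pos] 
  note iV = bounded_pot_integrable[OF \<nu>.bprob_axioms LN r_pos] 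
  have iW: "integrable M W"
    unfolding W_def[abs_def] using bounded_pot_integrable[OF assms(1) LM R_pos] by simp
  note iMN = MN.bounded_kernel(1)[OF LM LN a order_refl]
  note iNN = NN.bounded_kernel(1)[OF LN LN a order_refl]
  have swap: "bform (smlog a) \<nu> M = bform (smlog a) M \<nu>"
    unfolding bform_def
    by (subst MN.P.integral_product_swap[symmetric]) (auto simp: case_prod_beta' norm_minus_commute)
  have "bform (smlog a) M \<nu> = (\<integral>x. (\<integral>y. smlog a ((cmod (x - y))\<^sup>2) \<partial>\<nu>) \<partial>M)"
    unfolding bform_def using MN.P.integral_fst'[OF iMN] by simp
  moreover have "(\<integral>x. log_pot r x - sqrt a * (1 + 2 / r\<^sup>2) \<partial>M) \<le> (\<integral>x. (\<integral>y. smlog a ((cmod (x - y))\<^sup>2) \<partial>\<nu>) \<partial>M)"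
  proof (intro integral_mono smlog_pot[OF a])
    show "integrable M (\<lambda>x. \<integral>y. smlog a ((cmod (x - y))\<^sup>2) \<partial>\<nu>)"
      using MN.P.integrable_fst'[OF iMN] by simp
  qed (use iU in auto)
  moreover have "(\<integral>x. log_pot r x - sqrt a * (1 + 2 / r\<^sup>2) \<partial>M) = (\<integral>x. log_pot r x \<partial>M) - sqrt a * (1 + 2 / r\<^sup>2)"
    using iU M.prob_space by simp
  ultimately have 1: "bform (smlog a) M \<nu> \<ge> (\<integral>x. log_pot r x \<partial>M) - sqrt a * (1 + 2 / r\<^sup>2)" by linarith
  have "bform (smlog a) \<nu> \<nu> = (\<integral>x. (\<integral>y. smlog a ((cmod (x - y))\<^sup>2) \<partial>\<nu>) \<partial>\<nu>)"
    unfolding bform_def using NN.P.integral_fst'[OF iNN] by simp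
  also have "\<dots> \<le> I\<nu>"
    unfolding I\<nu>_def
  proof (intro integral_mono smlog_pot[OF a])
    show "integrable \<nu> (\<lambda>x. \<integral>y. smlog a ((cmod (x - y))\<^sup>2) \<partial>\<nu>)"
      using NN.P.integrable_fst'[OF iNN] by simp
  qed (use iV in auto)
  finally have 2: "bform (smlog a) \<nu> \<nu> \<le> I\<nu>" .
  have "(\<integral>x. I\<nu> + lam * (\<integral>x. W x \<partial>\<nu>) \<partial>M) \<le> (\<integral>x. log_pot r x + lam * W x \<partial>M)"
    using EL iU iW by (intro integral_mono Bochner_Integration.integrable_add integrable_mult_right) auto
  also have "\<dots> = (\<integral>x. log_pot r x \<partial>M) + lam * (\<integral>x. W x \<partial>M)" using iU iW by simp
  finally have 3: "I\<nu> + lam * (\<integral>x. W x \<partial>\<nu>) \<le> (\<integral>x. log_pot r x \<partial>M) + lam * (\<integral>x. W x \<partial>M)"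
    using M.prob_space by simp
  define k where "k = sqrt a * (1 + 2 / r\<^sup>2)"
  have "bform (smlog a) M M / 2 + lam * (\<integral>x. W x \<partial>M) \<ge> dform (smlog a) M \<nu> / 2 + J - k"
    using 1 2 3 unfolding dform_def swap J_def k_def[symmetric] by (simp add: field_simps)
  then show ?thesis by (simp add: k_def)
qed

end

section \<open>Discrete energies\<close>

lemma sum_pairs_symmetric:
  fixes h :: "nat \<Rightarrow> nat \<Rightarrow> real"
  assumes A: "finite A" and sym: "\<And>i j. h i j = h j i"
  shows "(\<Sum>(i,j)\<in>{(i,j). i \<in> A \<and> j \<in> A \<and> i < j}. h i j) = ((\<Sum>i\<in>A. \<Sum>j\<in>A. h i j) - (\<Sum>i\<in>A. h i i)) / 2"
proof -
  let ?L = "{(i,j). i \<in> A \<and> j \<in> A \<and> i < j}" and ?G = "{(i,j). i \<in> A \<and> j \<in> A \<and> j < i}" and ?D = "{(i,j). i \<in> A \<and> j = i}"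
  have fin: "finite ?L" "finite ?G" "finite ?D"
    by (rule finite_subset[of _ "A \<times> A"]; use A in auto)+
  have "(\<Sum>i\<in>A. \<Sum>j\<in>A. h i j) = (\<Sum>(i,j)\<in>A \<times> A. h i j)"
    by (rule sum.cartesian_product)
  also have "A \<times> A = (?L \<union> ?G) \<union> ?D" by auto
  also have "(\<Sum>(i,j)\<in>\<dots>. h i j) = (\<Sum>(i,j)\<in>?L. h i j) + (\<Sum>(i,j)\<in>?G. h i j) + (\<Sum>(i,j)\<in>?D. h i j)"
    using fin by (subst sum.union_disjoint; (subst sum.union_disjoint)?) auto
  also have "(\<Sum>(i,j)\<in>?G. h i j) = (\<Sum>(i,j)\<in>?L. h i j)"
    by (rule sum.reindex_bij_witness[where i="\<lambda>(i,j). (j,i)" and j="\<lambda>(i,j). (j,i)"]) (auto simp: sym)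
  also have "(\<Sum>(i,j)\<in>?D. h i j) = (\<Sum>i\<in>A. h i i)"
    by (rule sum.reindex_bij_witness[where i="\<lambda>i. (i,i)" and j="fst"]) auto
  finally show ?thesis by simp
qed

lemma pairs_lessThan: "{(i,j). i < j \<and> j < (n::nat)} = {(i,j). i \<in> {..<n} \<and> j \<in> {..<n} \<and> i < j}"
  by auto

lemma finite_pairs: "finite {(i,j). i < j \<and> j < (n::nat)}"
  by (rule finite_subset[of _ "{..<n} \<times> {..<n}"]) auto

lemma card_pairs: "real (card {(i,j). i < j \<and> j < (n::nat)}) = real n * (real n - 1) / 2"
  using sum_pairs_symmetric[of "{..<n}" "\<lambda>_ _. 1"] unfolding pairs_lessThan
  by (simp add: case_prod_beta algebra_simps)

lemma cmod_le_exp_llog: "cmod x \<le> exp (llog x)"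
proof -
  have "cmod x \<le> sqrt (1 + (cmod x)\<^sup>2)" by (rule real_le_rsqrt) simp
  also have "\<dots> = exp (llog x)"
    unfolding llog_def by (simp add: ln_sqrt[symmetric] add_pos_nonneg)
  finally show ?thesis .
qed

lemma ln_cmod_diff_le: "ln (cmod (x - y)) \<le> ln 2 + max (llog x) (llog y)"
proof (cases "x = y")
  case False
  have "cmod (x - y) \<le> cmod x + cmod y" by (rule norm_triangle_ineq4)
  also have "\<dots> \<le> exp (llog x) + exp (llog y)" by (intro add_mono cmod_le_exp_llog)
  also have "\<dots> \<le> 2 * exp (max (llog x) (llog y))" by (auto simp: max_def)
  finally have "ln (cmod (x - y)) \<le> ln (2 * exp (max (llog x) (llog y)))"
    using False by (intro ln_mono) auto
  then show ?thesis by (simp add: ln_mult_pos)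
qed (use llog_nonneg[of x] in \<open>auto simp: max_def intro: add_nonneg_nonneg llog_nonneg\<close>)

text \<open>A Borel measure, unlike \<open>empirical\<close>, for which every set is measurable; and
  normalised by the number of particles in A, so that distant particles can be left out.\<close>

definition emp_on :: "nat set \<Rightarrow> (nat \<Rightarrow> complex) \<Rightarrow> complex measure" where
  "emp_on A x = distr (measure_pmf (pmf_of_set A)) borel x"

lemma bprob_emp_on: "bprob (emp_on A x)"
  unfolding emp_on_def bprob_def bprob_axioms_def
  by (auto intro!: prob_space.prob_space_distr measure_pmf.prob_space_axioms)

lemma integral_emp_on:
  fixes f :: "complex \<Rightarrow> real"
  assumes "finite A" "A \<noteq> {}" and [measurable]: "f \<in> borel_measurable borel"
  shows "(\<integral>y. f y \<partial>emp_on A x) = (\<Sum>i\<in>A. f (x i)) / real (card A)"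
  unfolding emp_on_def using assms by (subst integral_distr) (auto simp: integral_pmf_of_set)

lemma AE_emp_on:
  assumes "finite A" "A \<noteq> {}" "\<And>i. i \<in> A \<Longrightarrow> P (x i)" and [measurable]: "Measurable.pred borel P"
  shows "AE y in emp_on A x. P y"
  unfolding emp_on_def using assms by (subst AE_distr_iff) (auto simp: AE_measure_pmf_iff)

lemma bform_smlog_emp_on:
  assumes A: "finite A" "A \<noteq> {}" and L: "\<And>i. i \<in> A \<Longrightarrow> cmod (x i) \<le> L" and a: "a > 0"
  shows "bform (smlog a) (emp_on A x) (emp_on A x) = (\<Sum>i\<in>A. \<Sum>j\<in>A. smlog a ((cmod (x i - x j))\<^sup>2)) / (real (card A))\<^sup>2"
proof -
  interpret bprob "emp_on A x" by (rule bprob_emp_on)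
  interpret MM: bprob_pair "emp_on A x" "emp_on A x" ..
  have "AE y in emp_on A x. cmod y \<le> L" using A L by (intro AE_emp_on) auto
  note int = MM.bounded_kernel(1)[OF this this a order_refl]
  have "bform (smlog a) (emp_on A x) (emp_on A x) = (\<integral>u. (\<integral>v. smlog a ((cmod (u - v))\<^sup>2) \<partial>emp_on A x) \<partial>emp_on A x)"
    unfolding bform_def using MM.P.integral_fst'[OF int] by simp
  also have "\<dots> = (\<integral>u. (\<Sum>j\<in>A. smlog a ((cmod (u - x j))\<^sup>2)) / real (card A) \<partial>emp_on A x)"
    using A by (subst integral_emp_on) auto
  also have "\<dots> = (\<Sum>i\<in>A. \<Sum>j\<in>A. smlog a ((cmod (x i - x j))\<^sup>2)) / (real (card A))\<^sup>2"
    using A by (subst integral_emp_on) (auto simp: power2_eq_square sum_divide_distrib)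
  finally show ?thesis .
qed

text \<open>The truncated kernel is finite on the diagonal, whose contribution is of order
  \<open>card A\<close> only. Injectivity is essential: a coinciding pair contributes
  \<open>ln 0 = 0\<close> on the left, which can be below its truncated value.\<close>

lemma pair_log_ge_bform:
  assumes A: "finite A" "A \<noteq> {}" and L: "\<And>i. i \<in> A \<Longrightarrow> cmod (x i) \<le> L" and a: "a > 0" and inj: "inj_on x A"
  shows "(\<Sum>(i,j)\<in>{(i,j). i \<in> A \<and> j \<in> A \<and> i < j}. - ln (cmod (x i - x j))) \<ge>
    (real (card A))\<^sup>2 * bform (smlog a) (emp_on A x) (emp_on A x) / 2 - real (card A) * smlog a 0 / 2"
proof -
  let ?h = "\<lambda>i j. smlog a ((cmod (x i - x j))\<^sup>2)"
  have "(\<Sum>(i,j)\<in>{(i,j). i \<in> A \<and> j \<in> A \<and> i < j}. ?h i j) =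
    ((\<Sum>i\<in>A. \<Sum>j\<in>A. ?h i j) - (\<Sum>i\<in>A. ?h i i)) / 2"
    using A by (intro sum_pairs_symmetric) (auto simp: norm_minus_commute)
  also have "(\<Sum>i\<in>A. \<Sum>j\<in>A. ?h i j) = (real (card A))\<^sup>2 * bform (smlog a) (emp_on A x) (emp_on A x)"
    using A by (subst bform_smlog_emp_on[OF A L a]) auto
  finally have "(real (card A))\<^sup>2 * bform (smlog a) (emp_on A x) (emp_on A x) / 2 - real (card A) * smlog a 0 / 2
     = (\<Sum>(i,j)\<in>{(i,j). i \<in> A \<and> j \<in> A \<and> i < j}. ?h i j)"
    by (simp add: diff_divide_distrib)
  also have "\<dots> \<le> (\<Sum>(i,j)\<in>{(i,j). i \<in> A \<and> j \<in> A \<and> i < j}. - ln (cmod (x i - x j)))"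
  proof (intro sum_mono, clarsimp)
    fix i j assume ij: "i \<in> A" "j \<in> A" "i < j"
    then have "x i \<noteq> x j" using inj by (auto dest: inj_onD)
    then have s: "cmod (x i - x j) > 0" by simp
    then have "2 * ln (cmod (x i - x j)) = ln ((cmod (x i - x j))\<^sup>2)" by (simp add: ln_realpow)
    also have "\<dots> \<le> ln ((cmod (x i - x j))\<^sup>2 + a)" using s a by (intro ln_mono) auto
    finally show "?h i j \<le> - ln (cmod (x i - x j))" by (simp add: smlog_def)
  qed
  finally show ?thesis .
qed

context jellium
begin

definition pairE :: "(nat \<Rightarrow> complex) \<Rightarrow> nat \<Rightarrow> nat \<Rightarrow> real" where
  "pairE x i j = - ln (cmod (x i - x j)) + W (x i) + W (x j)"

lemma energy_alt:
  assumes "n > 0"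
  shows "energy R al n x = (\<Sum>(i,j)\<in>{(i,j). i < j \<and> j < n}. pairE x i j) + (al - real n + 1) * (\<Sum>i<n. W (x i))"
proof -
  have "(\<Sum>(i,j)\<in>{(i,j). i < j \<and> j < n}. W (x i) + W (x j)) = (real n - 1) * (\<Sum>i<n. W (x i))"
    unfolding pairs_lessThan by (subst sum_pairs_symmetric) (auto simp: sum.distrib sum_distrib_left[symmetric] field_simps)
  moreover have "(\<Sum>(i,j)\<in>{(i,j). i < j \<and> j < n}. pairE x i j) =
      (\<Sum>(i,j)\<in>{(i,j). i < j \<and> j < n}. - ln (cmod (x i - x j))) + (\<Sum>(i,j)\<in>{(i,j). i < j \<and> j < n}. W (x i) + W (x j))"
    unfolding pairE_def sum.distrib[symmetric] by (intro sum.cong) auto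
  moreover have "real n * (\<Sum>i<n. ext_pot R al n (x i)) = al * (\<Sum>i<n. W (x i))"
    using assms by (simp add: ext_pot_def W_def sum_distrib_left sum_negf)
  ultimately show ?thesis unfolding energy_def by (simp add: algebra_simps)
qed

end

section \<open>The bounded-Lipschitz distance and empirical measures\<close>

lemma dBL_bdd_above:
  assumes "prob_space M" "prob_space N"
  shows "bdd_above ((\<lambda>f. (\<integral>x. f x \<partial>M) - (\<integral>x. f x \<partial>N)) `
    {f :: complex \<Rightarrow> real. (\<forall>x. \<bar>f x\<bar> \<le> 1) \<and> (\<forall>x y. \<bar>f x - f y\<bar> \<le> dist x y)})"
proof (rule bdd_aboveI2[where M=2])
  have b: "\<bar>\<integral>x. f x \<partial>K\<bar> \<le> 1" if f: "\<And>x. \<bar>f x\<bar> \<le> 1" and "prob_space K" for f :: "complex \<Rightarrow> real" and K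
  \<comment> \<open>K is not assumed to live on the Borel sets, so f may fail to be integrable; its
    integral is then 0 by default and the bound still holds.\<close>
  proof (cases "integrable K f")
    case True
    interpret prob_space K by fact
    have "\<bar>\<integral>x. f x \<partial>K\<bar> \<le> (\<integral>x. \<bar>f x\<bar> \<partial>K)" by (rule integral_abs_bound)
    also have "\<dots> \<le> (\<integral>x. 1 \<partial>K)" using f True by (intro integral_mono) auto
    finally show ?thesis by (simp add: prob_space)
  qed (simp add: not_integrable_integral_eq)
  fix f :: "complex \<Rightarrow> real" assume "f \<in> {f. (\<forall>x. \<bar>f x\<bar> \<le> 1) \<and> (\<forall>x y. \<bar>f x - f y\<bar> \<le> dist x y)}"
  then have "\<And>x. \<bar>f x\<bar> \<le> 1" by auto
  then have "\<bar>\<integral>x. f x \<partial>M\<bar> \<le> 1" "\<bar>\<integral>x. f x \<partial>N\<bar> \<le> 1"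
    using assms by (auto intro!: b)
  then show "(\<integral>x. f x \<partial>M) - (\<integral>x. f x \<partial>N) \<le> 2" by linarith
qed

lemma dBL_ge_witness:
  assumes "prob_space M" "prob_space N" "dBL M N \<ge> \<epsilon>" "\<epsilon> > 0"
  obtains f where "\<And>x. \<bar>f x\<bar> \<le> 1" "\<And>x y. \<bar>f x - f y\<bar> \<le> dist x y" "(\<integral>x. f x \<partial>M) - (\<integral>x. f x \<partial>N) > \<epsilon> / 2"
proof -
  let ?F = "{f :: complex \<Rightarrow> real. (\<forall>x. \<bar>f x\<bar> \<le> 1) \<and> (\<forall>x y. \<bar>f x - f y\<bar> \<le> dist x y)}"
  have ne: "?F \<noteq> {}" by (auto intro!: exI[of _ "\<lambda>_. 0"])
  have "\<epsilon> / 2 < dBL M N" using assms by simp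
  then obtain f where "f \<in> ?F" "\<epsilon> / 2 < (\<integral>x. f x \<partial>M) - (\<integral>x. f x \<partial>N)"
    unfolding dBL_def less_cSUP_iff[OF ne dBL_bdd_above[OF assms(1,2)]] by blast
  then show ?thesis using that by auto
qed

lemma dBL_nonneg:
  assumes "prob_space M" "prob_space N"
  shows "dBL M N \<ge> 0"
proof -
  have "(\<integral>x. 0 \<partial>M) - (\<integral>x. 0 \<partial>N) \<le> dBL M N"
    unfolding dBL_def by (rule cSUP_upper[OF _ dBL_bdd_above[OF assms]]) auto
  then show ?thesis by simp
qed

lemma empirical_prob: "prob_space (empirical n x)"
  unfolding empirical_def by (rule measure_pmf.prob_space_axioms)

lemma integral_empirical:
  fixes f :: "complex \<Rightarrow> real"
  assumes "n > 0"
  shows "(\<integral>y. f y \<partial>empirical n x) = (\<Sum>i<n. f (x i)) / real n"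
proof -
  have "pmf_of_multiset (image_mset x (mset_set {..<n})) = map_pmf x (pmf_of_set {..<n})"
    using assms by (subst map_pmf_of_set) (auto simp: lessThan_empty_iff)
  moreover have "(\<integral>y. f y \<partial>measure_pmf (map_pmf x (pmf_of_set {..<n}))) = (\<Sum>i<n. f (x i)) / real n"
    using assms by (simp add: map_pmf_rep_eq integral_distr integral_pmf_of_set lessThan_empty_iff)
  ultimately show ?thesis unfolding empirical_def by simp
qed

section \<open>The energy gap away from the equilibrium measure\<close>

definition pairmin :: "nat \<Rightarrow> (nat \<Rightarrow> complex) \<Rightarrow> real" where
  "pairmin n x = (\<Sum>(i,j)\<in>{(i,j). i < j \<and> j < n}. min (llog (x i)) (llog (x j)))"

lemma pairmin_nonneg: "pairmin n x \<ge> 0"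
  unfolding pairmin_def by (intro sum_nonneg) (auto simp: llog_nonneg)

lemma pairmin_ge:
  fixes n :: nat and x :: "nat \<Rightarrow> complex"
  assumes "L \<ge> 1"
  defines "F \<equiv> {i. i < n \<and> cmod (x i) > L}"
  shows "pairmin n x \<ge> ln L * (real (card F) * (real (card F) - 1) / 2)"
proof -
  let ?P = "{(i,j). i \<in> F \<and> j \<in> F \<and> i < j}"
  have fin: "finite F" by (simp add: F_def)
  have ge: "ln L \<le> llog (x i)" if "i \<in> F" for i
  proof -
    have "ln L \<le> ln (exp (llog (x i)))"
      using that assms(1) cmod_le_exp_llog[of "x i"] by (intro ln_mono) (auto simp: F_def)
    then show ?thesis by simp
  qed
  have "ln L * (real (card F) * (real (card F) - 1) / 2) = (\<Sum>(i,j)\<in>?P. ln L)"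
    by (subst sum_pairs_symmetric[OF fin]) (auto simp: algebra_simps)
  also have "\<dots> \<le> (\<Sum>(i,j)\<in>?P. min (llog (x i)) (llog (x j)))"
    using ge by (intro sum_mono) auto
  also have "\<dots> \<le> pairmin n x"
    unfolding pairmin_def by (intro sum_mono2 finite_pairs) (auto simp: F_def llog_nonneg)
  finally show ?thesis .
qed

context jellium
begin

text \<open>With a cutoff equal to \<open>1\<close> on the support of \<open>\<nu>\<close>, cutting off \<open>f - 1 \<le> 0\<close> instead of \<open>f\<close> can
  only increase the integral over the particles, so that no tightness is needed.\<close>

lemma near_separated:
  assumes \<epsilon>: "\<epsilon> > 0"
  obtains c where "c > 0"
    "\<And>n A x L a. \<lbrakk>n > 0; A \<subseteq> {..<n}; A \<noteq> {}; r \<le> L; \<And>i. i \<in> A \<Longrightarrow> cmod (x i) \<le> L;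
       real n - real (card A) \<le> \<epsilon> / 16 * real n; dBL (empirical n x) \<nu> \<ge> \<epsilon>; 0 < a; a \<le> 1\<rbrakk> \<Longrightarrow>
       dform (smlog a) (emp_on A x) \<nu> \<ge> c"
proof (rule dform_smlog_separated[of "\<epsilon> / 4" "r + 1"])
  show "\<epsilon> / 4 > 0" "r + 1 > 0" using \<epsilon> r_pos by auto
  fix c :: real
  assume c: "c > 0" and D: "\<And>M N L a g. \<lbrakk>bprob M; bprob N; AE x in M. cmod x \<le> L; AE x in N. cmod x \<le> L; 0 < a; a \<le> 1;
       g \<in> borel_measurable borel; \<And>x. \<bar>g x\<bar> \<le> 2; \<And>x y. \<bar>g x - g y\<bar> \<le> 3 * dist x y;
       \<And>x. cmod x > r + 1 \<Longrightarrow> g x = 0; (\<integral>x. g x \<partial>M) - (\<integral>x. g x \<partial>N) \<ge> \<epsilon> / 4\<rbrakk> \<Longrightarrow> dform (smlog a) M N \<ge> c"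
  show thesis
  proof (rule that[OF c])
    fix n A and x :: "nat \<Rightarrow> complex" and L a :: real
    assume n: "n > 0" and A: "A \<subseteq> {..<n}" "A \<noteq> {}" and L: "r \<le> L" "\<And>i. i \<in> A \<Longrightarrow> cmod (x i) \<le> L"
      and m: "real n - real (card A) \<le> \<epsilon> / 16 * real n" and d: "dBL (empirical n x) \<nu> \<ge> \<epsilon>" and a: "0 < a" "a \<le> 1"
    have fin: "finite A" using A finite_subset by blast
    obtain f where f1: "\<And>x. \<bar>f x\<bar> \<le> 1" and flip: "\<And>x y. \<bar>f x - f y\<bar> \<le> dist x y"
      and fs: "(\<integral>x. f x \<partial>empirical n x) - (\<integral>x. f x \<partial>\<nu>) > \<epsilon> / 2"
      using dBL_ge_witness[OF empirical_prob \<nu>.prob_space_axioms d \<epsilon>] by metis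
    have "continuous_on UNIV f"
      using flip by (intro lipschitz_on_continuous_on[of 1] lipschitz_onI) (auto simp: dist_real_def)
    then have [measurable]: "f \<in> borel_measurable borel" by (rule borel_measurable_continuous_onI)
    interpret M: bprob "emp_on A x" by (rule bprob_emp_on)
    define h where "h = real n - real (card A)"
    have cA: "real (card A) \<le> real n" "real (card A) > 0"
      using card_mono[OF _ A(1)] A fin by (auto simp: card_gt_0_iff)
    \<comment> \<open>One \<epsilon> / 16 comes from the omitted particles, the other from the
      change of normalisation from n to \<open>card A\<close>.\<close>
    have avg: "(\<integral>y. f y \<partial>empirical n x) - (\<integral>y. f y \<partial>emp_on A x) \<le> 2 * (\<epsilon> / 16)"
    proof -
      let ?S = "\<Sum>i\<in>A. f (x i)"
      have "(\<Sum>i<n. f (x i)) = ?S + (\<Sum>i\<in>{..<n} - A. f (x i))"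
        using sum.subset_diff[OF A(1), of "\<lambda>i. f (x i)"] by simp
      moreover have "(\<Sum>i\<in>{..<n} - A. f (x i)) \<le> (\<Sum>i\<in>{..<n} - A. 1)"
        using f1 by (intro sum_mono) (auto simp: abs_le_iff)
      moreover have "(\<Sum>i\<in>{..<n} - A. 1) = h"
        using A fin cA(1) by (simp add: h_def card_Diff_subset of_nat_diff)
      ultimately have 1: "(\<Sum>i<n. f (x i)) \<le> ?S + h" by linarith
      have "- ?S \<le> (\<Sum>i\<in>A. 1)"
        unfolding sum_negf[symmetric] using f1 by (intro sum_mono) (auto simp: abs_le_iff)
      moreover have "?S \<le> (\<Sum>i\<in>A. 1)" using f1 by (intro sum_mono) (auto simp: abs_le_iff)
      ultimately have S: "\<bar>?S\<bar> \<le> real (card A)" by (simp add: abs_le_iff)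
      have h0: "h \<ge> 0" using cA by (simp add: h_def)
      have "?S / real n - ?S / real (card A) = - ?S * h / (real n * real (card A))"
        using cA n by (simp add: h_def field_simps)
      also have "\<dots> \<le> real (card A) * h / (real n * real (card A))"
        using S h0 cA n by (intro divide_right_mono mult_right_mono) auto
      also have "\<dots> = h / real n" using cA by simp
      finally have "?S / real n - ?S / real (card A) \<le> h / real n" .
      moreover have "(\<Sum>i<n. f (x i)) / real n \<le> ?S / real n + h / real n"
        using divide_right_mono[OF 1, of "real n"] by (simp add: add_divide_distrib)
      moreover have "h / real n \<le> \<epsilon> / 16" using m n by (simp add: h_def divide_le_eq)
      ultimately have "(\<Sum>i<n. f (x i)) / real n - ?S / real (card A) \<le> 2 * (\<epsilon> / 16)" by linarith
      then show ?thesis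
        using n A fin by (simp add: integral_empirical integral_emp_on)
    qed
    define cut where "cut y = max 0 (min 1 (r + 1 - cmod y))" for y
    have [measurable]: "cut \<in> borel_measurable borel" unfolding cut_def[abs_def] by measurable
    have cut01: "0 \<le> cut y" "cut y \<le> 1" for y by (auto simp: cut_def)
    have cutlip: "\<bar>cut y - cut z\<bar> \<le> dist y z" for y z
    proof -
      have "\<bar>cmod y - cmod z\<bar> \<le> dist y z" by (simp add: dist_norm norm_triangle_ineq3)
      then show ?thesis unfolding cut_def by (auto simp: max_def min_def abs_if split: if_splits)
    qed
    \<comment> \<open>Since |f - 1| \<le> 2, the product rule gives the Lipschitz constant 1 + 2 = 3
      and the bound 2 under which \<open>dform_smlog_separated\<close> was prepared.\<close>
    define g where "g y = (f y - 1) * cut y" for y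
    have [measurable]: "g \<in> borel_measurable borel" unfolding g_def[abs_def] by measurable
    have g2: "\<bar>g y\<bar> \<le> 2" for y
    proof -
      have "\<bar>f y - 1\<bar> * \<bar>cut y\<bar> \<le> 2 * 1" using f1[of y] cut01[of y] by (intro mult_mono) (auto simp: abs_le_iff)
      then show ?thesis by (simp add: g_def abs_mult)
    qed
    have glip: "\<bar>g y - g z\<bar> \<le> 3 * dist y z" for y z
    proof -
      have "g y - g z = (f y - f z) * cut y + (f z - 1) * (cut y - cut z)"
        by (simp add: g_def algebra_simps)
      also have "\<bar>\<dots>\<bar> \<le> \<bar>f y - f z\<bar> * \<bar>cut y\<bar> + \<bar>f z - 1\<bar> * \<bar>cut y - cut z\<bar>"
        by (metis abs_mult abs_triangle_ineq)
      also have "\<dots> \<le> dist y z * 1 + 2 * dist y z"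
        using flip[of y z] cut01[of y] f1[of z] cutlip[of y z] by (intro add_mono mult_mono) (auto simp: abs_le_iff)
      finally show ?thesis by simp
    qed
    have gsupp: "g y = 0" if "cmod y > r + 1" for y using that by (simp add: g_def cut_def)
    have if': "integrable K f" if "bprob K" for K
    proof -
      interpret K: bprob K by fact
      show ?thesis using f1 by (intro K.integrable_const_bound[where B=1]) auto
    qed
    have ig: "integrable K g" if "bprob K" for K
    proof -
      interpret K: bprob K by fact
      show ?thesis using g2 by (intro K.integrable_const_bound[where B=2]) auto
    qed
    have "(\<integral>y. f y \<partial>emp_on A x) \<le> (\<integral>y. g y + 1 \<partial>emp_on A x)"
    proof (rule integral_mono)
      fix y
      have "0 \<le> (1 - f y) * (1 - cut y)" using f1[of y] cut01[of y] by (intro mult_nonneg_nonneg) (auto simp: abs_le_iff)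
      then show "f y \<le> g y + 1" by (simp add: g_def algebra_simps)
    qed (use if' ig bprob_emp_on in auto)
    then have 1: "(\<integral>y. f y \<partial>emp_on A x) \<le> (\<integral>y. g y \<partial>emp_on A x) + 1"
      using ig[OF bprob_emp_on] M.prob_space by simp
    have "(\<integral>y. f y \<partial>\<nu>) = (\<integral>y. g y + 1 \<partial>\<nu>)"
    proof (rule integral_cong_AE)
      show "AE y in \<nu>. f y = g y + 1"
        using AE_\<nu> by eventually_elim (simp add: g_def cut_def)
    qed measurable
    then have 2: "(\<integral>y. f y \<partial>\<nu>) = (\<integral>y. g y \<partial>\<nu>) + 1"
      using ig[OF \<nu>.bprob_axioms] \<nu>.prob_space by simp
    show "dform (smlog a) (emp_on A x) \<nu> \<ge> c"
    proof (rule D[OF bprob_emp_on \<nu>.bprob_axioms _ _ a _ g2 glip gsupp])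
      show "AE y in emp_on A x. cmod y \<le> L" using A fin L by (intro AE_emp_on) auto
      show "AE y in \<nu>. cmod y \<le> L" using AE_\<nu> by eventually_elim (use L in auto)
      \<comment> \<open>The separation is \<epsilon> / 2 for f and loses \<epsilon> / 8 in
        \<open>avg\<close>.\<close>
      show "\<epsilon> / 4 \<le> (\<integral>y. g y \<partial>emp_on A x) - (\<integral>y. g y \<partial>\<nu>)" using 1 2 avg fs \<epsilon> by linarith
    qed auto
  qed
qed

text \<open>At infinity the logarithm takes away at most the larger \<open>llog\<close>, while the
  two potentials supply both; the smaller one is left over. This leftover is the repulsion collected
  in \<open>pairmin\<close>.\<close>

lemma pairE_ge:
  assumes "\<And>x. \<bar>W x - llog x\<bar> \<le> C"
  shows "pairE x i j \<ge> min (llog (x i)) (llog (x j)) - (2 * C + ln 2)"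
  using ln_cmod_diff_le[of "x i" "x j"] assms[of "x i"] assms[of "x j"] unfolding pairE_def abs_le_iff
  by (simp add: max_def min_def split: if_splits)

lemma sum_pairE_ge:
  assumes "C \<ge> 0" "\<And>x. \<bar>W x - llog x\<bar> \<le> C"
  shows "(\<Sum>(i,j)\<in>{(i,j). i < j \<and> j < n}. pairE x i j) \<ge> pairmin n x - (2 * C + ln 2) * (real n)\<^sup>2 / 2"
proof -
  let ?P = "{(i,j). i < j \<and> j < n}"
  have "pairmin n x - (2 * C + ln 2) * (real n * (real n - 1) / 2) = (\<Sum>(i,j)\<in>?P. min (llog (x i)) (llog (x j)) - (2 * C + ln 2))"
    unfolding pairmin_def card_pairs[symmetric] by (simp add: case_prod_beta sum_subtractf)
  also have "\<dots> \<le> (\<Sum>(i,j)\<in>?P. pairE x i j)"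
    using pairE_ge[OF assms(2)] by (intro sum_mono) auto
  finally have "pairmin n x - (2 * C + ln 2) * (real n * (real n - 1) / 2) \<le> (\<Sum>(i,j)\<in>?P. pairE x i j)" .
  moreover have "(2 * C + ln 2) * (real n * (real n - 1) / 2) \<le> (2 * C + ln 2) * ((real n)\<^sup>2 / 2)"
    using assms(1) by (intro mult_left_mono) (auto simp: power2_eq_square algebra_simps)
  ultimately show ?thesis by simp
qed

lemma sum_W_ge:
  assumes "\<And>x. \<bar>W x - llog x\<bar> \<le> C"
  shows "(\<Sum>i<n. W (x i)) \<ge> (\<Sum>i<n. llog (x i)) - real n * C"
proof -
  have "(\<Sum>i<n. llog (x i)) - real n * C = (\<Sum>i<n. llog (x i) - C)" by (simp add: sum_subtractf)
  also have "\<dots> \<le> (\<Sum>i<n. W (x i))"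
    using assms by (intro sum_mono) (simp add: abs_le_iff algebra_simps)
  finally show ?thesis .
qed

text \<open>If many particles are far away, their mutual repulsion on the sphere compactifying the plane
  already makes the energy large.\<close>

lemma energy_far:
  assumes C: "C \<ge> 0" "\<And>x. \<bar>W x - llog x\<bar> \<le> C" and \<delta>: "\<delta> > 0" and L: "L \<ge> 1"
    "ln L \<ge> 8 * (\<bar>T\<bar> + 2 * C + ln 2 + 2 * lam * C) / \<delta>\<^sup>2"
    and \<kappa>: "0 < \<kappa>" "\<kappa> \<le> 1/2" and n: "real n \<ge> 2 / \<delta>" "n > 0" and \<gamma>: "0 \<le> \<gamma>" "\<gamma> \<le> \<kappa> * lam * real n"
    and al: "al - real n + 1 = (1 - \<kappa>) * (lam - 1) * real n + \<gamma>"
    and far: "real (card {i. i < n \<and> cmod (x i) > L}) \<ge> \<delta> * real n"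
  shows "energy R al n x \<ge> (real n)\<^sup>2 * T + \<kappa> * pairmin n x + \<gamma> * (\<Sum>i<n. llog (x i))"
proof -
  define S where "S = pairmin n x"
  define h where "h = real (card {i. i < n \<and> cmod (x i) > L})"
  define l where "l = (\<Sum>i<n. llog (x i))"
  define w where "w = (\<Sum>i<n. W (x i))"
  define C1 where "C1 = 2 * C + ln 2"
  have l0: "l \<ge> 0" unfolding l_def by (intro sum_nonneg) (simp add: llog_nonneg)
  have C1: "C1 \<ge> 0" using C by (simp add: C1_def)
  have w: "w \<ge> l - real n * C" unfolding w_def l_def by (rule sum_W_ge[OF C(2)])
  have S0: "S \<ge> 0" unfolding S_def by (rule pairmin_nonneg)
  have "S \<ge> ln L * (h * (h - 1) / 2)" unfolding S_def h_def by (rule pairmin_ge[OF L(1)])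
  moreover have "ln L * (h * (h - 1) / 2) \<ge> ln L * (\<delta>\<^sup>2 * (real n)\<^sup>2 / 4)"
  proof (rule mult_left_mono)
    \<comment> \<open>From \<delta> n \<ge> 2 one gets h - 1 \<ge> \<delta> n / 2, which makes the
      number of far pairs quadratic in n.\<close>
    have d: "\<delta> * real n \<ge> 2" using n \<delta> by (simp add: divide_le_eq mult.commute)
    have "(\<delta> * real n) * (\<delta> * real n / 2) \<le> h * (h - 1)"
      using far d unfolding h_def[symmetric] by (intro mult_mono) auto
    then show "\<delta>\<^sup>2 * (real n)\<^sup>2 / 4 \<le> h * (h - 1) / 2" by (simp add: power2_eq_square mult_ac)
  qed (use L in auto)
  moreover have "ln L * (\<delta>\<^sup>2 * (real n)\<^sup>2 / 4) \<ge> 2 * (\<bar>T\<bar> + C1 + 2 * lam * C) * (real n)\<^sup>2"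
  proof -
    have "8 * (\<bar>T\<bar> + C1 + 2 * lam * C) \<le> ln L * \<delta>\<^sup>2"
      using L(2) \<delta> by (simp add: divide_le_eq C1_def algebra_simps)
    from mult_right_mono[OF this, of "(real n)\<^sup>2 / 4"] show ?thesis by (simp add: algebra_simps)
  qed
  ultimately have S1: "S \<ge> 2 * (\<bar>T\<bar> + C1 + 2 * lam * C) * (real n)\<^sup>2" by linarith
  have E: "energy R al n x = (\<Sum>(i,j)\<in>{(i,j). i < j \<and> j < n}. pairE x i j) + ((1 - \<kappa>) * (lam - 1) * real n + \<gamma>) * w"
    using energy_alt[OF n(2), of al x] al by (simp add: w_def)
  have 1: "(\<Sum>(i,j)\<in>{(i,j). i < j \<and> j < n}. pairE x i j) \<ge> S - C1 * (real n)\<^sup>2 / 2"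
    unfolding S_def C1_def by (rule sum_pairE_ge[OF C])
  have 2: "(1 - \<kappa>) * (lam - 1) * real n * w \<ge> - (lam * C * (real n)\<^sup>2)"
  proof -
    have "(1 - \<kappa>) * (lam - 1) * real n * w \<ge> (1 - \<kappa>) * (lam - 1) * real n * (- (real n * C))"
      using w l0 \<kappa> lam_ge by (intro mult_left_mono) auto
    moreover have "(1 - \<kappa>) * (lam - 1) * (C * (real n)\<^sup>2) \<le> lam * (C * (real n)\<^sup>2)"
    proof (rule mult_right_mono)
      have "(1 - \<kappa>) * (lam - 1) \<le> 1 * (lam - 1)" using \<kappa> lam_ge by (intro mult_right_mono) auto
      also have "\<dots> \<le> lam" by simp
      finally show "(1 - \<kappa>) * (lam - 1) \<le> lam" .
    qed (use C in auto)
    ultimately show ?thesis by (simp add: power2_eq_square mult_ac)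
  qed
  have 3: "\<gamma> * w \<ge> \<gamma> * l - lam * C * (real n)\<^sup>2"
  proof -
    have "\<gamma> * w \<ge> \<gamma> * (l - real n * C)" using w \<gamma> by (intro mult_left_mono) auto
    moreover have "\<gamma> * (real n * C) \<le> (lam * real n) * (real n * C)"
    proof (rule mult_right_mono)
      have "\<kappa> * (lam * real n) \<le> 1 * (lam * real n)" using \<kappa> lam_ge by (intro mult_right_mono) auto
      then show "\<gamma> \<le> lam * real n" using \<gamma> by simp
    qed (use C in auto)
    ultimately show ?thesis by (simp add: power2_eq_square algebra_simps)
  qed
  \<comment> \<open>As \<kappa> \<le> 1/2, half of \<open>S\<close> remains after the reserved
    share; the threshold on \<open>ln L\<close> was chosen so that this half pays for T and all
    errors.\<close>
  have 4: "S \<ge> \<kappa> * S + S / 2"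
    using mult_right_mono[OF \<kappa>(2) S0] by simp
  have 5: "S / 2 \<ge> (real n)\<^sup>2 * T + C1 * (real n)\<^sup>2 / 2 + 2 * (lam * C * (real n)\<^sup>2)"
  proof -
    have "T * (real n)\<^sup>2 \<le> \<bar>T\<bar> * (real n)\<^sup>2" by (intro mult_right_mono) auto
    moreover have "C1 * (real n)\<^sup>2 \<ge> 0" using C1 by simp
    ultimately show ?thesis using S1 by (simp add: algebra_simps)
  qed
  show ?thesis
    using 1 2 3 4 5 unfolding E S_def[symmetric] l_def[symmetric] distrib_right by linarith
qed

text \<open>The near particles obey the smoothed continuum bound. The far ones are few and lower the
  energy by at most a small multiple of n^2, since \<open>pairE\<close> and \<open>W\<close> are
  bounded below. The fractions of c0 in the hypotheses each pay for one error.\<close>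

lemma energy_near:
  assumes C: "C \<ge> 0" "\<And>x. \<bar>W x - llog x\<bar> \<le> C" and C1: "C1 = 2 * C + ln 2"
    and X: "X = J + 3 * c0 / 8" and c0: "c0 > 0"
    and \<delta>: "0 < \<delta>" "\<delta> \<le> 1/2" "(C1 + 2 * lam * C + 2 * \<bar>X\<bar>) * \<delta> \<le> c0 / 16"
    and L: "r \<le> L" and a: "0 < a" "a \<le> 1" "sqrt a * (1 + 2 / r\<^sup>2) \<le> c0 / 8"
    and \<kappa>: "0 < \<kappa>" "\<kappa> \<le> 1/2" "\<kappa> * (\<bar>X\<bar> + C1 + lam * C) \<le> c0 / 16"
    and n: "n > 0" "smlog a 0 + \<bar>C + ln (1 + L\<^sup>2) / 2\<bar> \<le> c0 / 16 * real n" and \<gamma>: "0 \<le> \<gamma>" "\<gamma> \<le> \<kappa> * lam * real n"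
    and al: "al - real n + 1 = (1 - \<kappa>) * (lam - 1) * real n + \<gamma>"
    and inj: "inj_on x {..<n}"
    and near: "real (card {i. i < n \<and> cmod (x i) > L}) \<le> \<delta> * real n"
    and D: "dform (smlog a) (emp_on {i. i < n \<and> cmod (x i) \<le> L} x) \<nu> \<ge> c0"
  shows "energy R al n x \<ge> (real n)\<^sup>2 * (J + c0 / 16) + \<kappa> * pairmin n x + \<gamma> * (\<Sum>i<n. llog (x i))"
proof -
  define A where "A = {i. i < n \<and> cmod (x i) \<le> L}"
  define F where "F = {i. i < n \<and> cmod (x i) > L}"
  have fin: "finite A" "finite F" by (auto simp: A_def F_def)
  have AF: "{..<n} = A \<union> F" "A \<inter> F = {}" by (auto simp: A_def F_def)
  define N where "N = real n"
  define m where "m = real (card A)"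
  define h where "h = real (card F)"
  have "card {..<n} = card A + card F" unfolding AF(1) by (rule card_Un_disjoint) (use fin AF in auto)
  then have mh: "m + h = N" by (simp add: N_def m_def h_def)
  have N0: "N > 0" using n by (simp add: N_def)
  have h: "0 \<le> h" "h \<le> \<delta> * N" using near by (auto simp: h_def N_def F_def)
  have "h \<le> N / 2" using h \<delta> N0 mult_right_mono[of \<delta> "1/2" N] by linarith
  then have m: "0 < m" "m \<le> N" using mh N0 h by auto
  have Ane: "A \<noteq> {}" using m by (auto simp: m_def)
  define S where "S = pairmin n x"
  define l where "l = (\<Sum>i<n. llog (x i))"
  define w where "w = (\<Sum>i<n. W (x i))"
  define wA where "wA = (\<Sum>i\<in>A. W (x i))"
  define Sk where "Sk = (\<Sum>(i,j)\<in>{(i,j). i < j \<and> j < n}. pairE x i j)"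
  define SA where "SA = (\<Sum>(i,j)\<in>{(i,j). i \<in> A \<and> j \<in> A \<and> i < j}. pairE x i j)"
  define B where "B = bform (smlog a) (emp_on A x) (emp_on A x)"
  have C10: "C1 \<ge> 0" using C C1 by simp
  have W_ge: "W y \<ge> - C" for y using C(2)[of y] llog_nonneg[of y] by (simp add: abs_le_iff)
  have F2: "Sk \<ge> S - C1 * N\<^sup>2 / 2"
    unfolding Sk_def S_def C1 N_def by (rule sum_pairE_ge[OF C])
  have F1: "Sk \<ge> SA - C1 * (h * N)"
  proof -
    let ?P = "{(i,j). i < j \<and> j < n}" and ?PA = "{(i,j). i \<in> A \<and> j \<in> A \<and> i < j}"
    have sub: "?PA \<subseteq> ?P" by (auto simp: A_def)
    have "Sk = SA + (\<Sum>(i,j)\<in>?P - ?PA. pairE x i j)"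
      unfolding Sk_def SA_def using sum.subset_diff[OF sub finite_pairs, of "\<lambda>(i,j). pairE x i j"] by simp
    moreover have "(\<Sum>(i,j)\<in>?P - ?PA. pairE x i j) \<ge> (\<Sum>(i,j)\<in>?P - ?PA. - C1)"
    proof -
      have "- C1 \<le> pairE x i j" for i j
        using pairE_ge[OF C(2), of x i j] llog_nonneg[of "x i"] llog_nonneg[of "x j"] unfolding C1 by (simp add: min_def split: if_splits)
      then show ?thesis by (intro sum_mono) auto
    qed
    moreover have "(\<Sum>(i,j)\<in>?P - ?PA. - C1) \<ge> - (C1 * (h * N))"
    proof -
      let ?Q = "F \<times> {..<n}"
      \<comment> \<open>Orients a pair so that a far particle comes first: at most
        \<open>h * N\<close> pairs contain one.\<close>
      define \<phi> where "\<phi> = (\<lambda>(i,j). if i \<in> F then (i,j) else (j,i) :: nat \<times> nat)"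
      have "card (?P - ?PA) \<le> card ?Q"
      proof (rule card_inj_on_le[of \<phi>])
        show "inj_on \<phi> (?P - ?PA)" by (auto simp: inj_on_def \<phi>_def split: if_splits)
        show "\<phi> ` (?P - ?PA) \<subseteq> ?Q" by (auto simp: \<phi>_def A_def F_def split: if_splits)
      qed (use fin in auto)
      then have "real (card (?P - ?PA)) \<le> h * N" 
        unfolding h_def N_def by (simp add: card_cartesian_product flip: of_nat_mult)
      then have "real (card (?P - ?PA)) * C1 \<le> (h * N) * C1" using C10 by (rule mult_right_mono)
      then show ?thesis by (simp add: case_prod_beta mult.commute)
    qed
    ultimately show ?thesis by linarith
  qed
  have F3: "N * w \<ge> m * wA - 2 * (h * N) * C"
  proof -
    have "w = wA + (\<Sum>i\<in>F. W (x i))" unfolding w_def wA_def AF(1) by (rule sum.union_disjoint) (use fin AF in auto)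
    moreover have "(\<Sum>i\<in>F. W (x i)) \<ge> (\<Sum>i\<in>F. - C)" using W_ge by (intro sum_mono)
    ultimately have "w \<ge> wA - h * C" by (simp add: h_def)
    from mult_left_mono[OF this, of N] have 1: "N * w \<ge> N * wA - N * (h * C)" using N0 by (simp add: right_diff_distrib)
    have "wA \<ge> (\<Sum>i\<in>A. - C)" unfolding wA_def using W_ge by (intro sum_mono)
    then have "wA \<ge> - (m * C)" by (simp add: m_def)
    from mult_left_mono[OF this h(1)] have "h * wA \<ge> - (h * (m * C))" by simp
    moreover have "h * (m * C) \<le> h * (N * C)" using m h C by (intro mult_left_mono mult_right_mono) auto
    moreover have "N * wA = m * wA + h * wA" using mh by (simp add: distrib_right[symmetric])
    ultimately show ?thesis using 1 by (simp add: algebra_simps)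
  qed
  \<comment> \<open>A near particle lies in m - 1 near pairs. The missing \<open>wA\<close> is at
    most of order n and is paid in \<open>F11\<close>, together with the diagonal.\<close>
  have F4: "SA \<ge> m\<^sup>2 * B / 2 - m * smlog a 0 / 2 + (m - 1) * wA"
  proof -
    let ?PA = "{(i,j). i \<in> A \<and> j \<in> A \<and> i < j}"
    have "(\<Sum>(i,j)\<in>?PA. W (x i) + W (x j)) = (m - 1) * wA"
      by (subst sum_pairs_symmetric[OF fin(1)]) (auto simp: sum.distrib sum_distrib_left[symmetric] wA_def m_def field_simps)
    moreover have "SA = (\<Sum>(i,j)\<in>?PA. - ln (cmod (x i - x j))) + (\<Sum>(i,j)\<in>?PA. W (x i) + W (x j))"
      unfolding SA_def pairE_def sum.distrib[symmetric] by (intro sum.cong) auto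
    moreover have "inj_on x A" using inj by (rule inj_on_subset) (auto simp: A_def)
    then have "(\<Sum>(i,j)\<in>?PA. - ln (cmod (x i - x j))) \<ge> m\<^sup>2 * B / 2 - m * smlog a 0 / 2"
      unfolding m_def B_def using fin Ane a by (intro pair_log_ge_bform[where L=L]) (auto simp: A_def)
    ultimately show ?thesis by linarith
  qed
  \<comment> \<open>Half of \<open>dform\<close> gives c0 / 2 and truncation costs c0 / 8, whence
    the 3/8 in \<open>X\<close>.\<close>
  have F5: "B / 2 + lam * (wA / m) \<ge> X"
  proof -
    have "AE y in emp_on A x. cmod y \<le> L" using fin Ane by (intro AE_emp_on) (auto simp: A_def)
    from smoothed_energy_ge[OF bprob_emp_on this L a(1)]
    have "B / 2 + lam * (wA / m) \<ge> dform (smlog a) (emp_on A x) \<nu> / 2 + J - sqrt a * (1 + 2 / r\<^sup>2)"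
      using fin Ane by (simp add: B_def wA_def m_def integral_emp_on)
    moreover have "dform (smlog a) (emp_on A x) \<nu> \<ge> c0" using D by (simp add: A_def)
    ultimately show ?thesis using a(3) X by linarith
  qed
  define CL where "CL = \<bar>C + ln (1 + L\<^sup>2) / 2\<bar>"
  have F6: "wA \<le> N * CL"
  proof -
    have "wA \<le> (\<Sum>i\<in>A. CL)"
      unfolding wA_def
    proof (rule sum_mono)
      fix i assume "i \<in> A"
      then have "llog (x i) \<le> ln (1 + L\<^sup>2) / 2" by (intro llog_le) (auto simp: A_def)
      then show "W (x i) \<le> CL" using C(2)[of "x i"] unfolding CL_def abs_le_iff by linarith
    qed
    also have "\<dots> = m * CL" by (simp add: m_def)
    also have "\<dots> \<le> N * CL" using m by (intro mult_right_mono) (auto simp: CL_def)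
    finally show ?thesis .
  qed
  have s0: "smlog a 0 \<ge> 0" using a by (simp add: smlog_def)
  \<comment> \<open>The energy is (1 - \<kappa>) Y + \<kappa> Sk + \<gamma> w: the first term
    carries the gap, the other two keep the integrability at infinity.\<close>
  define Y where "Y = Sk + (lam - 1) * (N * w)"
  have F7: "(lam - 1) * (N * w) \<ge> (lam - 1) * (m * wA) - 2 * lam * C * (h * N)"
  proof -
    have "(lam - 1) * (N * w) \<ge> (lam - 1) * (m * wA - 2 * (h * N) * C)"
      using F3 lam_ge by (intro mult_left_mono) auto
    moreover have "(lam - 1) * (2 * (h * N) * C) \<le> lam * (2 * (h * N) * C)"
      using h N0 C by (intro mult_right_mono) auto
    ultimately show ?thesis by (simp add: algebra_simps)
  qed
  have F8: "m\<^sup>2 * B / 2 + lam * (m * wA) \<ge> m\<^sup>2 * X"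
  proof -
    have "m\<^sup>2 * (B / 2 + lam * (wA / m)) \<ge> m\<^sup>2 * X" using F5 by (intro mult_left_mono) auto
    moreover have "m\<^sup>2 * (B / 2 + lam * (wA / m)) = m\<^sup>2 * B / 2 + lam * (m * wA)"
      using m by (simp add: power2_eq_square field_simps)
    ultimately show ?thesis by simp
  qed
  have F9: "m\<^sup>2 * X \<ge> N\<^sup>2 * X - 2 * \<bar>X\<bar> * (h * N)"
  proof -
    have "N\<^sup>2 - m\<^sup>2 = h * (N + m)" using mh by (simp add: power2_eq_square algebra_simps flip: mh)
    moreover have "h * (N + m) \<le> h * (2 * N)" using h m by (intro mult_left_mono) auto
    moreover have "0 \<le> h * (N + m)" using h m N0 by simp
    ultimately have "(N\<^sup>2 - m\<^sup>2) * X \<le> (N\<^sup>2 - m\<^sup>2) * \<bar>X\<bar>" "(N\<^sup>2 - m\<^sup>2) * \<bar>X\<bar> \<le> h * (2 * N) * \<bar>X\<bar>"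
      by (auto intro!: mult_left_mono mult_right_mono)
    then show ?thesis by (simp add: algebra_simps)
  qed
  have F10: "(C1 + 2 * lam * C + 2 * \<bar>X\<bar>) * (h * N) \<le> c0 / 16 * N\<^sup>2"
  proof -
    have "(C1 + 2 * lam * C + 2 * \<bar>X\<bar>) * (h * N) \<le> (C1 + 2 * lam * C + 2 * \<bar>X\<bar>) * (\<delta> * N * N)"
      using h N0 C10 C lam_ge by (intro mult_left_mono mult_right_mono) auto
    also have "\<dots> = (C1 + 2 * lam * C + 2 * \<bar>X\<bar>) * \<delta> * N\<^sup>2" by (simp add: power2_eq_square)
    also have "\<dots> \<le> c0 / 16 * N\<^sup>2" using \<delta>(3) by (intro mult_right_mono) auto
    finally show ?thesis .
  qed
  have F11: "m * smlog a 0 / 2 + wA \<le> c0 / 16 * N\<^sup>2"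
  proof -
    have "m * smlog a 0 / 2 \<le> N * smlog a 0" using s0 N0 mult_right_mono[OF m(2) s0] mult_nonneg_nonneg[of N "smlog a 0"] by linarith
    moreover have "N * (smlog a 0 + CL) \<le> N * (c0 / 16 * N)" using n(2) N0 by (intro mult_left_mono) (auto simp: CL_def N_def)
    ultimately show ?thesis using F6 by (simp add: power2_eq_square algebra_simps)
  qed
  have Ylb: "Y \<ge> N\<^sup>2 * X - c0 / 8 * N\<^sup>2"
  proof -
    have "Y \<ge> SA - C1 * (h * N) + (lam - 1) * (m * wA) - 2 * lam * C * (h * N)"
      unfolding Y_def using F1 F7 by linarith
    also have "SA - C1 * (h * N) + (lam - 1) * (m * wA) - 2 * lam * C * (h * N) \<ge>
       m\<^sup>2 * B / 2 + lam * (m * wA) - (m * smlog a 0 / 2 + wA) - C1 * (h * N) - 2 * lam * C * (h * N)"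
      using F4 by (simp add: algebra_simps)
    finally show ?thesis using F8 F9 F10 F11 by (simp add: distrib_right)
  qed
  have Y2: "(1 - \<kappa>) * Y \<ge> N\<^sup>2 * X - c0 / 8 * N\<^sup>2 - \<kappa> * \<bar>X\<bar> * N\<^sup>2"
  proof -
    have "(1 - \<kappa>) * Y \<ge> (1 - \<kappa>) * (N\<^sup>2 * X - c0 / 8 * N\<^sup>2)" using Ylb \<kappa> by (intro mult_left_mono) auto
    moreover have "\<kappa> * (N\<^sup>2 * X) \<le> \<kappa> * (N\<^sup>2 * \<bar>X\<bar>)" using \<kappa> by (intro mult_left_mono) auto
    moreover have "\<kappa> * (c0 / 8 * N\<^sup>2) \<ge> 0" using \<kappa> c0 by simp
    ultimately show ?thesis by (simp add: field_simps)
  qed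
  have K1: "\<kappa> * Sk \<ge> \<kappa> * S - \<kappa> * C1 * N\<^sup>2"
  proof -
    have "\<kappa> * Sk \<ge> \<kappa> * (S - C1 * N\<^sup>2 / 2)" using F2 \<kappa> by (intro mult_left_mono) auto
    moreover have "\<kappa> * (C1 * N\<^sup>2) \<ge> 0" using \<kappa> C10 by simp
    ultimately show ?thesis by (simp add: algebra_simps)
  qed
  have K2: "\<gamma> * w \<ge> \<gamma> * l - \<kappa> * (lam * C) * N\<^sup>2"
  proof -
    have "w \<ge> l - N * C" unfolding w_def l_def N_def by (rule sum_W_ge[OF C(2)])
    then have "\<gamma> * w \<ge> \<gamma> * (l - N * C)" using \<gamma> by (intro mult_left_mono) auto
    moreover have "\<gamma> * (N * C) \<le> (\<kappa> * lam * N) * (N * C)" using \<gamma> N0 C by (intro mult_right_mono) (auto simp: N_def)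
    ultimately show ?thesis by (simp add: power2_eq_square algebra_simps)
  qed
  have K3: "(\<kappa> * (\<bar>X\<bar> + C1 + lam * C)) * N\<^sup>2 \<le> c0 / 16 * N\<^sup>2" using \<kappa>(3) by (intro mult_right_mono) auto
  have "energy R al n x = Sk + ((1 - \<kappa>) * (lam - 1) * N + \<gamma>) * w"
    using energy_alt[OF n(1), of al x] al by (simp add: w_def Sk_def N_def)
  then have E: "energy R al n x = (1 - \<kappa>) * Y + \<kappa> * Sk + \<gamma> * w"
    unfolding Y_def by (simp add: algebra_simps)
  \<comment> \<open>Balance: starting from 3 c0 / 8, the errors are c0 / 16 for far particles
    (\<open>F10\<close>), c0 / 16 for diagonal and order n terms (\<open>F11\<close>), and c0 / 16
    for the share \<kappa> (\<open>K3\<close>).\<close>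
  have "energy R al n x \<ge> N\<^sup>2 * X - c0 / 8 * N\<^sup>2 - c0 / 16 * N\<^sup>2 + \<kappa> * S + \<gamma> * l"
    unfolding E using Y2 K1 K2 K3 by (simp add: algebra_simps)
  moreover have "N\<^sup>2 * X - c0 / 8 * N\<^sup>2 - c0 / 16 * N\<^sup>2 \<ge> N\<^sup>2 * (J + c0 / 16)"
    unfolding X using c0 by (simp add: algebra_simps)
  ultimately show ?thesis by (simp add: N_def S_def l_def)
qed

text \<open>The order of the choices matters: c0 comes from the separation, \<delta>, \<kappa> and a
  depend on c0, L on \<delta>, and n0 on everything. The bound on \<gamma> keeps the error of
  replacing \<open>W\<close> by \<open>llog\<close> in the reserved confinement below \<kappa> lam C
  n^2.\<close>

lemma energy_gap:
  assumes \<epsilon>: "\<epsilon> > 0"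
  obtains c \<kappa> n0 where "c > 0" "0 < \<kappa>" "\<kappa> \<le> 1/2"
    "\<And>n al \<gamma> x. \<lbrakk>n \<ge> n0; 0 \<le> \<gamma>; \<gamma> \<le> \<kappa> * lam * real n; al - real n + 1 = (1 - \<kappa>) * (lam - 1) * real n + \<gamma>;
       inj_on x {..<n}; dBL (empirical n x) \<nu> \<ge> \<epsilon>\<rbrakk> \<Longrightarrow>
       energy R al n x \<ge> (real n)\<^sup>2 * (J + c) + \<kappa> * pairmin n x + \<gamma> * (\<Sum>i<n. llog (x i))"
proof -
  obtain c0 where c0: "c0 > 0" and sep: 
    "\<And>n A x L a. \<lbrakk>n > 0; A \<subseteq> {..<n}; A \<noteq> {}; r \<le> L; \<And>i. i \<in> A \<Longrightarrow> cmod (x i) \<le> L;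
       real n - real (card A) \<le> \<epsilon> / 16 * real n; dBL (empirical n x) \<nu> \<ge> \<epsilon>; 0 < a; a \<le> 1\<rbrakk> \<Longrightarrow>
       dform (smlog a) (emp_on A x) \<nu> \<ge> c0"
    using near_separated[OF \<epsilon>] by metis
  obtain C where C: "C \<ge> 0" "\<And>x. \<bar>W x - llog x\<bar> \<le> C" using W_llog by blast
  define C1 where "C1 = 2 * C + ln 2"
  define X where "X = J + 3 * c0 / 8"
  have C10: "C1 \<ge> 0" using C by (simp add: C1_def)
  define C3 where "C3 = C1 + 2 * lam * C + 2 * \<bar>X\<bar> + 1"
  have C3: "C3 \<ge> 1" using C10 C lam_ge by (simp add: C3_def)
  define \<delta> where "\<delta> = min (1/2) (min (\<epsilon> / 16) (c0 / 16 / C3))"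
  have \<delta>: "0 < \<delta>" "\<delta> \<le> 1/2" "\<delta> \<le> \<epsilon> / 16" "\<delta> \<le> c0 / 16 / C3" using \<epsilon> c0 C3 by (auto simp: \<delta>_def)
  have \<delta>3: "(C1 + 2 * lam * C + 2 * \<bar>X\<bar>) * \<delta> \<le> c0 / 16"
  proof -
    have "C3 * \<delta> \<le> c0 / 16" using mult_left_mono[OF \<delta>(4), of C3] C3 by simp
    then show ?thesis using \<delta>(1) by (simp add: C3_def distrib_right)
  qed
  define \<kappa> where "\<kappa> = min (1/2) (c0 / 16 / C3)"
  have \<kappa>: "0 < \<kappa>" "\<kappa> \<le> 1/2" "\<kappa> \<le> c0 / 16 / C3" using c0 C3 by (auto simp: \<kappa>_def)
  have \<kappa>3: "\<kappa> * (\<bar>X\<bar> + C1 + lam * C) \<le> c0 / 16"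
  proof -
    have "\<kappa> * (\<bar>X\<bar> + C1 + lam * C) \<le> \<kappa> * C3"
      using \<kappa> C lam_ge by (intro mult_left_mono) (auto simp: C3_def)
    also have "\<dots> \<le> c0 / 16" using \<kappa>(3) C3 by (simp add: le_divide_eq)
    finally show ?thesis .
  qed
  define k where "k = 1 + 2 / r\<^sup>2"
  have k: "k \<ge> 1" by (simp add: k_def)
  define a where "a = (min 1 (c0 / 8 / k))\<^sup>2"
  have a0: "min 1 (c0 / 8 / k) > 0" using c0 k by simp
  have a: "0 < a" "a \<le> 1" "sqrt a * (1 + 2 / r\<^sup>2) \<le> c0 / 8"
  proof -
    show "0 < a" using a0 by (simp add: a_def)
    show "a \<le> 1" unfolding a_def using a0 by (intro power_le_one) auto
    have "sqrt a \<le> c0 / 8 / k" using a0 by (simp add: a_def)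
    then show "sqrt a * (1 + 2 / r\<^sup>2) \<le> c0 / 8" using k unfolding k_def[symmetric] by (simp add: le_divide_eq)
  qed
  define T where "T = J + c0 / 16"
  define L where "L = max 1 (max r (exp (8 * (\<bar>T\<bar> + 2 * C + ln 2 + 2 * lam * C) / \<delta>\<^sup>2)))"
  have L: "L \<ge> 1" "r \<le> L" by (auto simp: L_def)
  have L2: "ln L \<ge> 8 * (\<bar>T\<bar> + 2 * C + ln 2 + 2 * lam * C) / \<delta>\<^sup>2"
  proof -
    have "ln (exp (8 * (\<bar>T\<bar> + 2 * C + ln 2 + 2 * lam * C) / \<delta>\<^sup>2)) \<le> ln L"
      by (intro ln_mono) (auto simp: L_def)
    then show ?thesis by simp
  qed
  define n0 where "n0 = nat \<lceil>max 1 (max (2 / \<delta>) ((smlog a 0 + \<bar>C + ln (1 + L\<^sup>2) / 2\<bar>) / (c0 / 16)))\<rceil>"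
  show ?thesis
  proof (rule that[of "c0 / 16" \<kappa> n0])
    fix n al \<gamma> and x :: "nat \<Rightarrow> complex"
    assume n: "n \<ge> n0" and \<gamma>: "0 \<le> \<gamma>" "\<gamma> \<le> \<kappa> * lam * real n" and al: "al - real n + 1 = (1 - \<kappa>) * (lam - 1) * real n + \<gamma>"
      and inj: "inj_on x {..<n}" and d: "dBL (empirical n x) \<nu> \<ge> \<epsilon>"
    have "real n \<ge> max 1 (max (2 / \<delta>) ((smlog a 0 + \<bar>C + ln (1 + L\<^sup>2) / 2\<bar>) / (c0 / 16)))"
      using n unfolding n0_def by linarith
    then have n1: "real n \<ge> 1" and n2: "real n \<ge> 2 / \<delta>" and "real n \<ge> (smlog a 0 + \<bar>C + ln (1 + L\<^sup>2) / 2\<bar>) / (c0 / 16)"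
      by auto
    then have n3: "smlog a 0 + \<bar>C + ln (1 + L\<^sup>2) / 2\<bar> \<le> c0 / 16 * real n" using c0 by (simp add: field_simps)
    have n0: "n > 0" using n1 by simp
    show "energy R al n x \<ge> (real n)\<^sup>2 * (J + c0 / 16) + \<kappa> * pairmin n x + \<gamma> * (\<Sum>i<n. llog (x i))"
    proof (cases "real (card {i. i < n \<and> cmod (x i) > L}) \<ge> \<delta> * real n")
      case True
      from energy_far[OF C \<delta>(1) L(1) L2 \<kappa>(1,2) n2 n0 \<gamma> al this] show ?thesis by (simp add: T_def)
    next
      case False
      define A where "A = {i. i < n \<and> cmod (x i) \<le> L}"
      define F where "F = {i. i < n \<and> cmod (x i) > L}"
      have fin: "finite A" "finite F" by (auto simp: A_def F_def)
      have AF: "{..<n} = A \<union> F" "A \<inter> F = {}" by (auto simp: A_def F_def)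
      have "card {..<n} = card A + card F" unfolding AF(1) by (rule card_Un_disjoint) (use fin AF in auto)
      then have AFn: "real n = real (card A) + real (card F)" by simp
      have Fd: "real (card F) \<le> \<delta> * real n" using False by (simp add: F_def)
      moreover have "\<delta> * real n \<le> 1/2 * real n" "\<delta> * real n \<le> \<epsilon> / 16 * real n" using \<delta> by (intro mult_right_mono; simp)+
      ultimately have A1: "real (card A) > 0" "real n - real (card A) \<le> \<epsilon> / 16 * real n" using AFn n1 by linarith+
      have "dform (smlog a) (emp_on A x) \<nu> \<ge> c0"
      proof (intro sep[OF n0 _ _ L(2) _ A1(2) d a(1,2)])
        show "A \<noteq> {}" using A1(1) by auto
      qed (auto simp: A_def)
      then show ?thesis
        unfolding A_def using Fd F_def by (intro energy_near[OF C C1_def X_def c0 \<delta>(1,2) \<delta>3 L(2) a \<kappa>(1,2) \<kappa>3 n0 n3 \<gamma> al inj]) auto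
    qed
  qed (use c0 \<kappa> in auto)
qed

end

section \<open>Integrability at infinity\<close>

text \<open>The 2 compensates the growth of area and the excess q makes the tail converge; the
  primitive is a multiple of exp (- q llog). The general lower end u serves the induction over
  particles and the escaping particle in the lower bound of Z_n.\<close>

lemma nn_integral_llog_tail:
  assumes "q > 0" "u \<ge> 0"
  shows "(\<integral>\<^sup>+ x. ennreal (exp (- (2 + q) * llog x)) * indicator {x. u \<le> llog x} x \<partial>lborel) = ennreal (2 * pi / q * exp (- q * u))"
proof -
  define s0 where "s0 = sqrt (exp (2 * u) - 1)"
  have s0: "s0 \<ge> 0" "s0\<^sup>2 = exp (2 * u) - 1" using assms by (auto simp: s0_def)
  have iff: "u \<le> ln (1 + s\<^sup>2) / 2 \<longleftrightarrow> s \<in> {s0..}" if "s \<ge> 0" for s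
  proof -
    have "u \<le> ln (1 + s\<^sup>2) / 2 \<longleftrightarrow> 2 * u \<le> ln (1 + s\<^sup>2)" by auto
    also have "\<dots> \<longleftrightarrow> exp (2 * u) \<le> 1 + s\<^sup>2" by (rule ln_ge_iff) (auto intro: add_pos_nonneg)
    also have "\<dots> \<longleftrightarrow> s0\<^sup>2 \<le> s\<^sup>2" using s0 by auto
    also have "\<dots> \<longleftrightarrow> s0 \<le> s" using s0(1) that by (intro power_mono_iff) auto
    finally show ?thesis by simp
  qed
  have "(\<integral>\<^sup>+ x. ennreal (exp (- (2 + q) * llog x)) * indicator {x. u \<le> llog x} x \<partial>lborel) =
     (\<integral>\<^sup>+ x. (\<lambda>s. ennreal (exp (- (2 + q) * (ln (1 + s\<^sup>2) / 2))) * indicator {s. u \<le> ln (1 + s\<^sup>2) / 2} s) (cmod x) \<partial>lborel)"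
    by (simp add: llog_def indicator_def)
  also have "\<dots> = (\<integral>\<^sup>+ s. ennreal (2 * pi * s) * (ennreal (exp (- (2 + q) * (ln (1 + s\<^sup>2) / 2))) * indicator {s. u \<le> ln (1 + s\<^sup>2) / 2} s) * indicator {0..} s \<partial>lborel)"
    by (rule nn_integral_radial) measurable
  also have "\<dots> = (\<integral>\<^sup>+ s. ennreal (2 * pi * s * exp (- (2 + q) * (ln (1 + s\<^sup>2) / 2))) * indicator {s0..} s \<partial>lborel)"
  proof (intro nn_integral_cong)
    fix s :: real
    show "ennreal (2 * pi * s) * (ennreal (exp (- (2 + q) * (ln (1 + s\<^sup>2) / 2))) * indicator {s. u \<le> ln (1 + s\<^sup>2) / 2} s) * indicator {0..} s
       = ennreal (2 * pi * s * exp (- (2 + q) * (ln (1 + s\<^sup>2) / 2))) * indicator {s0..} s"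
    proof (cases "s \<ge> 0")
      case True
      then show ?thesis using iff[OF True]
        by (auto simp: indicator_def ennreal_mult'')
    next
      case False
      then show ?thesis using s0 by (auto simp: indicator_def)
    qed
  qed
  also have "\<dots> = 0 - (- 2 * pi / q * exp (- q * (ln (1 + s0\<^sup>2) / 2)))"
  proof (rule nn_integral_FTC_atLeast)
    fix s assume s: "s0 \<le> s"
    have p: "1 + s\<^sup>2 > 0" by (intro add_pos_nonneg) auto
    have "((\<lambda>s. - 2 * pi / q * exp (- q * (ln (1 + s\<^sup>2) / 2))) has_real_derivative
       - 2 * pi / q * (exp (- q * (ln (1 + s\<^sup>2) / 2)) * (- q * (2 * s / (1 + s\<^sup>2) / 2)))) (at s)"
      using p assms by (auto intro!: derivative_eq_intros simp: field_split_simps add_nonneg_eq_0_iff)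
    also have "- 2 * pi / q * (exp (- q * (ln (1 + s\<^sup>2) / 2)) * (- q * (2 * s / (1 + s\<^sup>2) / 2))) =
       2 * pi * s * (exp (- q * (ln (1 + s\<^sup>2) / 2)) / (1 + s\<^sup>2))"
    proof -
      have dd: "- 2 * pi / q * (E * (- q * (2 * s / D / 2))) = 2 * pi * s * (E / D)" if "D \<noteq> 0" for D E
        using assms that by (simp add: field_simps)
      show ?thesis by (rule dd) (use p in auto)
    qed
    also have "exp (- q * (ln (1 + s\<^sup>2) / 2)) / (1 + s\<^sup>2) = exp (- (2 + q) * (ln (1 + s\<^sup>2) / 2))"
    proof -
      have "exp (- (2 + q) * (ln (1 + s\<^sup>2) / 2)) = exp (- q * (ln (1 + s\<^sup>2) / 2) - ln (1 + s\<^sup>2))"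
        by (simp add: field_simps)
      also have "\<dots> = exp (- q * (ln (1 + s\<^sup>2) / 2)) / (1 + s\<^sup>2)"
        unfolding exp_diff using p by simp
      finally show ?thesis by simp
    qed
    finally show "((\<lambda>s. - 2 * pi / q * exp (- q * (ln (1 + s\<^sup>2) / 2))) has_real_derivative
       2 * pi * s * exp (- (2 + q) * (ln (1 + s\<^sup>2) / 2))) (at s)" .
  next
    show "((\<lambda>s. - 2 * pi / q * exp (- q * (ln (1 + s\<^sup>2) / 2))) \<longlongrightarrow> 0) at_top"
      using assms by real_asymp
  qed (use s0 in auto)
  also have "\<dots> = ennreal (2 * pi / q * exp (- q * u))"
    using s0 by simp
  finally show ?thesis .
qed

text \<open>The exponent that is left after the gap has been taken out; a is the margin over the
  critical exponent 2 of integrability in the plane. The index set I is arbitrary so that an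
  induction can remove any particle.\<close>

definition gasE :: "real \<Rightarrow> real \<Rightarrow> nat set \<Rightarrow> (nat \<Rightarrow> complex) \<Rightarrow> real" where
  "gasE a b I x = b * (\<Sum>(i,j)\<in>{(i,j). i \<in> I \<and> j \<in> I \<and> i < j}. min (llog (x i)) (llog (x j)))
     + (2 + a) * (\<Sum>i\<in>I. llog (x i))"

lemma gasE_measurable [measurable]:
  assumes "finite I" "I \<subseteq> I'"
  shows "gasE a b I \<in> borel_measurable (\<Pi>\<^sub>M i\<in>I'. lborel)"
proof -
  have [measurable]: "(\<lambda>x. llog (x i)) \<in> borel_measurable (\<Pi>\<^sub>M i\<in>I'. lborel)" if "i \<in> I" for i
    using that assms by (intro measurable_compose[OF measurable_component_singleton]) auto
  show ?thesis unfolding gasE_def[abs_def] case_prod_beta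
    by (intro borel_measurable_add borel_measurable_times borel_measurable_sum borel_measurable_min) auto
qed

lemma sum_pairs_insert:
  fixes h :: "nat \<Rightarrow> nat \<Rightarrow> real"
  assumes "finite I" "k \<notin> I" and sym: "\<And>i j. h i j = h j i"
  shows "(\<Sum>(i,j)\<in>{(i,j). i \<in> insert k I \<and> j \<in> insert k I \<and> i < j}. h i j) =
    (\<Sum>(i,j)\<in>{(i,j). i \<in> I \<and> j \<in> I \<and> i < j}. h i j) + (\<Sum>j\<in>I. h k j)"
proof -
  have "(\<Sum>i\<in>I. h i k) = (\<Sum>i\<in>I. h k i)" by (rule sum.cong) (auto simp: sym)
  moreover have "finite (insert k I)" using assms by simp
  ultimately show ?thesis
    unfolding sum_pairs_symmetric[OF \<open>finite (insert k I)\<close> sym] sum_pairs_symmetric[OF assms(1) sym]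
    using assms(1,2) by (simp add: sum.distrib field_simps)
qed

lemma gasE_insert:
  assumes "finite I" "k \<notin> I" "\<And>i. i \<in> I \<Longrightarrow> llog (x k) \<le> llog (x i)"
  shows "gasE a b (insert k I) x = gasE a b I x + (2 + a + b * real (card I)) * llog (x k)"
proof -
  have "(\<Sum>j\<in>I. min (llog (x k)) (llog (x j))) = real (card I) * llog (x k)"
    using assms(3) by simp
  then show ?thesis unfolding gasE_def
    using assms by (subst sum_pairs_insert) (auto simp: min.commute algebra_simps)
qed

text \<open>Splitting according to which particle is closest to the origin and integrating this particle
  last leads to the recursion \<open>C (k + 1) = C k / (a + b k / 2)\<close> for the constants.\<close>

lemma gas_integral_le:
  fixes I :: "nat set"
  assumes "finite I" and a: "a > 0" and b: "b \<ge> 0" and u: "u \<ge> 0"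
  shows "(\<integral>\<^sup>+ x. ennreal (exp (- gasE a b I x)) * indicator {x. \<forall>i\<in>I. u \<le> llog (x i)} x \<partial>(\<Pi>\<^sub>M i\<in>I. lborel))
    \<le> ennreal ((2 * pi) ^ card I * (\<Prod>j<card I. 1 / (a + b * real j / 2)) *
        exp (- (real (card I) * a + b * (real (card I) * (real (card I) - 1) / 2)) * u))"
  using assms(1) u
proof (induction "card I" arbitrary: I u)
  case 0
  then have "I = {}" by simp
  interpret product_sigma_finite "\<lambda>_::nat. lborel :: complex measure" ..
  show ?case unfolding \<open>I = {}\<close> by (simp add: PiM_empty nn_integral_count_space_finite gasE_def)
next
  case (Suc k)
  interpret product_sigma_finite "\<lambda>_::nat. lborel :: complex measure" ..
  define Ck where "Ck = (2 * pi) ^ k * (\<Prod>j<k. 1 / (a + b * real j / 2))"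
  have Ck: "Ck \<ge> 0" unfolding Ck_def using a b by (intro mult_nonneg_nonneg prod_nonneg) auto
  \<comment> \<open>The closest particle carries a + b k beyond 2 by itself, and the induction
    hypothesis with its \<open>llog\<close> as the lower end adds k a + b k (k - 1) / 2; the sum is
    q.\<close>
  define q where "q = real (Suc k) * a + b * (real (Suc k) * real k / 2)"
  have q: "q > 0" unfolding q_def using a b by (intro add_pos_nonneg) auto
  let ?f = "\<lambda>i x. ennreal (exp (- gasE a b I x)) * indicator {x. u \<le> llog (x i) \<and> (\<forall>j\<in>I. llog (x i) \<le> llog (x j))} x"
  have fm: "?f i \<in> borel_measurable (\<Pi>\<^sub>M i\<in>I. lborel)" if "i \<in> I" for i
  proof -
    let ?P = "\<Pi>\<^sub>M i\<in>I. lborel :: complex measure"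
    have mj: "(\<lambda>x. llog (x j)) \<in> borel_measurable ?P" if "j \<in> I" for j
      using that by (intro measurable_compose[OF measurable_component_singleton]) auto
    have [measurable]: "gasE a b I \<in> borel_measurable ?P"
      by (rule gasE_measurable[OF Suc.prems(1) order_refl])
    have "{x \<in> space ?P. u \<le> llog (x i)} \<inter> (\<Inter>j\<in>I. {x \<in> space ?P. llog (x i) \<le> llog (x j)}) \<in> sets ?P"
      using that Suc.prems(1) mj by (intro sets.Int sets.finite_INT borel_measurable_le) auto
    also have "{x \<in> space ?P. u \<le> llog (x i)} \<inter> (\<Inter>j\<in>I. {x \<in> space ?P. llog (x i) \<le> llog (x j)}) =
        {x \<in> space ?P. u \<le> llog (x i) \<and> (\<forall>j\<in>I. llog (x i) \<le> llog (x j))}" using that by auto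
    finally have mk: "{x \<in> space ?P. u \<le> llog (x i) \<and> (\<forall>j\<in>I. llog (x i) \<le> llog (x j))} \<in> sets ?P" .
    have "(\<lambda>x. if u \<le> llog (x i) \<and> (\<forall>j\<in>I. llog (x i) \<le> llog (x j)) then ennreal (exp (- gasE a b I x)) else 0)
        \<in> borel_measurable (\<Pi>\<^sub>M i\<in>I. lborel)"
      by (rule measurable_If[OF _ _ mk]) measurable
    also have "(\<lambda>x. if u \<le> llog (x i) \<and> (\<forall>j\<in>I. llog (x i) \<le> llog (x j)) then ennreal (exp (- gasE a b I x)) else 0) = ?f i"
      by (auto simp: indicator_def)
    finally show ?thesis .
  qed
  have Ine: "I \<noteq> {}" using Suc by auto
  \<comment> \<open>Some particle attains the smallest \<open>llog\<close>. Ties are counted more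
    than once, hence only an inequality.\<close>
  have "(\<integral>\<^sup>+ x. ennreal (exp (- gasE a b I x)) * indicator {x. \<forall>i\<in>I. u \<le> llog (x i)} x \<partial>(\<Pi>\<^sub>M i\<in>I. lborel))
     \<le> (\<integral>\<^sup>+ x. (\<Sum>i\<in>I. ?f i x) \<partial>(\<Pi>\<^sub>M i\<in>I. lborel))"
  proof (intro nn_integral_mono)
    fix x :: "nat \<Rightarrow> complex"
    show "ennreal (exp (- gasE a b I x)) * indicator {x. \<forall>i\<in>I. u \<le> llog (x i)} x \<le> (\<Sum>i\<in>I. ?f i x)"
    proof (cases "\<forall>i\<in>I. u \<le> llog (x i)")
      case True
      obtain i where i: "i \<in> I" "\<forall>j\<in>I. llog (x i) \<le> llog (x j)"
        using Suc.prems(1) Ine arg_min_if_finite[of I "\<lambda>i. llog (x i)"] by (metis not_less)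
      have "?f i x \<le> (\<Sum>i\<in>I. ?f i x)" using i Suc.prems(1) by (intro member_le_sum) auto
      then show ?thesis using True i by simp
    qed simp
  qed
  also have "\<dots> = (\<Sum>i\<in>I. (\<integral>\<^sup>+ x. ?f i x \<partial>(\<Pi>\<^sub>M i\<in>I. lborel)))"
    by (rule nn_integral_sum[OF fm])
  also have "\<dots> \<le> (\<Sum>i\<in>I. ennreal (Ck * (2 * pi / q * exp (- q * u))))"
  proof (rule sum_mono)
    fix i assume i: "i \<in> I"
    define I' where "I' = I - {i}"
    have I': "finite I'" "i \<notin> I'" "I = insert i I'" "card I' = k"
      using i Suc by (auto simp: I'_def)
    have "(\<integral>\<^sup>+ x. ?f i x \<partial>(\<Pi>\<^sub>M i\<in>I. lborel)) = (\<integral>\<^sup>+ y. (\<integral>\<^sup>+ x. ?f i (x(i := y)) \<partial>(\<Pi>\<^sub>M i\<in>I'. lborel)) \<partial>lborel)"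
      using fm[OF i] unfolding I'(3) by (rule product_nn_integral_insert_rev[OF I'(1,2)])
    also have "\<dots> \<le> (\<integral>\<^sup>+ y. ennreal Ck * (ennreal (exp (- (2 + q) * llog y)) * indicator {y. u \<le> llog y} y) \<partial>lborel)"
    proof (intro nn_integral_mono)
      fix y :: complex
      show "(\<integral>\<^sup>+ x. ?f i (x(i := y)) \<partial>(\<Pi>\<^sub>M i\<in>I'. lborel)) \<le> ennreal Ck * (ennreal (exp (- (2 + q) * llog y)) * indicator {y. u \<le> llog y} y)"
      proof (cases "u \<le> llog y")
        case True
        define e where "e = exp (- (2 + a + b * real k) * llog y)"
        have upd: "gasE a b I' (x(i := y)) = gasE a b I' x" for x
          unfolding gasE_def using I' by (intro arg_cong2[where f="(+)"] arg_cong2[where f="(*)"] sum.cong) auto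
        have all: "(\<forall>j\<in>I. llog ((x(i := y)) i) \<le> llog ((x(i := y)) j)) \<longleftrightarrow> (\<forall>j\<in>I'. llog y \<le> llog (x j))" for x
          using I' by auto
        have "(\<integral>\<^sup>+ x. ?f i (x(i := y)) \<partial>(\<Pi>\<^sub>M i\<in>I'. lborel)) =
          (\<integral>\<^sup>+ x. ennreal e * (ennreal (exp (- gasE a b I' x)) * indicator {x. \<forall>j\<in>I'. llog y \<le> llog (x j)} x) \<partial>(\<Pi>\<^sub>M i\<in>I'. lborel))"
        proof (intro nn_integral_cong)
          fix x :: "nat \<Rightarrow> complex"
          show "?f i (x(i := y)) = ennreal e * (ennreal (exp (- gasE a b I' x)) * indicator {x. \<forall>j\<in>I'. llog y \<le> llog (x j)} x)"
          proof (cases "\<forall>j\<in>I'. llog y \<le> llog (x j)")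
            case t: True
            have "gasE a b I (x(i := y)) = gasE a b I' x + (2 + a + b * real k) * llog y"
              unfolding I'(3) using I' t by (subst gasE_insert) (auto simp: upd)
            then have "exp (- gasE a b I (x(i := y))) = e * exp (- gasE a b I' x)"
              by (simp add: e_def exp_add[symmetric] algebra_simps)
            then show ?thesis using t True all[of x] by (simp add: ennreal_mult e_def)
          next
            case False
            then have "\<not> (\<forall>j\<in>I. llog ((x(i := y)) i) \<le> llog ((x(i := y)) j))" using all[of x] by simp
            then show ?thesis using False by (auto simp: indicator_def simp del: fun_upd_apply)
          qed
        qed
        also have "\<dots> = ennreal e * (\<integral>\<^sup>+ x. ennreal (exp (- gasE a b I' x)) * indicator {x. \<forall>j\<in>I'. llog y \<le> llog (x j)} x \<partial>(\<Pi>\<^sub>M i\<in>I'. lborel))"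
        proof (rule nn_integral_cmult)
          have "Measurable.pred (\<Pi>\<^sub>M i\<in>I'. lborel) (\<lambda>x. \<forall>j\<in>I'. llog y \<le> llog (x j))" using I'(1) by measurable
          then show "(\<lambda>x. ennreal (exp (- gasE a b I' x)) * indicator {x. \<forall>j\<in>I'. llog y \<le> llog (x j)} x) \<in> borel_measurable (\<Pi>\<^sub>M i\<in>I'. lborel)"
            using gasE_measurable[OF I'(1) order_refl] by measurable
        qed
        also have "\<dots> \<le> ennreal e * ennreal (Ck * exp (- (real k * a + b * (real k * (real k - 1) / 2)) * llog y))"
          using Suc.hyps(1)[of I' "llog y"] I' llog_nonneg[of y] unfolding Ck_def by (intro mult_left_mono) (auto simp: mult.assoc)
        also have "\<dots> = ennreal (Ck * exp (- (2 + q) * llog y))"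
        proof -
          have "e * exp (- (real k * a + b * (real k * (real k - 1) / 2)) * llog y) = exp (- (2 + q) * llog y)"
            unfolding e_def q_def exp_add[symmetric] by (rule arg_cong[where f=exp]) (simp add: field_simps)
          then show ?thesis by (simp add: ennreal_mult'[symmetric] e_def mult.left_commute)
        qed
        finally show ?thesis using True Ck by (simp add: ennreal_mult)
      qed simp
    qed
    also have "\<dots> = ennreal Ck * ennreal (2 * pi / q * exp (- q * u))"
      using nn_integral_llog_tail[OF q Suc.prems(2)] by (subst nn_integral_cmult) auto
    also have "\<dots> = ennreal (Ck * (2 * pi / q * exp (- q * u)))"
      by (rule ennreal_mult'[OF Ck, symmetric])
    finally show "(\<integral>\<^sup>+ x. ?f i x \<partial>(\<Pi>\<^sub>M i\<in>I. lborel)) \<le> ennreal (Ck * (2 * pi / q * exp (- q * u)))" .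
  qed
  also have "\<dots> = ennreal (real (Suc k) * (Ck * (2 * pi / q * exp (- q * u))))"
    unfolding sum_constant Suc(2)[symmetric] ennreal_of_nat_eq_real_of_nat by (rule ennreal_mult'[symmetric]) simp
  also have "real (Suc k) * (Ck * (2 * pi / q * exp (- q * u))) =
    (2 * pi) ^ Suc k * (\<Prod>j<Suc k. 1 / (a + b * real j / 2)) * exp (- q * u)"
  proof -
    \<comment> \<open>The number \<open>Suc k\<close> of candidates for the closest particle cancels
      against q and leaves one new factor of the product.\<close>
    have "q = real (Suc k) * (a + b * real k / 2)" by (simp add: q_def field_simps)
    then have q': "real (Suc k) * (1 / q) = 1 / (a + b * real k / 2)" by simp
    have "real (Suc k) * (Ck * (2 * pi / q * exp (- q * u))) = Ck * (2 * pi) * (real (Suc k) * (1 / q)) * exp (- q * u)"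
      by (simp only: divide_inverse mult_ac mult_1_left mult_1_right)
    then show ?thesis unfolding q' Ck_def by (simp only: power_Suc prod.lessThan_Suc mult_ac)
  qed
  finally show ?case unfolding Suc(2)[symmetric] q_def by simp
qed

section \<open>The partition function\<close>

text \<open>Since \<open>ln 0 = 0\<close>, coinciding particles have finite energy and have to be excluded by hand.\<close>

lemma AE_lebC_inj: "AE x in lebC n. inj_on x {..<n}"
proof -
  interpret product_sigma_finite "\<lambda>_::nat. lborel :: complex measure" ..
  have "AE x in lebC n. x i \<noteq> x j" if ij: "i < n" "j < n" "i \<noteq> j" for i j
  proof -
    define I where "I = {..<n} - {i}"
    have I: "finite I" "i \<notin> I" "{..<n} = insert i I" "j \<in> I" using ij by (auto simp: I_def)
    have m: "(\<lambda>x. x k) \<in> borel_measurable (lebC n)" if "k < n" for k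
      using measurable_component_singleton[of k "{..<n}" "\<lambda>_. lborel :: complex measure"] that by (simp add: lebC_def)
    have S: "{x \<in> space (lebC n). x i = x j} \<in> sets (lebC n)"
    proof -
      have "(\<lambda>x. x i - x j) -` {0} \<inter> space (lebC n) \<in> sets (lebC n)"
        using m[OF ij(1)] m[OF ij(2)] by (intro measurable_sets[of _ _ borel] borel_measurable_diff) auto
      also have "(\<lambda>x. x i - x j) -` {0} \<inter> space (lebC n) = {x \<in> space (lebC n). x i = x j}" by auto
      finally show ?thesis .
    qed
    have "emeasure (lebC n) {x \<in> space (lebC n). x i = x j} = (\<integral>\<^sup>+ x. indicator {x \<in> space (lebC n). x i = x j} x \<partial>lebC n)"
      using S by simp
    \<comment> \<open>With all other coordinates fixed, the coincidence set is at most one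
      point.\<close>
    also have "\<dots> = (\<integral>\<^sup>+ x. (\<integral>\<^sup>+ y. indicator {x \<in> space (lebC n). x i = x j} (x(i := y)) \<partial>lborel) \<partial>(\<Pi>\<^sub>M i\<in>I. lborel))"
      using S unfolding lebC_def I(3) by (intro product_nn_integral_insert[OF I(1,2)]) auto
    also have "\<dots> \<le> (\<integral>\<^sup>+ x. (\<integral>\<^sup>+ y. indicator {x j} y \<partial>lborel) \<partial>(\<Pi>\<^sub>M i\<in>I. lborel :: complex measure))"
      using ij by (intro nn_integral_mono) (auto simp: indicator_def)
    also have "\<dots> = 0" by simp
    finally have "{x \<in> space (lebC n). x i = x j} \<in> null_sets (lebC n)" using S by (auto simp: null_sets_def)
    then show ?thesis by (rule AE_I') auto
  qed
  then have "AE x in lebC n. \<forall>i\<in>{..<n}. \<forall>j\<in>{..<n}. i \<noteq> j \<longrightarrow> x i \<noteq> x j"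
    by (intro AE_finite_allI AE_impI) auto
  then show ?thesis by eventually_elim (auto simp: inj_on_def)
qed

text \<open>For Jensen's bound, where f is an exponential that may have infinite integral.\<close>

lemma ennreal_integral_le_nn_integral:
  fixes f g :: "'a \<Rightarrow> real"
  assumes "integrable M g" "\<And>x. x \<in> space M \<Longrightarrow> g x \<le> f x" "\<And>x. 0 \<le> f x" and f: "f \<in> borel_measurable M"
  shows "ennreal (\<integral>x. g x \<partial>M) \<le> (\<integral>\<^sup>+ x. ennreal (f x) \<partial>M)"
proof (cases "integrable M f")
  case True
  then have "(\<integral>\<^sup>+ x. ennreal (f x) \<partial>M) = ennreal (\<integral>x. f x \<partial>M)"
    using assms(3) by (intro nn_integral_eq_integral) auto
  moreover have "(\<integral>x. g x \<partial>M) \<le> (\<integral>x. f x \<partial>M)" using assms True by (intro integral_mono) auto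
  ultimately show ?thesis by (simp add: ennreal_leI)
next
  case False
  then have "\<not> (\<integral>\<^sup>+ x. ennreal (f x) \<partial>M) < \<infinity>"
    using assms(3) integrableI_nonneg[OF f] by auto
  then have "(\<integral>\<^sup>+ x. ennreal (f x) \<partial>M) = \<infinity>" by (simp add: not_less top_unique)
  then show ?thesis by simp
qed

lemma distr_PiM_pair:
  assumes M: "prob_space M" and ij: "i \<in> I" "j \<in> I" "i \<noteq> j"
  shows "distr (\<Pi>\<^sub>M i\<in>I. M) (M \<Otimes>\<^sub>M M) (\<lambda>\<omega>. (\<omega> i, \<omega> j)) = M \<Otimes>\<^sub>M M"
proof -
  interpret prob_space M by fact
  interpret product_prob_space "\<lambda>_. M" I ..
  show ?thesis
  proof (rule pair_measure_eqI[symmetric])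
    fix A B assume AB: "A \<in> sets M" "B \<in> sets M"
    define X where "X k = (if k = i then A else B)" for k
    have "emeasure (distr (\<Pi>\<^sub>M i\<in>I. M) (M \<Otimes>\<^sub>M M) (\<lambda>\<omega>. (\<omega> i, \<omega> j))) (A \<times> B) =
      emeasure (\<Pi>\<^sub>M i\<in>I. M) {\<omega> \<in> space (\<Pi>\<^sub>M i\<in>I. M). \<forall>k\<in>{i, j}. \<omega> k \<in> X k}"
      using AB ij by (subst emeasure_distr) (auto intro!: arg_cong2[where f=emeasure] simp: X_def)
    also have "\<dots> = (\<Prod>k\<in>{i, j}. emeasure M (X k))"
      using AB ij by (intro emeasure_PiM_Collect) (auto simp: X_def)
    finally show "emeasure M A * emeasure M B = emeasure (distr (\<Pi>\<^sub>M i\<in>I. M) (M \<Otimes>\<^sub>M M) (\<lambda>\<omega>. (\<omega> i, \<omega> j))) (A \<times> B)"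
      using ij by (simp add: X_def)
  qed (auto intro: prob_space_imp_sigma_finite[OF M])
qed

section \<open>Lower bound of the partition function\<close>

context jellium
begin

abbreviation "wbar \<equiv> \<integral>x. W x \<partial>\<nu>"

lemma integrable_W: "integrable \<nu> W"
  unfolding W_def[abs_def] using bounded_pot_integrable[OF \<nu>.bprob_axioms AE_\<nu> R_pos] by simp

lemma log_energy_pair:
  "integrable (\<nu> \<Otimes>\<^sub>M \<nu>) (\<lambda>p. ln (cmod (fst p - snd p)))"
  "(\<integral>p. ln (cmod (fst p - snd p)) \<partial>(\<nu> \<Otimes>\<^sub>M \<nu>)) = - I\<nu>"
proof -
  interpret NN: bprob_pair \<nu> \<nu> ..
  have i1: "integrable \<nu> (\<lambda>y. ln (cmod (x - y)))" for x
    unfolding \<nu>_def by (rule integrable_ln_cmod_unif[OF r_pos])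
  note i2 = integrable_inverse_cmod
  define c where "c = 1 + 2 / r\<^sup>2"
  have i2': "(\<integral>y. 1 / cmod (x - y) \<partial>\<nu>) \<le> c" for x
    unfolding c_def by (rule integral_inverse_cmod_le)
  have int: "integrable (\<nu> \<Otimes>\<^sub>M \<nu>) (\<lambda>p. ln (cmod (fst p - snd p)))"
  proof (rule NN.P.Fubini_integrable)
    have "AE x in \<nu>. norm (\<integral>y. \<bar>ln (cmod (x - y))\<bar> \<partial>\<nu>) \<le> 2 * r + c"
      using AE_\<nu>
    proof eventually_elim
      fix x assume x: "cmod x \<le> r"
      have "(\<integral>y. \<bar>ln (cmod (x - y))\<bar> \<partial>\<nu>) \<le> (\<integral>y. 2 * r + 1 / cmod (x - y) \<partial>\<nu>)"
      proof (intro integral_mono_AE)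
        show "AE y in \<nu>. \<bar>ln (cmod (x - y))\<bar> \<le> 2 * r + 1 / cmod (x - y)"
          using AE_\<nu>
        proof eventually_elim
          fix y assume "cmod y \<le> r"
          then show "\<bar>ln (cmod (x - y))\<bar> \<le> 2 * r + 1 / cmod (x - y)"
            using abs_ln_le[of "cmod (x - y)"] norm_triangle_ineq4[of x y] norm_ge_zero[of "x - y"] x by linarith
        qed
      qed (use i1 i2 in auto)
      also have "\<dots> \<le> 2 * r + c" using i2 i2'[of x] \<nu>.prob_space by simp
      finally show "norm (\<integral>y. \<bar>ln (cmod (x - y))\<bar> \<partial>\<nu>) \<le> 2 * r + c" by simp
    qed
    then show "integrable \<nu> (\<lambda>x. \<integral>y. norm (ln (cmod (fst (x, y) - snd (x, y)))) \<partial>\<nu>)"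
      by (intro \<nu>.integrable_const_bound[where B="2 * r + c"]) auto
    show "AE x in \<nu>. integrable \<nu> (\<lambda>y. ln (cmod (fst (x, y) - snd (x, y))))" using i1 by simp
  qed measurable
  then show "integrable (\<nu> \<Otimes>\<^sub>M \<nu>) (\<lambda>p. ln (cmod (fst p - snd p)))" .
  show "(\<integral>p. ln (cmod (fst p - snd p)) \<partial>(\<nu> \<Otimes>\<^sub>M \<nu>)) = - I\<nu>"
    using NN.P.integral_fst'[OF int] by (simp add: I\<nu>_def log_pot_def \<nu>_def)
qed

abbreviation "\<nu>P m \<equiv> \<Pi>\<^sub>M i\<in>{..<m::nat}. \<nu>"

text \<open>In \<open>energy\<close> the factors n and 1 / n cancel. Written without them, the
  strength \<alpha> stays fixed while the number m of particles changes by one.\<close>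

definition nearE :: "real \<Rightarrow> nat \<Rightarrow> (nat \<Rightarrow> complex) \<Rightarrow> real" where
  "nearE al m x = (\<Sum>(i,j)\<in>{(i,j). i < j \<and> j < m}. - ln (cmod (x i - x j))) + al * (\<Sum>i<m. W (x i))"

lemma nearE_integral:
  "integrable (\<nu>P m) (nearE al m)"
  "(\<integral>x. nearE al m x \<partial>\<nu>P m) = real m * (real m - 1) / 2 * I\<nu> + al * real m * wbar"
proof -
  interpret product_prob_space "\<lambda>_::nat. \<nu>" "{..<m}" ..
  have c: "integrable (\<nu>P m) (\<lambda>x. W (x i)) \<and> (\<integral>x. W (x i) \<partial>\<nu>P m) = wbar" if "i < m" for i
  proof -
    have d: "distr (\<nu>P m) \<nu> (\<lambda>x. x i) = \<nu>" using that by (intro distr_PiM_component) (auto intro: \<nu>.prob_space_axioms)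
    have [measurable]: "(\<lambda>x. x i) \<in> measurable (\<nu>P m) \<nu>" using that by (intro measurable_component_singleton) auto
    have W: "W \<in> borel_measurable \<nu>" by measurable
    show ?thesis
      using integrable_distr_eq[OF _ W, of "\<lambda>x. x i" "\<nu>P m"] integral_distr[OF _ W, of "\<lambda>x. x i" "\<nu>P m"] integrable_W
      unfolding d by simp
  qed
  have p: "integrable (\<nu>P m) (\<lambda>x. - ln (cmod (x i - x j))) \<and> (\<integral>x. - ln (cmod (x i - x j)) \<partial>\<nu>P m) = I\<nu>" if "i < j" "j < m" for i j
  proof -
    have d: "distr (\<nu>P m) (\<nu> \<Otimes>\<^sub>M \<nu>) (\<lambda>x. (x i, x j)) = \<nu> \<Otimes>\<^sub>M \<nu>"
      using that by (intro distr_PiM_pair) (auto intro: \<nu>.prob_space_axioms)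
    have mm: "(\<lambda>x. (x i, x j)) \<in> measurable (\<nu>P m) (\<nu> \<Otimes>\<^sub>M \<nu>)"
      using that by (intro measurable_Pair measurable_component_singleton) auto
    have f: "(\<lambda>p. ln (cmod (fst p - snd p))) \<in> borel_measurable (\<nu> \<Otimes>\<^sub>M \<nu>)" by measurable
    show ?thesis
      using integrable_distr_eq[OF mm f] integral_distr[OF mm f] log_energy_pair
      unfolding d by simp
  qed
  show "integrable (\<nu>P m) (nearE al m)"
    unfolding nearE_def[abs_def] case_prod_beta
    using c p by (intro Bochner_Integration.integrable_add Bochner_Integration.integrable_sum integrable_mult_right) auto
  have "(\<integral>x. nearE al m x \<partial>\<nu>P m) = (\<Sum>(i,j)\<in>{(i,j). i < j \<and> j < m}. \<integral>x. - ln (cmod (x i - x j)) \<partial>\<nu>P m) + al * (\<Sum>i<m. \<integral>x. W (x i) \<partial>\<nu>P m)"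
    unfolding nearE_def case_prod_beta
    using c p by (subst Bochner_Integration.integral_add)
      (auto intro!: Bochner_Integration.integrable_sum integrable_mult_right simp: Bochner_Integration.integral_sum simp del: Bochner_Integration.integral_minus)
  also have "\<dots> = real (card {(i,j). i < j \<and> j < m}) * I\<nu> + al * real m * wbar"
    using c p by (simp add: case_prod_beta)
  finally show "(\<integral>x. nearE al m x \<partial>\<nu>P m) = real m * (real m - 1) / 2 * I\<nu> + al * real m * wbar"
    by (simp add: card_pairs)
qed

lemma \<nu>P_density: "\<nu>P m = density (\<Pi>\<^sub>M i\<in>{..<m}. lborel) (\<lambda>x. \<Prod>i<m. ennreal (indicator (cball 0 r) (x i) / (pi * r\<^sup>2)))"
proof -
  interpret L: product_sigma_finite "\<lambda>_::nat. lborel :: complex measure" ..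
  interpret N: product_prob_space "\<lambda>_::nat. \<nu>" "{..<m}" ..
  let ?g = "\<lambda>y. ennreal (indicator (cball (0::complex) r) y / (pi * r\<^sup>2))"
  have gm: "(\<lambda>x. \<Prod>i<m. ?g (x i)) \<in> borel_measurable (\<Pi>\<^sub>M i\<in>{..<m}. lborel)"
  proof (rule borel_measurable_prod_ennreal)
    fix i assume "i \<in> {..<m}"
    then show "(\<lambda>x. ?g (x i)) \<in> borel_measurable (\<Pi>\<^sub>M i\<in>{..<m}. lborel)"
      by (intro measurable_compose[OF measurable_component_singleton[of i]]) auto
  qed
  show ?thesis
  proof (rule N.PiM_eqI[symmetric])
    show "sets (density (\<Pi>\<^sub>M i\<in>{..<m}. lborel) (\<lambda>x. \<Prod>i<m. ?g (x i))) = sets (\<nu>P m)"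
      by (auto intro!: sets_PiM_cong)
    fix A assume "\<And>i. i \<in> {..<m} \<Longrightarrow> A i \<in> sets \<nu>"
    then have A: "A i \<in> sets borel" if "i < m" for i using that by auto
    have PA: "Pi\<^sub>E {..<m} A \<in> sets (\<Pi>\<^sub>M i\<in>{..<m}. lborel)" using A by (intro sets_PiM_I_finite) auto
    have "emeasure (density (\<Pi>\<^sub>M i\<in>{..<m}. lborel) (\<lambda>x. \<Prod>i<m. ?g (x i))) (Pi\<^sub>E {..<m} A)
      = (\<integral>\<^sup>+ x. (\<Prod>i<m. ?g (x i)) * indicator (Pi\<^sub>E {..<m} A) x \<partial>(\<Pi>\<^sub>M i\<in>{..<m}. lborel))"
      by (rule emeasure_density[OF gm PA])
    also have "\<dots> = (\<integral>\<^sup>+ x. (\<Prod>i<m. ?g (x i) * indicator (A i) (x i)) \<partial>(\<Pi>\<^sub>M i\<in>{..<m}. lborel))"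
    proof (intro nn_integral_cong)
      fix x :: "nat \<Rightarrow> complex" assume "x \<in> space (\<Pi>\<^sub>M i\<in>{..<m}. lborel)"
      then have "indicator (Pi\<^sub>E {..<m} A) x = (\<Prod>i<m. indicator (A i) (x i) :: ennreal)"
        by (auto simp: indicator_def space_PiM PiE_iff prod_zero_iff intro!: prod.neutral[symmetric])
      then show "(\<Prod>i<m. ?g (x i)) * indicator (Pi\<^sub>E {..<m} A) x = (\<Prod>i<m. ?g (x i) * indicator (A i) (x i))"
        by (simp add: prod.distrib)
    qed
    also have "\<dots> = (\<Prod>i<m. (\<integral>\<^sup>+ y. ?g y * indicator (A i) y \<partial>lborel))"
      using A by (intro L.product_nn_integral_prod) auto
    also have "\<dots> = (\<Prod>i<m. emeasure \<nu> (A i))"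
      unfolding \<nu>_def unif_disc_density[OF r_pos] using A by (intro prod.cong) (auto simp: emeasure_density)
    finally show "emeasure (density (\<Pi>\<^sub>M i\<in>{..<m}. lborel) (\<lambda>x. \<Prod>i<m. ?g (x i))) (Pi\<^sub>E {..<m} A) = (\<Prod>i<m. emeasure \<nu> (A i))" .
  qed simp
qed

lemma nearE_measurable: "nearE al m \<in> borel_measurable (\<Pi>\<^sub>M i\<in>{..<m}. lborel)"
proof -
  have "sets (\<nu>P m) = sets (\<Pi>\<^sub>M i\<in>{..<m}. lborel :: complex measure)" by (intro sets_PiM_cong) auto
  moreover have "nearE al m \<in> borel_measurable (\<nu>P m)" using nearE_integral(1) by auto
  ultimately show ?thesis using measurable_cong_sets by blast
qed

lemma near_exp_measurable:
  "(\<lambda>x. ennreal (exp (- b * nearE al m x)) * indicator {x. \<forall>i<m. cmod (x i) \<le> r} x) \<in> borel_measurable (\<Pi>\<^sub>M i\<in>{..<m}. lborel)"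
proof -
  let ?L = "\<Pi>\<^sub>M i\<in>{..<m}. lborel :: complex measure"
  have mj: "(\<lambda>x. cmod (x j)) \<in> borel_measurable ?L" if "j < m" for j
    using that by (intro measurable_compose[OF measurable_component_singleton]) auto
  have "{x \<in> space ?L. cmod (x j) \<le> r} \<in> sets ?L" if "j < m" for j
    using mj[OF that] by (intro borel_measurable_le) auto
  then have "{x \<in> space ?L. \<forall>j\<in>{..<m}. cmod (x j) \<le> r} \<in> sets ?L"
    by (intro sets.sets_Collect_finite_All) auto
  then have S: "{x \<in> space ?L. \<forall>i<m. cmod (x i) \<le> r} \<in> sets ?L" by simp
  have "(\<lambda>x. if \<forall>i<m. cmod (x i) \<le> r then ennreal (exp (- b * nearE al m x)) else 0) \<in> borel_measurable ?L"
    by (rule measurable_If[OF _ _ S]) (use nearE_measurable in auto)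
  also have "(\<lambda>x. if \<forall>i<m. cmod (x i) \<le> r then ennreal (exp (- b * nearE al m x)) else 0) =
     (\<lambda>x. ennreal (exp (- b * nearE al m x)) * indicator {x. \<forall>i<m. cmod (x i) \<le> r} x)"
    by (auto simp: indicator_def)
  finally show ?thesis .
qed

text \<open>Jensen's inequality, in the form of the tangent line bound for \<open>exp\<close>, which does not require
  the exponential to be integrable.\<close>

lemma nearE_exp_lower:
  assumes "b > 0"
  shows "(\<integral>\<^sup>+ x. ennreal (exp (- b * nearE al m x)) * indicator {x. \<forall>i<m. cmod (x i) \<le> r} x \<partial>(\<Pi>\<^sub>M i\<in>{..<m}. lborel))
    \<ge> ennreal ((pi * r\<^sup>2) ^ m * exp (- b * (real m * (real m - 1) / 2 * I\<nu> + al * real m * wbar)))"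
proof -
  interpret P: prob_space "\<nu>P m" by (intro prob_space_PiM \<nu>.prob_space_axioms)
  define e where "e = real m * (real m - 1) / 2 * I\<nu> + al * real m * wbar"
  note i = nearE_integral[of m al, folded e_def]
  have nm: "nearE al m \<in> borel_measurable (\<nu>P m)" using i(1) by auto
  note nm' = nearE_measurable[of al m]
  \<comment> \<open>The tangent is taken at the mean \<open>e\<close> of the energy, so the linear
    term integrates to 0.\<close>
  have "ennreal (exp (- b * e)) = ennreal (\<integral>x. exp (- b * e) * (1 - b * (nearE al m x - e)) \<partial>\<nu>P m)"
    using i P.prob_space by simp
  also have "\<dots> \<le> (\<integral>\<^sup>+ x. ennreal (exp (- b * nearE al m x)) \<partial>\<nu>P m)"
  proof (rule ennreal_integral_le_nn_integral)
    show "integrable (\<nu>P m) (\<lambda>x. exp (- b * e) * (1 - b * (nearE al m x - e)))" using i by simp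
    fix x
    have "1 + - b * (nearE al m x - e) \<le> exp (- b * (nearE al m x - e))" by (rule exp_ge_add_one_self)
    then have "exp (- b * e) * (1 - b * (nearE al m x - e)) \<le> exp (- b * e) * exp (- b * (nearE al m x - e))"
      by (intro mult_left_mono) auto
    also have "\<dots> = exp (- b * nearE al m x)" by (simp flip: exp_add add: algebra_simps)
    finally show "exp (- b * e) * (1 - b * (nearE al m x - e)) \<le> exp (- b * nearE al m x)" .
  qed (use nm in auto)
  also have "\<dots> = (\<integral>\<^sup>+ x. (\<Prod>i<m. ennreal (indicator (cball 0 r) (x i) / (pi * r\<^sup>2))) * ennreal (exp (- b * nearE al m x)) \<partial>(\<Pi>\<^sub>M i\<in>{..<m}. lborel))"
    unfolding \<nu>P_density
  proof (rule nn_integral_density)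
    have g: "(\<lambda>y. ennreal (indicator (cball 0 r) y / (pi * r\<^sup>2))) \<in> borel_measurable (lborel :: complex measure)"
      by measurable
    show "(\<lambda>x::nat \<Rightarrow> complex. \<Prod>i<m. ennreal (indicator (cball 0 r) (x i) / (pi * r\<^sup>2))) \<in> borel_measurable (\<Pi>\<^sub>M i\<in>{..<m}. lborel)"
    proof (rule borel_measurable_prod_ennreal)
      fix i assume i: "i \<in> {..<m}"
      show "(\<lambda>x::nat \<Rightarrow> complex. ennreal (indicator (cball 0 r) (x i) / (pi * r\<^sup>2))) \<in> borel_measurable (\<Pi>\<^sub>M i\<in>{..<m}. lborel)"
        by (rule measurable_compose[OF _ g]) (use i in \<open>intro measurable_component_singleton\<close>)
    qed
    show "(\<lambda>x. ennreal (exp (- b * nearE al m x))) \<in> borel_measurable (\<Pi>\<^sub>M i\<in>{..<m}. lborel)"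
      using nm' by simp
  qed
  also have "\<dots> \<le> (\<integral>\<^sup>+ x. ennreal ((1 / (pi * r\<^sup>2)) ^ m) * (ennreal (exp (- b * nearE al m x)) * indicator {x. \<forall>i<m. cmod (x i) \<le> r} x) \<partial>(\<Pi>\<^sub>M i\<in>{..<m}. lborel))"
  proof (intro nn_integral_mono)
    fix x :: "nat \<Rightarrow> complex"
    show "(\<Prod>i<m. ennreal (indicator (cball 0 r) (x i) / (pi * r\<^sup>2))) * ennreal (exp (- b * nearE al m x)) \<le>
      ennreal ((1 / (pi * r\<^sup>2)) ^ m) * (ennreal (exp (- b * nearE al m x)) * indicator {x. \<forall>i<m. cmod (x i) \<le> r} x)"
    proof (cases "\<forall>i<m. cmod (x i) \<le> r")
      case True
      have "(\<Prod>i<m. ennreal (indicator (cball 0 r) (x i) / (pi * r\<^sup>2))) = (\<Prod>i<m. ennreal (1 / (pi * r\<^sup>2)))"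
        using True by (intro prod.cong) auto
      also have "\<dots> = ennreal ((1 / (pi * r\<^sup>2)) ^ m)"
        unfolding prod_constant by (subst ennreal_power) auto
      finally have "(\<Prod>i<m. ennreal (indicator (cball 0 r) (x i) / (pi * r\<^sup>2))) = ennreal ((1 / (pi * r\<^sup>2)) ^ m)" .
      moreover have "indicator {x. \<forall>i<m. cmod (x i) \<le> r} x = (1::ennreal)" using True by auto
      ultimately show ?thesis by (simp only: mult_1_right order_refl)
    next
      case False
      then obtain i where "i < m" "\<not> cmod (x i) \<le> r" by auto
      then have "(\<Prod>i<m. ennreal (indicator (cball 0 r) (x i) / (pi * r\<^sup>2))) = 0"
        by (intro prod_zero bexI[of _ i]) auto
      then show ?thesis by (simp only: mult_zero_left zero_le)
    qed
  qed
  also have "\<dots> = ennreal ((1 / (pi * r\<^sup>2)) ^ m) * (\<integral>\<^sup>+ x. ennreal (exp (- b * nearE al m x)) * indicator {x. \<forall>i<m. cmod (x i) \<le> r} x \<partial>(\<Pi>\<^sub>M i\<in>{..<m}. lborel))"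
    by (rule nn_integral_cmult[OF near_exp_measurable])
  finally have low: "ennreal (exp (- b * e)) \<le> ennreal ((1 / (pi * r\<^sup>2)) ^ m) * (\<integral>\<^sup>+ x. ennreal (exp (- b * nearE al m x)) * indicator {x. \<forall>i<m. cmod (x i) \<le> r} x \<partial>(\<Pi>\<^sub>M i\<in>{..<m}. lborel))" .
  have p0: "(pi * r\<^sup>2) ^ m \<ge> 0" by simp
  from mult_left_mono[OF low, of "ennreal ((pi * r\<^sup>2) ^ m)", OF zero_le]
  have "ennreal ((pi * r\<^sup>2) ^ m * exp (- b * e)) \<le> ennreal ((pi * r\<^sup>2) ^ m * (1 / (pi * r\<^sup>2)) ^ m) * (\<integral>\<^sup>+ x. ennreal (exp (- b * nearE al m x)) * indicator {x. \<forall>i<m. cmod (x i) \<le> r} x \<partial>(\<Pi>\<^sub>M i\<in>{..<m}. lborel))"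
    by (simp only: ennreal_mult'[OF p0] mult.assoc)
  moreover have p1: "(pi * r\<^sup>2) ^ m * (1 / (pi * r\<^sup>2)) ^ m = 1"
    unfolding power_mult_distrib[symmetric] using r_pos by simp
  ultimately have "ennreal ((pi * r\<^sup>2) ^ m * exp (- b * e)) \<le> (\<integral>\<^sup>+ x. ennreal (exp (- b * nearE al m x)) * indicator {x. \<forall>i<m. cmod (x i) \<le> r} x \<partial>(\<Pi>\<^sub>M i\<in>{..<m}. lborel))"
    by (simp only: p1 ennreal_1 mult_1_left)
  then show ?thesis unfolding e_def .
qed


lemma energy_nearE: "n > 0 \<Longrightarrow> energy R al n x = nearE al n x"
  unfolding energy_def nearE_def by (simp add: ext_pot_def W_def sum_distrib_left sum_negf)

lemma energy_measurable: "n > 0 \<Longrightarrow> energy R al n \<in> borel_measurable (lebC n)"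
  using nearE_measurable[of al n] energy_nearE[of n al] unfolding lebC_def by (simp cong: measurable_cong)

lemma nearE_Suc: "nearE al (Suc m) (x(m := y)) = nearE al m x + (\<Sum>i<m. - ln (cmod (x i - y))) + al * W y"
proof -
  have eq: "{(i,j). i < j \<and> j < Suc m} = {(i,j). i < j \<and> j < m} \<union> (\<lambda>i. (i, m)) ` {..<m}" by (auto simp: less_Suc_eq)
  have "(\<Sum>(i,j)\<in>{(i,j). i < j \<and> j < Suc m}. - ln (cmod ((x(m := y)) i - (x(m := y)) j))) =
     (\<Sum>(i,j)\<in>{(i,j). i < j \<and> j < m}. - ln (cmod ((x(m := y)) i - (x(m := y)) j)))
     + (\<Sum>(i,j)\<in>(\<lambda>i. (i, m)) ` {..<m}. - ln (cmod ((x(m := y)) i - (x(m := y)) j)))"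
    unfolding eq by (rule sum.union_disjoint) (auto intro: finite_pairs)
  also have "(\<Sum>(i,j)\<in>{(i,j). i < j \<and> j < m}. - ln (cmod ((x(m := y)) i - (x(m := y)) j)))
      = (\<Sum>(i,j)\<in>{(i,j). i < j \<and> j < m}. - ln (cmod (x i - x j)))"
    by (intro sum.cong) auto
  also have "(\<Sum>(i,j)\<in>(\<lambda>i. (i, m)) ` {..<m}. - ln (cmod ((x(m := y)) i - (x(m := y)) j))) = (\<Sum>i<m. - ln (cmod (x i - y)))"
    by (subst sum.reindex) (auto simp: inj_on_def intro!: sum.cong)
  finally show ?thesis unfolding nearE_def by (simp add: algebra_simps)
qed

text \<open>All particles but one are put into the support of the equilibrium measure. The last one is
  placed far away: in the critical case it may escape, and it contributes the factor \<open>1 / \<eta>\<close>.\<close>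

lemma part_fun_ge:
  obtains K u0 where "K \<ge> 0" "u0 \<ge> 0"
    "\<And>m al b \<eta>. \<lbrakk>al > 0; b > 0; \<eta> > 0; b * (al - real m) = 2 + \<eta>\<rbrakk> \<Longrightarrow>
      ennreal ((pi * r\<^sup>2) ^ m * exp (- b * (real m * (real m - 1) / 2 * I\<nu> + al * real m * wbar)) *
        (exp (- b * K * (real m + al)) * (2 * pi / \<eta> * exp (- \<eta> * u0)))) \<le> part_fun R al b (Suc m)"
proof -
  obtain C where C: "C \<ge> 0" "\<And>x. \<bar>W x - llog x\<bar> \<le> C" using W_llog by blast
  define K where "K = 2 * ln 2 + C"
  \<comment> \<open>The value 2 r ensures |z - y| \<ge> |y| / 2 for z in the disc, and 1 ensures 1 +
    |y|^2 \<le> (2 |y|)^2.\<close>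
  define L where "L = max 1 (2 * r)"
  have L: "L \<ge> 1" "L \<ge> 2 * r" by (auto simp: L_def)
  define u0 where "u0 = ln (1 + L\<^sup>2) / 2"
  have far: "cmod y \<ge> L" if "u0 \<le> llog y" for y
  proof -
    have "ln (1 + L\<^sup>2) \<le> ln (1 + (cmod y)\<^sup>2)" using that by (simp add: u0_def llog_def)
    then have "L\<^sup>2 \<le> (cmod y)\<^sup>2" by (subst (asm) ln_le_cancel_iff) (auto intro: add_pos_nonneg)
    then show ?thesis by (rule power2_le_imp_le) simp
  qed
  have far2: "- ln (cmod (z - y)) \<le> 2 * ln 2 - llog y" if "cmod z \<le> r" "cmod y \<ge> L" for z y
  proof -
    have y: "cmod y \<ge> 1" "cmod y / 2 \<ge> r" using that L by auto
    have "1 + (cmod y)\<^sup>2 \<le> (2 * cmod y)\<^sup>2" using one_le_power[OF y(1), of 2] by (simp add: power_mult_distrib)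
    then have "ln (1 + (cmod y)\<^sup>2) \<le> ln ((2 * cmod y)\<^sup>2)" by (intro ln_mono) (auto intro: add_pos_nonneg)
    also have "\<dots> = 2 * ln (2 * cmod y)" using ln_realpow[of "2 * cmod y" 2] y by simp
    finally have "llog y \<le> ln (2 * cmod y)" by (simp add: llog_def)
    also have "2 * cmod y = (2 * 2) * (cmod y / 2)" by simp
    also have "ln \<dots> = 2 * ln 2 + ln (cmod y / 2)" using y by (subst ln_mult_pos) (auto simp: ln_mult_pos[of 2 2, simplified])
    also have "ln (cmod y / 2) \<le> ln (cmod (z - y))"
    proof (rule ln_mono)
      show "cmod y / 2 \<le> cmod (z - y)" using norm_triangle_ineq2[of y z] that y by (simp add: norm_minus_commute)
    qed (use y in auto)
    finally show ?thesis by simp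
  qed
  show ?thesis
  proof (rule that[of K u0])
    show "K \<ge> 0" using C by (simp add: K_def)
    show "u0 \<ge> 0" by (simp add: u0_def)
    fix m al b \<eta> assume al: "al > (0::real)" and b: "b > (0::real)" and \<eta>: "\<eta> > (0::real)" and bal: "b * (al - real m) = 2 + \<eta>"
    interpret product_sigma_finite "\<lambda>_::nat. lborel :: complex measure" ..
    define f where "f = (\<lambda>x. ennreal (exp (- b * nearE al m x)) * indicator {x. \<forall>i<m. cmod (x i) \<le> r} x)"
    have fm: "f \<in> borel_measurable (\<Pi>\<^sub>M i\<in>{..<m}. lborel)" unfolding f_def by (rule near_exp_measurable)
    define c where "c = exp (- b * K * (real m + al))"
    define g where "g = (\<lambda>y. ennreal c * (ennreal (exp (- (2 + \<eta>) * llog y)) * indicator {y. u0 \<le> llog y} y))"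
    have gm: "g \<in> borel_measurable lborel" unfolding g_def by measurable
    have gi: "(\<integral>\<^sup>+ y. g y \<partial>lborel) = ennreal (c * (2 * pi / \<eta> * exp (- \<eta> * u0)))"
    proof -
      have "(\<integral>\<^sup>+ y. g y \<partial>lborel) = ennreal c * ennreal (2 * pi / \<eta> * exp (- \<eta> * u0))"
        unfolding g_def using nn_integral_llog_tail[OF \<eta>, of u0] by (subst nn_integral_cmult) (auto simp: u0_def)
      then show ?thesis by (simp add: ennreal_mult'[symmetric] c_def)
    qed
    have pw: "f x * g y \<le> ennreal (exp (- b * nearE al (Suc m) (x(m := y))))" for x y
    proof (cases "(\<forall>i<m. cmod (x i) \<le> r) \<and> u0 \<le> llog y")
      case True
      have "nearE al (Suc m) (x(m := y)) \<le> nearE al m x + (\<Sum>i<m. 2 * ln 2 - llog y) + al * (llog y + C)"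
        unfolding nearE_Suc using True far[of y] al C(2)[of y]
        by (intro add_mono sum_mono far2 mult_left_mono order_refl) (auto simp: abs_le_iff)
      \<comment> \<open>Seen from afar, the m particles in the disc cancel m units of the
        confinement; for n = m + 1 the remaining \<open>al - real m\<close> is \<alpha> - n +
        1.\<close>
      also have "\<dots> = nearE al m x + (al - real m) * llog y + (2 * ln 2 * real m + C * al)"
        by (simp add: algebra_simps)
      also have "\<dots> \<le> nearE al m x + (al - real m) * llog y + K * (real m + al)"
        using C al ln_gt_zero[of "2::real"] by (simp add: K_def algebra_simps)
      finally have "b * nearE al (Suc m) (x(m := y)) \<le> b * (nearE al m x + (al - real m) * llog y + K * (real m + al))"
        using b by (intro mult_left_mono) auto
      also have "\<dots> = b * nearE al m x + (2 + \<eta>) * llog y + b * K * (real m + al)"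
        unfolding bal[symmetric] by (simp add: algebra_simps)
      finally have "exp (- (b * nearE al m x + (2 + \<eta>) * llog y + b * K * (real m + al))) \<le> exp (- b * nearE al (Suc m) (x(m := y)))"
        by simp
      moreover have "exp (- (b * nearE al m x + (2 + \<eta>) * llog y + b * K * (real m + al))) =
         exp (- b * nearE al m x) * (c * exp (- (2 + \<eta>) * llog y))"
        unfolding c_def exp_add[symmetric] by (simp add: algebra_simps)
      ultimately have "ennreal (exp (- b * nearE al m x) * (c * exp (- (2 + \<eta>) * llog y))) \<le> ennreal (exp (- b * nearE al (Suc m) (x(m := y))))"
        by (metis ennreal_leI)
      moreover have "f x = ennreal (exp (- b * nearE al m x))" "g y = ennreal (c * exp (- (2 + \<eta>) * llog y))"
        using True by (auto simp: f_def g_def ennreal_mult' c_def)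
      ultimately show ?thesis by (simp add: ennreal_mult'[symmetric])
    next
      case False
      then have "f x * g y = 0" by (auto simp: f_def g_def indicator_def)
      then show ?thesis by (simp only: zero_le)
    qed
    have "ennreal ((pi * r\<^sup>2) ^ m * exp (- b * (real m * (real m - 1) / 2 * I\<nu> + al * real m * wbar)) *
        (c * (2 * pi / \<eta> * exp (- \<eta> * u0)))) =
        ennreal ((pi * r\<^sup>2) ^ m * exp (- b * (real m * (real m - 1) / 2 * I\<nu> + al * real m * wbar))) * ennreal (c * (2 * pi / \<eta> * exp (- \<eta> * u0)))"
      by (rule ennreal_mult') simp
    also have "\<dots> \<le> (\<integral>\<^sup>+ x. f x \<partial>(\<Pi>\<^sub>M i\<in>{..<m}. lborel)) * (\<integral>\<^sup>+ y. g y \<partial>lborel)"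
      unfolding gi f_def by (intro mult_right_mono nearE_exp_lower[OF b]) simp
    also have "\<dots> = (\<integral>\<^sup>+ x. f x * (\<integral>\<^sup>+ y. g y \<partial>lborel) \<partial>(\<Pi>\<^sub>M i\<in>{..<m}. lborel))"
      by (rule nn_integral_multc[OF fm, symmetric])
    also have "\<dots> = (\<integral>\<^sup>+ x. (\<integral>\<^sup>+ y. f x * g y \<partial>lborel) \<partial>(\<Pi>\<^sub>M i\<in>{..<m}. lborel))"
      by (intro nn_integral_cong nn_integral_cmult[OF gm, symmetric])
    also have "\<dots> \<le> (\<integral>\<^sup>+ x. (\<integral>\<^sup>+ y. ennreal (exp (- b * nearE al (Suc m) (x(m := y)))) \<partial>lborel) \<partial>(\<Pi>\<^sub>M i\<in>{..<m}. lborel))"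
      by (intro nn_integral_mono pw)
    also have "\<dots> = (\<integral>\<^sup>+ x. ennreal (exp (- b * nearE al (Suc m) x)) \<partial>(\<Pi>\<^sub>M i\<in>insert m {..<m}. lborel))"
    proof (rule product_nn_integral_insert[symmetric])
      have "nearE al (Suc m) \<in> borel_measurable (\<Pi>\<^sub>M i\<in>insert m {..<m}. lborel)"
        using nearE_measurable[of al "Suc m"] by (simp add: lessThan_Suc)
      then show "(\<lambda>x. ennreal (exp (- b * nearE al (Suc m) x))) \<in> borel_measurable (\<Pi>\<^sub>M i\<in>insert m {..<m}. lborel)" by simp
    qed auto
    also have "\<dots> = part_fun R al b (Suc m)"
      unfolding part_fun_def lebC_def using energy_nearE[of "Suc m" al] by (simp add: lessThan_Suc)
    finally show "ennreal ((pi * r\<^sup>2) ^ m * exp (- b * (real m * (real m - 1) / 2 * I\<nu> + al * real m * wbar)) *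
        (exp (- b * K * (real m + al)) * (2 * pi / \<eta> * exp (- \<eta> * u0)))) \<le> part_fun R al b (Suc m)"
      unfolding c_def .
  qed
qed

section \<open>Upper bounds of Gibbs weights\<close>

text \<open>Used twice: with the bad configurations, where T contains the gap, and with the whole
  space, where it gives Z_n < infinity.\<close>

lemma energy_weight_le:
  assumes b: "b > 0" and \<kappa>: "\<kappa> \<ge> 0" and a: "a > 0" and \<gamma>: "b * \<gamma> = 2 + a"
    and B: "\<And>x. x \<in> B \<Longrightarrow> energy R al n x \<ge> T + \<kappa> * pairmin n x + \<gamma> * (\<Sum>i<n. llog (x i))"
  shows "(\<integral>\<^sup>+ x. ennreal (exp (- b * energy R al n x)) * indicator B x \<partial>lebC n)
    \<le> ennreal (exp (- b * T) * ((2 * pi) ^ n * (\<Prod>j<n. 1 / (a + b * \<kappa> * real j / 2))))"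
proof -
  have gm: "gasE a (b * \<kappa>) {..<n} \<in> borel_measurable (lebC n)"
    unfolding lebC_def by (rule gasE_measurable) auto
  have "(\<integral>\<^sup>+ x. ennreal (exp (- b * energy R al n x)) * indicator B x \<partial>lebC n)
     \<le> (\<integral>\<^sup>+ x. ennreal (exp (- b * T)) * ennreal (exp (- gasE a (b * \<kappa>) {..<n} x)) \<partial>lebC n)"
  proof (intro nn_integral_mono)
    fix x
    show "ennreal (exp (- b * energy R al n x)) * indicator B x \<le> ennreal (exp (- b * T)) * ennreal (exp (- gasE a (b * \<kappa>) {..<n} x))"
    proof (cases "x \<in> B")
      case True
      have "b * energy R al n x \<ge> b * (T + \<kappa> * pairmin n x + \<gamma> * (\<Sum>i<n. llog (x i)))"
        using B[OF True] b by (intro mult_left_mono) auto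
      also have "b * (T + \<kappa> * pairmin n x + \<gamma> * (\<Sum>i<n. llog (x i))) = b * T + gasE a (b * \<kappa>) {..<n} x"
        unfolding gasE_def \<gamma>[symmetric] pairmin_def pairs_lessThan by (simp add: algebra_simps)
      finally have "exp (- b * energy R al n x) \<le> exp (- b * T) * exp (- gasE a (b * \<kappa>) {..<n} x)"
        by (simp flip: exp_add)
      then show ?thesis using True by (simp add: ennreal_mult'[symmetric] ennreal_leI)
    qed simp
  qed
  also have "\<dots> = ennreal (exp (- b * T)) * (\<integral>\<^sup>+ x. ennreal (exp (- gasE a (b * \<kappa>) {..<n} x)) \<partial>lebC n)"
    using gm by (intro nn_integral_cmult) auto
  also have "\<dots> \<le> ennreal (exp (- b * T)) * ennreal ((2 * pi) ^ n * (\<Prod>j<n. 1 / (a + b * \<kappa> * real j / 2)))"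
    using gas_integral_le[of "{..<n}" a "b * \<kappa>" 0] a b \<kappa> llog_nonneg by (intro mult_left_mono) (simp_all add: lebC_def)
  also have "\<dots> = ennreal (exp (- b * T) * ((2 * pi) ^ n * (\<Prod>j<n. 1 / (a + b * \<kappa> * real j / 2))))"
    by (rule ennreal_mult'[symmetric]) simp
  finally show ?thesis .
qed

lemma part_fun_finite:
  assumes b: "b > 0" and n: "n > 0" and \<gamma>: "b * (al - real n + 1) > 2"
  shows "part_fun R al b n < \<infinity>"
proof -
  obtain C where C: "C \<ge> 0" "\<And>x. \<bar>W x - llog x\<bar> \<le> C" using W_llog by blast
  define g where "g = al - real n + 1"
  have g: "g \<ge> 0" using \<gamma> b unfolding g_def[symmetric] by (smt (verit) mult_nonneg_nonpos)
  define T where "T = - ((2 * C + ln 2) * (real n)\<^sup>2 / 2) - g * (real n * C)"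
  \<comment> \<open>No gap is wanted here, so all of the pair repulsion is kept, which is \<kappa> =
    1.\<close>
  have "energy R al n x \<ge> T + 1 * pairmin n x + g * (\<Sum>i<n. llog (x i))" for x
  proof -
    have "g * (\<Sum>i<n. W (x i)) \<ge> g * ((\<Sum>i<n. llog (x i)) - real n * C)"
      using sum_W_ge[OF C(2)] g by (intro mult_left_mono) auto
    then show ?thesis
      using sum_pairE_ge[OF C, where x=x and n=n] unfolding energy_alt[OF n] g_def[symmetric] T_def by (simp add: right_diff_distrib)
  qed
  then have "(\<integral>\<^sup>+ x. ennreal (exp (- b * energy R al n x)) * indicator UNIV x \<partial>lebC n)
    \<le> ennreal (exp (- b * T) * ((2 * pi) ^ n * (\<Prod>j<n. 1 / (b * g - 2 + b * 1 * real j / 2))))"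
    using b \<gamma> by (intro energy_weight_le[where \<gamma>=g]) (auto simp: g_def)
  then show ?thesis unfolding part_fun_def by (auto intro: le_less_trans)
qed

end

text \<open>Only the factor j = 0 sees the margin a, and it is kept exactly. The others are at most
  (2 / c)^m / m! \<le> (2 e / (c m))^m, which is at most 1 once c m is large; with c a multiple of
  \<beta> this uses n \<beta> -> infinity.\<close>

lemma gas_constant_le:
  assumes a: "a > 0" and c: "c * real m \<ge> 2 * exp 1" "c > 0"
  shows "(\<Prod>j<Suc m. 1 / (a + c * real j / 2)) \<le> 1 / a"
proof -
  have m: "m > 0" using c by (cases m) auto
  let ?P = "\<Prod>j<m. 1 / (a + c * real (Suc j) / 2)"
  have "?P \<le> (\<Prod>j<m. 2 / c * (1 / real (Suc j)))"
  proof (rule prod_mono)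
    fix j
    have "1 / (a + c * real (Suc j) / 2) \<le> 1 / (c * real (Suc j) / 2)"
      using a c by (intro divide_left_mono mult_pos_pos add_pos_pos) auto
    then show "0 \<le> 1 / (a + c * real (Suc j) / 2) \<and> 1 / (a + c * real (Suc j) / 2) \<le> 2 / c * (1 / real (Suc j))"
      using a c by (auto intro!: divide_nonneg_pos add_pos_nonneg)
  qed
  also have "\<dots> = (2 / c) ^ m / fact m"
    by (simp add: prod.distrib fact_prod_Suc prod_dividef lessThan_atLeast0 power_divide del: of_nat_Suc)
  also have "\<dots> = (2 / (c * real m)) ^ m * (real m ^ m / fact m)"
    using m by (simp add: power_divide power_mult_distrib)
  also have "\<dots> \<le> (2 / (c * real m)) ^ m * exp (real m)"
  proof (rule mult_left_mono)
    have "(\<Sum>i\<in>{m}. inverse (fact i) * real m ^ i) \<le> exp (real m)"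
      unfolding exp_def using summable_exp[of "real m"] by (intro sum_le_suminf[THEN order_trans]) (auto simp: divide_inverse mult.commute scaleR_conv_of_real)
    then show "real m ^ m / fact m \<le> exp (real m)" by (simp add: divide_inverse mult.commute)
  qed (use c in simp)
  also have "\<dots> = (2 * exp 1 / (c * real m)) ^ m"
    by (simp add: power_divide power_mult_distrib exp_of_nat_mult[symmetric])
  also have "\<dots> \<le> 1" using c m by (intro power_le_one) auto
  finally have "?P \<le> 1" .
  moreover have "(\<Prod>j<Suc m. 1 / (a + c * real j / 2)) = 1 / a * ?P"
    by (subst prod.lessThan_Suc_shift) simp
  ultimately show ?thesis using a by (simp add: divide_right_mono)
qed

section \<open>Almost sure convergence\<close>

locale jellium_seq = jellium +
  fixes \<alpha> \<beta> :: "nat \<Rightarrow> real"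
  assumes \<alpha>_pos: "\<And>n. \<alpha> n > 0" and \<beta>_pos: "\<And>n. \<beta> n > 0"
    and n\<beta>: "filterlim (\<lambda>n. real n * \<beta> n) at_top sequentially"
    and \<alpha>_lim: "(\<lambda>n. \<alpha> n / real n) \<longlonglongrightarrow> lam"
    and crit: "lam = 1 \<Longrightarrow> eventually (\<lambda>n. \<alpha> n - real n > 2 / \<beta> n - 1) sequentially"
begin

definition \<gamma> :: "nat \<Rightarrow> real" where "\<gamma> n = \<alpha> n - real n + 1"

text \<open>The confinement reserved for integrability after the energy gap has taken its share; it
  equals \<open>\<gamma> n\<close> when lam = 1.\<close>

definition \<gamma>2 :: "real \<Rightarrow> nat \<Rightarrow> real" where "\<gamma>2 \<kappa> n = \<gamma> n - (1 - \<kappa>) * (lam - 1) * real n"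

lemma inverse_n: "(\<lambda>n. 1 / real n) \<longlonglongrightarrow> 0"
  using lim_inverse_n by (simp add: inverse_eq_divide)

lemma \<gamma>_lim: "(\<lambda>n. \<gamma> n / real n) \<longlonglongrightarrow> lam - 1"
proof -
  have "(\<lambda>n. \<alpha> n / real n - 1 + 1 / real n) \<longlonglongrightarrow> lam - 1 + 0"
    by (intro tendsto_intros \<alpha>_lim inverse_n)
  moreover have "\<forall>\<^sub>F n in sequentially. \<alpha> n / real n - 1 + 1 / real n = \<gamma> n / real n"
    using eventually_gt_at_top[of 0] by eventually_elim (simp add: \<gamma>_def field_simps)
  ultimately show ?thesis by (simp add: tendsto_cong)
qed

text \<open>For lam = 1 both margins coincide and 2 / \<kappa> \<ge> 1. For lam > 1 the reserved
  part is about \<kappa> (lam - 1) n, twice \<kappa> / 2 times the whole, and the surplus multiplied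
  by \<beta> tends to infinity.\<close>

lemma rates:
  assumes \<kappa>: "0 < \<kappa>" "\<kappa> \<le> 1/2"
  shows "\<forall>\<^sub>F n in sequentially. \<beta> n * \<gamma>2 \<kappa> n > 2 \<and> \<beta> n * \<gamma> n - 2 \<le> 2 / \<kappa> * (\<beta> n * \<gamma>2 \<kappa> n - 2) \<and> \<gamma>2 \<kappa> n \<le> \<kappa> * lam * real n"
proof -
  have "(\<lambda>n. \<gamma> n / real n - (1 - \<kappa>) * (lam - 1)) \<longlonglongrightarrow> (lam - 1) - (1 - \<kappa>) * (lam - 1)"
    by (intro tendsto_intros \<gamma>_lim)
  moreover have "(lam - 1) - (1 - \<kappa>) * (lam - 1) < \<kappa> * lam" using \<kappa> by (simp add: algebra_simps)
  ultimately have "\<forall>\<^sub>F n in sequentially. \<gamma> n / real n - (1 - \<kappa>) * (lam - 1) < \<kappa> * lam"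
    by (rule order_tendstoD(2))
  then have 3: "\<forall>\<^sub>F n in sequentially. \<gamma>2 \<kappa> n \<le> \<kappa> * lam * real n"
    using eventually_gt_at_top[of 0]
  proof eventually_elim
    fix n :: nat assume n: "n > 0" "\<gamma> n / real n - (1 - \<kappa>) * (lam - 1) < \<kappa> * lam"
    then have "(\<gamma> n / real n - (1 - \<kappa>) * (lam - 1)) * real n \<le> \<kappa> * lam * real n" by (intro mult_right_mono) auto
    then show "\<gamma>2 \<kappa> n \<le> \<kappa> * lam * real n" using n by (simp add: \<gamma>2_def left_diff_distrib)
  qed
  show ?thesis
  proof (cases "lam = 1")
    case True
    have "\<forall>\<^sub>F n in sequentially. \<beta> n * \<gamma> n > 2"
      using crit[OF True]
    proof eventually_elim
      fix n assume "\<alpha> n - real n > 2 / \<beta> n - 1"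
      then have "2 / \<beta> n < \<gamma> n" by (simp add: \<gamma>_def)
      then show "\<beta> n * \<gamma> n > 2" using \<beta>_pos[of n] by (simp add: divide_less_eq mult.commute)
    qed
    then show ?thesis using 3
    proof eventually_elim
      fix n assume g: "\<beta> n * \<gamma> n > 2" and 3: "\<gamma>2 \<kappa> n \<le> \<kappa> * lam * real n"
      have eq: "\<gamma>2 \<kappa> n = \<gamma> n" by (subst \<gamma>2_def) (simp add: True)
      have "1 * (\<beta> n * \<gamma> n - 2) \<le> 2 / \<kappa> * (\<beta> n * \<gamma> n - 2)"
        using \<kappa> g by (intro mult_right_mono) (auto simp: le_divide_eq)
      then show "\<beta> n * \<gamma>2 \<kappa> n > 2 \<and> \<beta> n * \<gamma> n - 2 \<le> 2 / \<kappa> * (\<beta> n * \<gamma>2 \<kappa> n - 2) \<and> \<gamma>2 \<kappa> n \<le> \<kappa> * lam * real n"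
        using g 3 unfolding eq by simp
    qed
  next
    case False
    then have l: "lam - 1 > 0" using lam_ge by simp
    \<comment> \<open>Half the limit of (\<gamma>2 - \<kappa> / 2 \<gamma>) / n. The threshold 3 / d
      then gives a surplus of at least 3, which exceeds the critical 2 strictly.\<close>
    define d where "d = (lam - 1) * \<kappa> / 4"
    have d: "d > 0" using l \<kappa> by (simp add: d_def)
    have "(\<lambda>n. (1 - \<kappa> / 2) * (\<gamma> n / real n) - (1 - \<kappa>) * (lam - 1)) \<longlonglongrightarrow> (1 - \<kappa> / 2) * (lam - 1) - (1 - \<kappa>) * (lam - 1)"
      by (intro tendsto_intros \<gamma>_lim)
    moreover have "(1 - \<kappa> / 2) * (lam - 1) - (1 - \<kappa>) * (lam - 1) > d"
    proof -
      have "(1 - \<kappa> / 2) * (lam - 1) - (1 - \<kappa>) * (lam - 1) = 2 * d" by (simp add: d_def field_simps)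
      then show ?thesis using d by simp
    qed
    ultimately have a: "\<forall>\<^sub>F n in sequentially. (1 - \<kappa> / 2) * (\<gamma> n / real n) - (1 - \<kappa>) * (lam - 1) > d"
      by (rule order_tendstoD(1))
    have b: "\<forall>\<^sub>F n in sequentially. \<gamma> n / real n > 0" using \<gamma>_lim l by (rule order_tendstoD(1))
    have c: "\<forall>\<^sub>F n in sequentially. real n * \<beta> n \<ge> 3 / d" using n\<beta> by (simp add: filterlim_at_top)
    show ?thesis using a b c 3 eventually_gt_at_top[of 0]
    proof eventually_elim
      fix n :: nat assume a: "(1 - \<kappa> / 2) * (\<gamma> n / real n) - (1 - \<kappa>) * (lam - 1) > d" and b: "\<gamma> n / real n > 0"
        and c: "real n * \<beta> n \<ge> 3 / d" and 3: "\<gamma>2 \<kappa> n \<le> \<kappa> * lam * real n" and n: "0 < n"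
      have "d * real n \<le> ((1 - \<kappa> / 2) * (\<gamma> n / real n) - (1 - \<kappa>) * (lam - 1)) * real n"
        using a by (intro mult_right_mono) auto
      also have "\<dots> = \<gamma>2 \<kappa> n - \<kappa> / 2 * \<gamma> n" using n by (simp add: \<gamma>2_def field_simps)
      finally have "\<beta> n * (d * real n) \<le> \<beta> n * (\<gamma>2 \<kappa> n - \<kappa> / 2 * \<gamma> n)" using \<beta>_pos[of n] by (intro mult_left_mono) auto
      moreover have "\<beta> n * (d * real n) \<ge> 3" using c d by (simp add: divide_le_eq mult_ac)
      ultimately have e: "\<beta> n * \<gamma>2 \<kappa> n - \<kappa> / 2 * (\<beta> n * \<gamma> n) \<ge> 3" by (simp add: algebra_simps)
      have g: "\<gamma> n > 0" using b n by (simp add: zero_less_divide_iff)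
      have "\<kappa> / 2 * (\<beta> n * \<gamma> n) \<ge> 0" using \<kappa> \<beta>_pos[of n] g by simp
      then have f: "\<beta> n * \<gamma>2 \<kappa> n > 2" using e by linarith
      have "\<kappa> / 2 * (\<beta> n * \<gamma> n - 2) \<le> \<beta> n * \<gamma>2 \<kappa> n - 2" using e \<kappa> by (simp add: right_diff_distrib)
      then have "2 / \<kappa> * (\<kappa> / 2 * (\<beta> n * \<gamma> n - 2)) \<le> 2 / \<kappa> * (\<beta> n * \<gamma>2 \<kappa> n - 2)" using \<kappa> by (intro mult_left_mono) auto
      moreover have "2 / \<kappa> * (\<kappa> / 2 * z) = z" for z using \<kappa> by simp
      ultimately have "\<beta> n * \<gamma> n - 2 \<le> 2 / \<kappa> * (\<beta> n * \<gamma>2 \<kappa> n - 2)" by (simp only:)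
      then show "\<beta> n * \<gamma>2 \<kappa> n > 2 \<and> \<beta> n * \<gamma> n - 2 \<le> 2 / \<kappa> * (\<beta> n * \<gamma>2 \<kappa> n - 2) \<and> \<gamma>2 \<kappa> n \<le> \<kappa> * lam * real n"
        using f 3 by simp
    qed
  qed
qed

lemma \<gamma>2_le: "\<kappa> \<le> 1 \<Longrightarrow> \<gamma>2 \<kappa> n \<le> \<gamma> n"
  using lam_ge by (simp add: \<gamma>2_def)

lemma eventually_finite: "\<forall>\<^sub>F n in sequentially. \<beta> n * \<gamma> n > 2"
proof -
  have "\<forall>\<^sub>F n in sequentially. \<beta> n * \<gamma>2 (1/2) n > 2"
    using rates[of "1/2"] by (rule eventually_mono[rotated 2]) auto
  then show ?thesis
  proof eventually_elim
    fix n assume *: "\<beta> n * \<gamma>2 (1/2) n > 2"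
    have "\<beta> n * \<gamma>2 (1/2) n \<le> \<beta> n * \<gamma> n" using \<gamma>2_le[of "1/2" n] \<beta>_pos[of n] by (intro mult_left_mono) auto
    then show "\<beta> n * \<gamma> n > 2" using * by linarith
  qed
qed

text \<open>The logarithm of the ratio of the upper bound for the bad set to the lower bound for
  Z_n. Divided by \<beta> n^2, the energy terms of the lower bound tend to J; one half of c absorbs
  the fluctuation and the other half, by n \<beta> -> infinity, the terms of order n.\<close>

lemma exponent_bound:
  assumes c: "c > 0" and K: "K \<ge> 0" and u0: "u0 \<ge> 0"
  shows "\<forall>\<^sub>F n in sequentially. - \<beta> n * ((real n)\<^sup>2 * (J + c)) + real n * C
     + \<beta> n * ((real n - 1) * (real n - 2) / 2 * I\<nu> + \<alpha> n * (real n - 1) * wbar)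
     + \<beta> n * K * (real n - 1 + \<alpha> n) + \<beta> n * \<gamma> n * u0 \<le> - real n"
proof -
  \<comment> \<open>The contributions of the lower bound divided by \<beta> n^2. Only n - 1
    particles sit in the disc, hence the pair count (n - 1) (n - 2) / 2; the terms with K and u0
    vanish in the limit.\<close>
  define t where "t n = ((1 - 1 / real n) * (1 - 2 * (1 / real n)) / 2 * I\<nu> + \<alpha> n / real n * (1 - 1 / real n) * wbar)
     + K * ((1 - 1 / real n) * (1 / real n) + \<alpha> n / real n * (1 / real n)) + \<gamma> n / real n * (1 / real n) * u0" for n
  have "t \<longlonglongrightarrow> ((1 - 0) * (1 - 2 * 0) / 2 * I\<nu> + lam * (1 - 0) * wbar)
     + K * ((1 - 0) * 0 + lam * 0) + (lam - 1) * 0 * u0"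
    unfolding t_def by (intro tendsto_intros inverse_n \<alpha>_lim \<gamma>_lim) simp
  then have "t \<longlonglongrightarrow> J" by (simp add: J_def)
  then have 1: "\<forall>\<^sub>F n in sequentially. t n < J + c / 2" using c by (intro order_tendstoD(2)) auto
  have 2: "\<forall>\<^sub>F n in sequentially. real n * \<beta> n \<ge> (C + 1) / (c / 2)" using n\<beta> by (simp add: filterlim_at_top)
  show ?thesis using 1 2 eventually_gt_at_top[of 0]
  proof eventually_elim
    fix n :: nat assume 1: "t n < J + c / 2" and 2: "real n * \<beta> n \<ge> (C + 1) / (c / 2)" and n: "0 < n"
    define D where "D = \<beta> n * (real n)\<^sup>2"
    have D: "D \<ge> 0" using \<beta>_pos[of n] by (simp add: D_def)
    have eq: "\<beta> n * ((real n - 1) * (real n - 2) / 2 * I\<nu> + \<alpha> n * (real n - 1) * wbar)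
     + \<beta> n * K * (real n - 1 + \<alpha> n) + \<beta> n * \<gamma> n * u0 = D * t n"
    proof -
      have "(real n)\<^sup>2 * t n = ((real n - 1) * (real n - 2) / 2 * I\<nu> + \<alpha> n * (real n - 1) * wbar)
         + K * (real n - 1 + \<alpha> n) + \<gamma> n * u0"
        using n by (simp add: t_def power2_eq_square field_simps)
      then have "D * t n = \<beta> n * (((real n - 1) * (real n - 2) / 2 * I\<nu> + \<alpha> n * (real n - 1) * wbar)
         + K * (real n - 1 + \<alpha> n) + \<gamma> n * u0)" by (simp add: D_def mult.assoc)
      then show ?thesis by (simp add: distrib_left mult.assoc)
    qed
    have "D * t n \<le> D * (J + c / 2)" using 1 D by (intro mult_left_mono) auto
    moreover have "real n * (C + 1) \<le> D * (c / 2)"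
    proof -
      have "C + 1 \<le> real n * \<beta> n * (c / 2)" using 2 c by (simp add: divide_le_eq)
      then have "real n * (C + 1) \<le> real n * (real n * \<beta> n * (c / 2))" by (intro mult_left_mono) auto
      then show ?thesis by (simp add: D_def power2_eq_square mult_ac)
    qed
    ultimately have "- (D * (J + c)) + real n * C + D * t n \<le> - real n" by (simp add: algebra_simps)
    then show "- \<beta> n * ((real n)\<^sup>2 * (J + c)) + real n * C
       + \<beta> n * ((real n - 1) * (real n - 2) / 2 * I\<nu> + \<alpha> n * (real n - 1) * wbar)
       + \<beta> n * K * (real n - 1 + \<alpha> n) + \<beta> n * \<gamma> n * u0 \<le> - real n"
      using eq by (simp add: D_def mult.assoc)
  qed
qed

lemma pairmin_measurable: "pairmin n \<in> borel_measurable (lebC n)"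
proof -
  have "(\<lambda>x. llog (x i)) \<in> borel_measurable (lebC n)" if "i < n" for i
    unfolding lebC_def using that by (intro measurable_compose[OF measurable_component_singleton]) auto
  then show ?thesis unfolding pairmin_def[abs_def] case_prod_beta
    by (intro borel_measurable_sum borel_measurable_min) auto
qed

lemma sum_llog_measurable: "(\<lambda>x. \<Sum>i<n. llog (x i)) \<in> borel_measurable (lebC n)"
  unfolding lebC_def by (intro borel_measurable_sum measurable_compose[OF measurable_component_singleton[where M="\<lambda>_. lborel"]]) auto

lemma deviation:
  assumes \<epsilon>: "\<epsilon> > 0"
  shows "\<forall>\<^sub>F n in sequentially. \<exists>B\<in>sets (lebC n).
    (\<forall>x\<in>space (lebC n). inj_on x {..<n} \<longrightarrow> dBL (empirical n x) \<nu> \<ge> \<epsilon> \<longrightarrow> x \<in> B) \<and>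
    emeasure (gibbs R (\<alpha> n) (\<beta> n) n) B \<le> ennreal (exp (- real n))"
proof (rule energy_gap[OF \<epsilon>])
  fix c \<kappa> :: real and n0 :: nat
  assume c: "c > 0" and \<kappa>: "0 < \<kappa>" "\<kappa> \<le> 1/2" and gap:
    "\<And>n al \<gamma> x. \<lbrakk>n \<ge> n0; 0 \<le> \<gamma>; \<gamma> \<le> \<kappa> * lam * real n; al - real n + 1 = (1 - \<kappa>) * (lam - 1) * real n + \<gamma>;
       inj_on x {..<n}; dBL (empirical n x) \<nu> \<ge> \<epsilon>\<rbrakk> \<Longrightarrow>
       energy R al n x \<ge> (real n)\<^sup>2 * (J + c) + \<kappa> * pairmin n x + \<gamma> * (\<Sum>i<n. llog (x i))"
  show ?thesis
  proof (rule part_fun_ge)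
    fix K u0 :: real
    assume K: "K \<ge> 0" and u0: "u0 \<ge> 0" and low:
      "\<And>m al b \<eta>. \<lbrakk>al > 0; b > 0; \<eta> > 0; b * (al - real m) = 2 + \<eta>\<rbrakk> \<Longrightarrow>
        ennreal ((pi * r\<^sup>2) ^ m * exp (- b * (real m * (real m - 1) / 2 * I\<nu> + al * real m * wbar)) *
          (exp (- b * K * (real m + al)) * (2 * pi / \<eta> * exp (- \<eta> * u0)))) \<le> part_fun R al b (Suc m)"
    define C where "C = ln (2 * pi) + ln (2 / \<kappa>) + \<bar>ln (pi * r\<^sup>2)\<bar>"
    have lpi: "ln (2 * pi) \<ge> 0" using pi_ge_two by (intro ln_ge_zero) auto
    have l\<kappa>: "ln (2 / \<kappa>) \<ge> 0" using \<kappa> by (intro ln_ge_zero) (auto simp: le_divide_eq)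
    have big: "\<forall>\<^sub>F n in sequentially. real n * \<beta> n \<ge> 4 * exp 1 / \<kappa>" using n\<beta> by (simp add: filterlim_at_top)
    show ?thesis
      using rates[OF \<kappa>] eventually_finite exponent_bound[OF c K u0, of C] big eventually_ge_at_top[of n0] eventually_ge_at_top[of 2]
    proof eventually_elim
      fix n :: nat
      assume rt: "\<beta> n * \<gamma>2 \<kappa> n > 2 \<and> \<beta> n * \<gamma> n - 2 \<le> 2 / \<kappa> * (\<beta> n * \<gamma>2 \<kappa> n - 2) \<and> \<gamma>2 \<kappa> n \<le> \<kappa> * lam * real n"
        and fin: "\<beta> n * \<gamma> n > 2" and ex: "- \<beta> n * ((real n)\<^sup>2 * (J + c)) + real n * C
       + \<beta> n * ((real n - 1) * (real n - 2) / 2 * I\<nu> + \<alpha> n * (real n - 1) * wbar)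
       + \<beta> n * K * (real n - 1 + \<alpha> n) + \<beta> n * \<gamma> n * u0 \<le> - real n"
        and big: "real n * \<beta> n \<ge> 4 * exp 1 / \<kappa>" and n0: "n \<ge> n0" and n2: "n \<ge> 2"
      define m where "m = n - 1"
      have nm: "n = Suc m" "real m = real n - 1" using n2 by (auto simp: m_def)
      define a where "a = \<beta> n * \<gamma>2 \<kappa> n - 2"
      define \<eta> where "\<eta> = \<beta> n * \<gamma> n - 2"
      have a: "a > 0" and \<eta>: "\<eta> > 0" and \<eta>a: "\<eta> \<le> 2 / \<kappa> * a" using rt fin by (auto simp: a_def \<eta>_def)
      have g20: "\<gamma>2 \<kappa> n \<ge> 0" using rt \<beta>_pos[of n] by (smt (verit) mult_nonneg_nonpos)
      let ?E = "energy R (\<alpha> n) n"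
      define T where "T = (real n)\<^sup>2 * (J + c)"
      \<comment> \<open>Defined by the energy inequality and not by \<open>dBL\<close>:
        measurability is then immediate, whereas \<open>dBL\<close> is a supremum over an
        uncountable family. By the gap, \<open>B\<close> contains all injective bad
        configurations.\<close>
      define B where "B = {x \<in> space (lebC n). ?E x \<ge> T + \<kappa> * pairmin n x + \<gamma>2 \<kappa> n * (\<Sum>i<n. llog (x i))}"
      have Em: "?E \<in> borel_measurable (lebC n)" using n2 by (intro energy_measurable) auto
      have B: "B \<in> sets (lebC n)"
        unfolding B_def using Em pairmin_measurable[of n] sum_llog_measurable[of n] by measurable
      define Z where "Z = part_fun R (\<alpha> n) (\<beta> n) n"
      have Zfin: "Z < \<infinity>" unfolding Z_def using n2 \<beta>_pos fin by (intro part_fun_finite) (auto simp: \<gamma>_def)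
      define zl where "zl = (pi * r\<^sup>2) ^ m * exp (- \<beta> n * (real m * (real m - 1) / 2 * I\<nu> + \<alpha> n * real m * wbar)) *
          (exp (- \<beta> n * K * (real m + \<alpha> n)) * (2 * pi / \<eta> * exp (- \<eta> * u0)))"
      have zl0: "zl > 0" unfolding zl_def using r_pos \<eta> by (intro mult_pos_pos divide_pos_pos) auto
      have "ennreal zl \<le> Z"
        unfolding zl_def Z_def nm(1) using \<alpha>_pos[of "Suc m"] \<beta>_pos[of "Suc m"] \<eta>
        by (intro low) (auto simp: \<eta>_def \<gamma>_def nm(1) algebra_simps)
      then have zl: "zl \<le> enn2real Z" using Zfin zl0 by (metis enn2real_ennreal enn2real_mono infinity_ennreal_def less_imp_le)
      have up: "(\<integral>\<^sup>+ x. ennreal (exp (- \<beta> n * ?E x)) * indicator B x \<partial>lebC n) \<le> ennreal (exp (- \<beta> n * T) * ((2 * pi) ^ n * (1 / a)))"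
      proof -
        have "(\<integral>\<^sup>+ x. ennreal (exp (- \<beta> n * ?E x)) * indicator B x \<partial>lebC n)
          \<le> ennreal (exp (- \<beta> n * T) * ((2 * pi) ^ n * (\<Prod>j<n. 1 / (a + \<beta> n * \<kappa> * real j / 2))))"
          using \<beta>_pos[of n] \<kappa> a by (intro energy_weight_le) (auto simp: a_def B_def)
        also have "\<dots> \<le> ennreal (exp (- \<beta> n * T) * ((2 * pi) ^ n * (1 / a)))"
        proof (intro ennreal_leI mult_left_mono)
          \<comment> \<open>As n \<ge> 2, n is at most 2 m; this is why the threshold
            \<open>big\<close> has 4 where \<open>gas_constant_le\<close> asks for 2.\<close>
          have "real n * \<beta> n \<le> 2 * real m * \<beta> n" using n2 \<beta>_pos[of n] by (intro mult_right_mono) (auto simp: nm(2))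
          then have "4 * exp 1 / \<kappa> \<le> 2 * real m * \<beta> n" using big by linarith
          then have "2 * exp 1 \<le> \<beta> n * \<kappa> * real m" using \<kappa> by (simp add: divide_le_eq mult_ac)
          then show "(\<Prod>j<n. 1 / (a + \<beta> n * \<kappa> * real j / 2)) \<le> 1 / a"
            unfolding nm(1) using a \<kappa> \<beta>_pos[of "Suc m"] by (intro gas_constant_le) (auto simp: nm(1)[symmetric])
        qed auto
        finally show ?thesis .
      qed
      have "emeasure (gibbs R (\<alpha> n) (\<beta> n) n) B = (\<integral>\<^sup>+ x. ennreal (exp (- \<beta> n * ?E x) / enn2real Z) * indicator B x \<partial>lebC n)"
        unfolding gibbs_def Z_def[symmetric] using Em B by (intro emeasure_density) auto
      also have "\<dots> = (\<integral>\<^sup>+ x. ennreal (1 / enn2real Z) * (ennreal (exp (- \<beta> n * ?E x)) * indicator B x) \<partial>lebC n)"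
        by (intro nn_integral_cong) (simp add: ennreal_mult'[symmetric] indicator_def)
      also have "\<dots> = ennreal (1 / enn2real Z) * (\<integral>\<^sup>+ x. ennreal (exp (- \<beta> n * ?E x)) * indicator B x \<partial>lebC n)"
        using Em B by (intro nn_integral_cmult) auto
      also have "\<dots> \<le> ennreal (1 / zl) * ennreal (exp (- \<beta> n * T) * ((2 * pi) ^ n * (1 / a)))"
        using up zl zl0 by (intro mult_mono ennreal_leI divide_left_mono) auto
      also have "\<dots> = ennreal (1 / zl * (exp (- \<beta> n * T) * ((2 * pi) ^ n * (1 / a))))"
        using zl0 by (intro ennreal_mult'[symmetric]) auto
      also have "\<dots> \<le> ennreal (exp (- real n))"
      proof (rule ennreal_leI)
        define e1 where "e1 = real m * (real m - 1) / 2 * I\<nu> + \<alpha> n * real m * wbar"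
        have zl_exp: "zl = exp (real m * ln (pi * r\<^sup>2) - \<beta> n * e1 - \<beta> n * K * (real m + \<alpha> n) - \<eta> * u0 + ln (2 * pi)) / \<eta>"
          unfolding zl_def e1_def[symmetric] using r_pos
          by (simp add: exp_add exp_diff exp_minus exp_of_nat_mult field_simps)
        have p2: "(2 * pi) ^ n = exp (real n * ln (2 * pi))"
          by (simp add: exp_of_nat_mult)
        \<comment> \<open>Here the singular factors meet: 1 / a from the bad set and 1 / \<eta> from
          Z_n. Each may be unbounded, but by \<open>rates\<close> their ratio is at most 2 /
          \<kappa>.\<close>
        have "1 / a \<le> exp (ln (2 / \<kappa>)) / \<eta>"
          using \<eta>a a \<eta> \<kappa> by (simp add: field_simps)
        then have "1 / zl * (exp (- \<beta> n * T) * ((2 * pi) ^ n * (1 / a))) \<le> 1 / zl * (exp (- \<beta> n * T) * ((2 * pi) ^ n * (exp (ln (2 / \<kappa>)) / \<eta>)))"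
          using zl0 by (intro mult_left_mono) auto
        also have "\<dots> = exp (- \<beta> n * T + real n * ln (2 * pi) + ln (2 / \<kappa>) -
            (real m * ln (pi * r\<^sup>2) - \<beta> n * e1 - \<beta> n * K * (real m + \<alpha> n) - \<eta> * u0 + ln (2 * pi)))"
          unfolding zl_exp p2 exp_diff exp_add using \<eta> by simp
        also have "\<dots> \<le> exp (- real n)"
        proof -
          have 1: "ln (2 / \<kappa>) \<le> real n * ln (2 / \<kappa>)" using l\<kappa> n2 mult_right_mono[of 1 "real n" "ln (2 / \<kappa>)"] by simp
          have 2: "- (real m * ln (pi * r\<^sup>2)) \<le> real n * \<bar>ln (pi * r\<^sup>2)\<bar>"
          proof -
            have "- (real m * ln (pi * r\<^sup>2)) \<le> real m * \<bar>ln (pi * r\<^sup>2)\<bar>"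
              unfolding mult_minus_right[symmetric] by (intro mult_left_mono) auto
            also have "\<dots> \<le> real n * \<bar>ln (pi * r\<^sup>2)\<bar>" by (intro mult_right_mono) (simp_all add: nm(2))
            finally show ?thesis .
          qed
          have 3: "\<eta> * u0 \<le> \<beta> n * \<gamma> n * u0" using u0 by (intro mult_right_mono) (auto simp: \<eta>_def)
          have 4: "e1 = (real n - 1) * (real n - 2) / 2 * I\<nu> + \<alpha> n * (real n - 1) * wbar"
            by (simp add: e1_def nm(2))
          have 5: "real n * C = real n * ln (2 * pi) + real n * ln (2 / \<kappa>) + real n * \<bar>ln (pi * r\<^sup>2)\<bar>"
            by (simp add: C_def algebra_simps)
          have 6: "\<beta> n * K * (real m + \<alpha> n) = \<beta> n * K * (real n - 1 + \<alpha> n)" by (simp add: nm(2))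
          have "- \<beta> n * T + real n * ln (2 * pi) + ln (2 / \<kappa>) -
            (real m * ln (pi * r\<^sup>2) - \<beta> n * e1 - \<beta> n * K * (real m + \<alpha> n) - \<eta> * u0 + ln (2 * pi)) \<le> - real n"
            using ex 1 2 3 5 lpi unfolding T_def[symmetric] 4[symmetric] 6 by linarith
          then show ?thesis by simp
        qed
        finally show "1 / zl * (exp (- \<beta> n * T) * ((2 * pi) ^ n * (1 / a))) \<le> exp (- real n)" .
      qed
      finally have "emeasure (gibbs R (\<alpha> n) (\<beta> n) n) B \<le> ennreal (exp (- real n))" .
      moreover have "x \<in> B" if "x \<in> space (lebC n)" "inj_on x {..<n}" "dBL (empirical n x) \<nu> \<ge> \<epsilon>" for x
      proof -
        have "?E x \<ge> (real n)\<^sup>2 * (J + c) + \<kappa> * pairmin n x + \<gamma>2 \<kappa> n * (\<Sum>i<n. llog (x i))"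
          using rt g20 by (intro gap[OF n0 _ _ _ that(2,3)]) (auto simp: \<gamma>2_def \<gamma>_def)
        then show ?thesis using that(1) by (simp add: B_def T_def)
      qed
      ultimately show "\<exists>B\<in>sets (lebC n). (\<forall>x\<in>space (lebC n). inj_on x {..<n} \<longrightarrow> dBL (empirical n x) \<nu> \<ge> \<epsilon> \<longrightarrow> x \<in> B) \<and>
        emeasure (gibbs R (\<alpha> n) (\<beta> n) n) B \<le> ennreal (exp (- real n))"
        using B by blast
    qed
  qed
qed

text \<open>Borel-Cantelli for each tolerance. Only the law of each single \<open>X n\<close>
  enters, so every coupling is covered. Injectivity holds almost surely because the Gibbs measure
  has a density.\<close>

lemma almost_sure_convergence:
  fixes M :: "'a measure" and X :: "nat \<Rightarrow> 'a \<Rightarrow> nat \<Rightarrow> complex"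
  assumes "prob_space M" and X: "\<And>n. n \<ge> N \<Longrightarrow> X n \<in> measurable M (lebC n)"
    and D: "\<And>n. n \<ge> N \<Longrightarrow> distr M (lebC n) (X n) = gibbs R (\<alpha> n) (\<beta> n) n"
  shows "AE \<omega> in M. (\<lambda>n. dBL (empirical n (X n \<omega>)) \<nu>) \<longlonglongrightarrow> 0"
proof -
  interpret prob_space M by fact
  have "AE \<omega> in M. n \<ge> N \<longrightarrow> inj_on (X n \<omega>) {..<n}" for n
  proof (cases "n \<ge> N")
    case True
    show ?thesis
    proof (cases "n > 0")
      case n: True
      have "energy R (\<alpha> n) n \<in> borel_measurable (lebC n)" using n by (rule energy_measurable)
      then have "AE x in gibbs R (\<alpha> n) (\<beta> n) n. inj_on x {..<n}"
        unfolding gibbs_def using AE_lebC_inj[of n] by (subst AE_density) auto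
      then have "AE \<omega> in M. inj_on (X n \<omega>) {..<n}"
        unfolding D[OF True, symmetric] using AE_distrD[OF X[OF True]] by blast
      then show ?thesis by simp
    qed simp
  qed simp
  then have inj: "AE \<omega> in M. \<forall>n. n \<ge> N \<longrightarrow> inj_on (X n \<omega>) {..<n}" by (simp add: AE_all_countable)
  have ev: "AE \<omega> in M. \<forall>\<^sub>F n in sequentially. dBL (empirical n (X n \<omega>)) \<nu> < \<epsilon>" if \<epsilon>: "\<epsilon> > 0" for \<epsilon>
  proof -
    obtain N1 where N1: "\<And>n. n \<ge> N1 \<Longrightarrow> \<exists>B\<in>sets (lebC n).
      (\<forall>x\<in>space (lebC n). inj_on x {..<n} \<longrightarrow> dBL (empirical n x) \<nu> \<ge> \<epsilon> \<longrightarrow> x \<in> B) \<and>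
      emeasure (gibbs R (\<alpha> n) (\<beta> n) n) B \<le> ennreal (exp (- real n))"
      using deviation[OF \<epsilon>] unfolding eventually_sequentially by blast
    then have "\<forall>n. \<exists>B. n \<ge> N1 \<longrightarrow> B \<in> sets (lebC n) \<and>
      (\<forall>x\<in>space (lebC n). inj_on x {..<n} \<longrightarrow> dBL (empirical n x) \<nu> \<ge> \<epsilon> \<longrightarrow> x \<in> B) \<and>
      emeasure (gibbs R (\<alpha> n) (\<beta> n) n) B \<le> ennreal (exp (- real n))" by blast
    then obtain B where B: "\<And>n. n \<ge> N1 \<Longrightarrow> B n \<in> sets (lebC n)"
      "\<And>n x. n \<ge> N1 \<Longrightarrow> x \<in> space (lebC n) \<Longrightarrow> inj_on x {..<n} \<Longrightarrow> dBL (empirical n x) \<nu> \<ge> \<epsilon> \<Longrightarrow> x \<in> B n"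
      "\<And>n. n \<ge> N1 \<Longrightarrow> emeasure (gibbs R (\<alpha> n) (\<beta> n) n) (B n) \<le> ennreal (exp (- real n))"
      by metis
    define N2 where "N2 = max N N1"
    \<comment> \<open>Below N2 nothing is known about \<open>X n\<close> or \<open>B n\<close>; the
      empty set is put there so that the events are defined for all n.\<close>
    define A where "A n = (if n \<ge> N2 then X n -` B n \<inter> space M else {})" for n
    have Am: "A n \<in> sets M" for n
      using X[of n] B(1)[of n] by (auto simp: A_def N2_def intro: measurable_sets)
    have Ab: "measure M (A n) \<le> exp (- real n)" for n
    proof (cases "n \<ge> N2")
      case True
      then have n: "n \<ge> N" "n \<ge> N1" by (auto simp: N2_def)
      have "emeasure M (A n) = emeasure (distr M (lebC n) (X n)) (B n)"
        using True X[OF n(1)] B(1)[OF n(2)] by (simp add: A_def emeasure_distr)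
      also have "\<dots> \<le> ennreal (exp (- real n))" unfolding D[OF n(1)] by (rule B(3)[OF n(2)])
      finally show ?thesis by (simp add: emeasure_eq_measure)
    qed (simp add: A_def)
    have "summable (\<lambda>n. exp (- 1 :: real) ^ n)" by (intro summable_geometric) simp
    then have "summable (\<lambda>n. exp (- real n))" by (simp add: exp_of_nat_mult[symmetric])
    then have "summable (\<lambda>n. measure M (A n))"
      by (rule summable_comparison_test'[where N=0]) (use Ab in auto)
    from borel_cantelli_AE1[OF Am _ this]
    have "AE \<omega> in M. \<forall>\<^sub>F n in sequentially. \<omega> \<in> space M - A n" by (simp add: less_top[symmetric])
    then show ?thesis using inj AE_space
    proof eventually_elim
      fix \<omega> assume e: "\<forall>\<^sub>F n in sequentially. \<omega> \<in> space M - A n" and i: "\<forall>n\<ge>N. inj_on (X n \<omega>) {..<n}" and \<omega>: "\<omega> \<in> space M"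
      show "\<forall>\<^sub>F n in sequentially. dBL (empirical n (X n \<omega>)) \<nu> < \<epsilon>"
        using e eventually_ge_at_top[of N2]
      proof eventually_elim
        fix n assume nA: "\<omega> \<in> space M - A n" and n: "N2 \<le> n"
        show "dBL (empirical n (X n \<omega>)) \<nu> < \<epsilon>"
        proof (rule ccontr)
          assume "\<not> dBL (empirical n (X n \<omega>)) \<nu> < \<epsilon>"
          then have "X n \<omega> \<in> B n"
            using n i \<omega> measurable_space[OF X[of n]] by (intro B(2)) (auto simp: N2_def)
          then show False using nA n \<omega> by (simp add: A_def)
        qed
      qed
    qed
  qed
  \<comment> \<open>Countably many tolerances, so that the exceptional null sets can be
    united.\<close>
  have "AE \<omega> in M. \<forall>k. \<forall>\<^sub>F n in sequentially. dBL (empirical n (X n \<omega>)) \<nu> < 1 / real (Suc k)"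
    unfolding AE_all_countable by (intro allI ev) simp
  then show ?thesis
  proof eventually_elim
    fix \<omega> assume *: "\<forall>k. \<forall>\<^sub>F n in sequentially. dBL (empirical n (X n \<omega>)) \<nu> < 1 / real (Suc k)"
    show "(\<lambda>n. dBL (empirical n (X n \<omega>)) \<nu>) \<longlonglongrightarrow> 0"
    proof (rule order_tendstoI)
      fix e :: real assume "e < 0"
      then show "\<forall>\<^sub>F n in sequentially. e < dBL (empirical n (X n \<omega>)) \<nu>"
        using dBL_nonneg[OF empirical_prob \<nu>.prob_space_axioms] by (intro always_eventually allI) (meson less_le_trans)
    next
      fix e :: real assume "e > 0"
      then obtain k where k: "1 / real (Suc k) < e" by (meson nat_approx_posE)
      show "\<forall>\<^sub>F n in sequentially. dBL (empirical n (X n \<omega>)) \<nu> < e"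
        using *[rule_format, of k] by eventually_elim (use k in linarith)
    qed
  qed
qed

end

theorem theorem1p2:
  fixes R lam :: real and \<alpha> \<beta> :: "nat \<Rightarrow> real"
  assumes R_pos: "R > 0"
    and \<alpha>_pos: "\<And>n. \<alpha> n > 0" and \<beta>_pos: "\<And>n. \<beta> n > 0"
    and n\<beta>: "filterlim (\<lambda>n. real n * \<beta> n) at_top sequentially"
    and \<alpha>_lim: "(\<lambda>n. \<alpha> n / real n) \<longlonglongrightarrow> lam"
    and lam_ge: "lam \<ge> 1"
    and crit: "lam = 1 \<Longrightarrow> eventually (\<lambda>n. \<alpha> n - real n > 2 / \<beta> n - 1) sequentially"
  shows "(\<exists>N. \<forall>n\<ge>N. part_fun R (\<alpha> n) (\<beta> n) n < \<infinity>) \<and>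
         (\<forall>(M :: 'a measure) (X :: nat \<Rightarrow> 'a \<Rightarrow> (nat \<Rightarrow> complex)) N.
            prob_space M \<longrightarrow>
            (\<forall>n\<ge>N. part_fun R (\<alpha> n) (\<beta> n) n < \<infinity> \<and>
                    X n \<in> measurable M (lebC n) \<and>
                    distr M (lebC n) (X n) = gibbs R (\<alpha> n) (\<beta> n) n) \<longrightarrow>
            (AE \<omega> in M. (\<lambda>n. dBL (empirical n (X n \<omega>)) (unif_disc (R / sqrt lam))) \<longlonglongrightarrow> 0))"
proof -
  interpret jellium_seq R lam \<alpha> \<beta>
    by unfold_locales (use assms in auto)
  have "\<forall>\<^sub>F n in sequentially. part_fun R (\<alpha> n) (\<beta> n) n < \<infinity>"
    using eventually_finite eventually_gt_at_top[of 0]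
    by eventually_elim (intro part_fun_finite, use \<beta>_pos in \<open>auto simp: \<gamma>_def\<close>)
  moreover have "unif_disc (R / sqrt lam) = \<nu>" by (simp add: \<nu>_def r_def)
  moreover have "AE \<omega> in M. (\<lambda>n. dBL (empirical n (X n \<omega>)) \<nu>) \<longlonglongrightarrow> 0"
    if "prob_space M" and X: "\<forall>n\<ge>N. part_fun R (\<alpha> n) (\<beta> n) n < \<infinity> \<and> X n \<in> measurable M (lebC n) \<and>
      distr M (lebC n) (X n) = gibbs R (\<alpha> n) (\<beta> n) n" for M :: "'a measure" and X N
    using almost_sure_convergence[OF that(1), of N X] X by blast
  ultimately show ?thesis
    by (simp add: eventually_sequentially)
qed

end
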